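(* Let $T$ be a rooted tree on a countably infinite vertex set $X$, let $P$ be the set of all paths in $T$ starting at the root, and let $\mathcal{P}_\omega$ be a fixed $\aleph_0$-unbounded partition of $X$. Then one of the following holds: (i) $T$ contains a subtree in which every vertex has a descendant of infinite degree, and $\mathcal{S}(T) \approx_I I_X$; (ii) $T$ does not satisfy (i) but contains a subtree in which every vertex has a descendant of degree at least $3$, and $\mathcal{S}(T) \approx_I \operatorname{PStab}(\mathcal{P}_\omega)$; (iii) $P$ is countable and $\mathcal{S}(T) \approx_I \emptyset$.
   Context: For a set $X$, $I_X$ is the symmetric inverse monoid: the set of all bijections between subsets of $X$ (partial bijections, called charts) under composition of partial functions, written left to right. For subsemigroups $S_1, S_2$ of $I_X$ (the empty set being allowed), write $S_1 \preccurlyeq_I S_2$ if there is a finite set $U \subseteq I_X$ such that $S_1 \subseteq \langle S_2 \cup U \rangle$, where $\langle\cdot\rangle$ denotes the semigroup generated; $S_1 \approx_I S_2$ means $S_1 \preccurlyeq_I S_2$ and $S_2 \preccurlyeq_I S_1$. A partition of $X$ is $\aleph_0$-unbounded if all its parts are finite but there is no finite common bound on their cardinalities. $\operatorname{PStab}(\mathcal{P}) = \{ f \in \operatorname{Sym}(X) \mid \Sigma f = \Sigma \text{ for all } \Sigma \in \mathcal{P} \}$ is the partwise stabiliser of a partition $\mathcal{P}$. A rooted tree on $X$ is a connected graph without cycles on the vertex set $X$ with one vertex designated as the root. For distinct vertices $x,y$, $y$ is a descendant of $x$ if $x$ lies on the path from $y$ to the root. The degree of a vertex is the number of vertices adjacent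 to it. A subtree of $T$ is a subgraph of $T$ which is itself a rooted tree with the same root as $T$; in (i) and (ii), descendants and degrees are taken in the subtree. A path is a finite or infinite ($\omega$-indexed) sequence of distinct vertices with consecutive entries adjacent; $P$ is the set of all (finite or infinite) paths starting at the root. For $p = (x_i)_{i}\in P$ and $f \in I_X$ with domain equal to the set of vertices on $p$, $pf$ denotes the sequence $(x_i f)_i$. $\mathcal{S}(T)$ is the inverse semigroup of path-bijections on $T$: the set of all $f \in I_X$ for which there exist $p,q \in P$ such that $\operatorname{dom}(f)$ is the set of vertices on $p$ and $pf = q$. *)

theory Defs
  imports Main "HOL-Library.Countable_Set" "HOL-Library.Disjoint_Sets" "HOL-Library.Extended_Nat"
begin

section \<open>The symmetric inverse monoid\<close>

text \<open>Charts of \<open>X\<close> are partial maps. Composition is written left to right in the source, so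
  the product \<open>f g\<close> (first \<open>f\<close>, then \<open>g\<close>) is \<open>g \<circ>\<^sub>m f\<close>.\<close>

definition sym_inv_monoid :: "'a set \<Rightarrow> ('a \<rightharpoonup> 'a) set" where
  "sym_inv_monoid X = {f. dom f \<subseteq> X \<and> ran f \<subseteq> X \<and> inj_on f (dom f)}"

definition sym_group :: "'a set \<Rightarrow> ('a \<rightharpoonup> 'a) set" where
  "sym_group X = {f \<in> sym_inv_monoid X. dom f = X \<and> ran f = X}"

inductive_set semigroup_gen :: "('a \<rightharpoonup> 'a) set \<Rightarrow> ('a \<rightharpoonup> 'a) set"
  for A :: "('a \<rightharpoonup> 'a) set" where
  base: "f \<in> A \<Longrightarrow> f \<in> semigroup_gen A"
| mult: "f \<in> semigroup_gen A \<Longrightarrow> g \<in> semigroup_gen A \<Longrightarrow> g \<circ>\<^sub>m f \<in> semigroup_gen A"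

definition preceq_I :: "'a set \<Rightarrow> ('a \<rightharpoonup> 'a) set \<Rightarrow> ('a \<rightharpoonup> 'a) set \<Rightarrow> bool" where
  "preceq_I X S1 S2 \<longleftrightarrow>
     (\<exists>U. finite U \<and> U \<subseteq> sym_inv_monoid X \<and> S1 \<subseteq> semigroup_gen (S2 \<union> U))"

definition approx_I :: "'a set \<Rightarrow> ('a \<rightharpoonup> 'a) set \<Rightarrow> ('a \<rightharpoonup> 'a) set \<Rightarrow> bool" where
  "approx_I X S1 S2 \<longleftrightarrow> preceq_I X S1 S2 \<and> preceq_I X S2 S1"

section \<open>Partitions and partwise stabilisers\<close>

definition aleph0_unbounded_partition :: "'a set \<Rightarrow> 'a set set \<Rightarrow> bool" where
  "aleph0_unbounded_partition X \<P> \<longleftrightarrow>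
     partition_on X \<P> \<and> (\<forall>A\<in>\<P>. finite A) \<and> \<not> (\<exists>n. \<forall>A\<in>\<P>. card A \<le> n)"

definition pimage :: "('a \<rightharpoonup> 'b) \<Rightarrow> 'a set \<Rightarrow> 'b set" where
  "pimage f A = {y. \<exists>x\<in>A. f x = Some y}"

definition PStab :: "'a set \<Rightarrow> 'a set set \<Rightarrow> ('a \<rightharpoonup> 'a) set" where
  "PStab X \<P> = {f \<in> sym_group X. \<forall>A\<in>\<P>. pimage f A = A}"

section \<open>Rooted trees\<close>

text \<open>Undirected simple graphs with a distinguished vertex; edges are two-element sets of
  vertices.\<close>

record 'a rooted_graph =
  gverts :: "'a set"
  gedges :: "'a set set"
  groot :: 'a

definition neighbours :: "'a rooted_graph \<Rightarrow> 'a \<Rightarrow> 'a set" where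
  "neighbours T x = {y \<in> gverts T. {x, y} \<in> gedges T}"

definition vdegree :: "'a rooted_graph \<Rightarrow> 'a \<Rightarrow> enat" where
  "vdegree T x = (if finite (neighbours T x) then enat (card (neighbours T x)) else \<infinity>)"

text \<open>A finite or infinite sequence \<open>(x\<^sub>i)\<^sub>i\<close> is a partial map on \<open>nat\<close> whose domain is
  \<open>{..<n}\<close> for some \<open>n\<close> or all of \<open>nat\<close>; the set of its vertices is its range.\<close>

definition is_path :: "'a rooted_graph \<Rightarrow> (nat \<rightharpoonup> 'a) \<Rightarrow> bool" where
  "is_path T p \<longleftrightarrow>
     ((\<exists>n. dom p = {..<n}) \<or> dom p = UNIV) \<and>
     ran p \<subseteq> gverts T \<and> inj_on p (dom p) \<and>
     (\<forall>i x y. p i = Some x \<longrightarrow> p (Suc i) = Some y \<longrightarrow> {x, y} \<in> gedges T)"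

text \<open>The index \<open>n\<close> is the number of edges of the path.\<close>

definition path_from_to :: "'a rooted_graph \<Rightarrow> 'a \<Rightarrow> (nat \<rightharpoonup> 'a) \<Rightarrow> nat \<Rightarrow> 'a \<Rightarrow> bool" where
  "path_from_to T x p n y \<longleftrightarrow> is_path T p \<and> dom p = {..n} \<and> p 0 = Some x \<and> p n = Some y"

definition graph_connected :: "'a rooted_graph \<Rightarrow> bool" where
  "graph_connected T \<longleftrightarrow> (\<forall>x\<in>gverts T. \<forall>y\<in>gverts T. \<exists>p n. path_from_to T x p n y)"

text \<open>A cycle is a path with at least three vertices whose end points are adjacent.\<close>

definition has_cycle :: "'a rooted_graph \<Rightarrow> bool" where
  "has_cycle T \<longleftrightarrow> (\<exists>x p n y. path_from_to T x p n y \<and> 2 \<le> n \<and> {y, x} \<in> gedges T)"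

definition rooted_tree :: "'a rooted_graph \<Rightarrow> bool" where
  "rooted_tree T \<longleftrightarrow>
     (\<forall>e\<in>gedges T. e \<subseteq> gverts T \<and> card e = 2) \<and> groot T \<in> gverts T \<and>
     graph_connected T \<and> \<not> has_cycle T"

definition descendant :: "'a rooted_graph \<Rightarrow> 'a \<Rightarrow> 'a \<Rightarrow> bool" where
  "descendant T x y \<longleftrightarrow> x \<noteq> y \<and> (\<exists>p n. path_from_to T y p n (groot T) \<and> x \<in> ran p)"

definition subtree :: "'a rooted_graph \<Rightarrow> 'a rooted_graph \<Rightarrow> bool" where
  "subtree T' T \<longleftrightarrow>
     rooted_tree T' \<and> gverts T' \<subseteq> gverts T \<and> gedges T' \<subseteq> gedges T \<and> groot T' = groot T"

section \<open>Path-bijections\<close>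

definition root_paths :: "'a rooted_graph \<Rightarrow> (nat \<rightharpoonup> 'a) set" where
  "root_paths T = {p. is_path T p \<and> p 0 = Some (groot T)}"

text \<open>For \<open>dom f = ran p\<close>, the sequence \<open>p f = (x\<^sub>i f)\<^sub>i\<close> is \<open>f \<circ>\<^sub>m p\<close>.\<close>

definition path_bijections :: "'a rooted_graph \<Rightarrow> ('a \<rightharpoonup> 'a) set" where
  "path_bijections T =
     {f \<in> sym_inv_monoid (gverts T).
        \<exists>p\<in>root_paths T. \<exists>q\<in>root_paths T. dom f = ran p \<and> f \<circ>\<^sub>m p = q}"

end

theory Submission imports Defs begin

text \<open>Countably many charts never matter, because any countable set of charts lies in a finitely
  generated subsemigroup; so only infinite paths from the root (rays) are relevant. Call a set of
  rays \<open>\<sigma>\<close>-bounded if it is a countable union of sets that meet each level in finitely many vertices.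
  Keeping only the vertices through which there pass uncountably many rays (respectively a set
  of rays that is not \<open>\<sigma>\<close>-bounded) gives the subtree of (ii) (respectively (i)) unless the set of
  all rays is countable (respectively \<open>\<sigma>\<close>-bounded).

  If the rays are \<open>\<sigma>\<close>-bounded, each bounded set of rays is placed, level by level, in parts of
  \<open>\<P>\<^sub>\<omega>\<close> that are large enough for a permutation of the parts to select any ray of the set.
  In a binary branching tree, an element \<open>\<sigma>\<close> of the partwise stabiliser is coded by a ray
  that has decided the restriction of \<open>\<sigma>\<close> to the \<open>k\<close>-th part before it reaches the levels representing this
  part; a single chart, which reads off the code, then acts as \<open>\<sigma>\<close> on every such ray.
  With infinite branching, a ray can also choose the lengths of the blocks into which it
  cuts the levels, and conjugation carries the partwise stabiliser to all partial injections that preserve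
  these blocks. Every partial injection is a product of two such maps.\<close>

section \<open>Charts as relations, and generation\<close>

text \<open>A path-bijection carries each vertex to one of the same level, and the finitely many
  further charts are fixed in advance although uncountably many maps have to be produced. A fixed
  chart must therefore recognise from the single vertex in front of it what to do, and it may act
  differently for two maps only where the rays coding them have already separated. This obstacle
  shapes both lower bounds. With binary branching, the number of levels needed for a letter depends
  on the size of its alphabet, so the levels are laid out beforehand, in the same way for all maps.
  What is coded must then respect one fixed sequence of finite sets, which is what the partwise
  stabiliser does. A vertex with infinitely many children can announce an arbitrary number in one
  step, hence the layout itself may depend on the map. A single layout still fails for pairs that
  cross its bounds. Two staggered layouts suffice because a partial injection relates a finite set
  to finitely many points only, in either direction.\<close>

definition chart :: "('a \<times> 'a) set \<Rightarrow> 'a \<rightharpoonup> 'a" where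
  "chart R x = (if \<exists>y. (x, y) \<in> R then Some (THE y. (x, y) \<in> R) else None)"

text \<open>Relations compose from left to right and have converses, so long products can be checked
  as sets of pairs. \<open>chart\<close> is multiplicative on \<open>biunique\<close> relations,
  which is why this property accompanies every factor.\<close>

definition biunique :: "('a \<times> 'b) set \<Rightarrow> bool" where
  "biunique R \<longleftrightarrow> single_valued R \<and> single_valued (R\<inverse>)"

lemma biuniqueI:
  assumes "\<And>x y z. (x, y) \<in> R \<Longrightarrow> (x, z) \<in> R \<Longrightarrow> y = z"
    and "\<And>x x' y. (x, y) \<in> R \<Longrightarrow> (x', y) \<in> R \<Longrightarrow> x = x'"
  shows "biunique R"
  using assms by (auto simp: biunique_def single_valued_def)

lemma biunique_right: "biunique R \<Longrightarrow> (x, y) \<in> R \<Longrightarrow> (x, z) \<in> R \<Longrightarrow> y = z"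
  by (auto simp: biunique_def single_valued_def)

lemma biunique_left: "biunique R \<Longrightarrow> (x, z) \<in> R \<Longrightarrow> (y, z) \<in> R \<Longrightarrow> x = y"
  by (auto simp: biunique_def single_valued_def)

lemma biunique_converse: "biunique R \<Longrightarrow> biunique (R\<inverse>)"
  by (auto simp: biunique_def)

lemma biunique_O: "biunique R \<Longrightarrow> biunique S \<Longrightarrow> biunique (R O S)"
  by (auto simp: biunique_def single_valued_relcomp converse_relcomp)

lemma chart_eq_Some:
  assumes "biunique R"
  shows "chart R x = Some y \<longleftrightarrow> (x, y) \<in> R"
proof -
  have "(THE y. (x, y) \<in> R) = y" if "(x, y) \<in> R" for y
    using that biunique_right[OF assms] by blast
  then show ?thesis unfolding chart_def by auto
qed

lemma map_eqI: "(\<And>x y. f x = Some y \<longleftrightarrow> g x = Some y) \<Longrightarrow> f = g"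
  by (metis (no_types, opaque_lifting) ext not_None_eq)

lemma chart_O:
  assumes "biunique R" "biunique S"
  shows "chart (R O S) = chart S \<circ>\<^sub>m chart R"
  by (rule map_eqI)
    (auto simp: chart_eq_Some assms biunique_O map_comp_Some_iff)

lemma chart_graph: "chart (Map.graph f) = f"
  by (rule map_eqI) (auto simp: chart_def Map.graph_def split: if_splits)

lemma chart_in_sym_inv_monoid:
  assumes "biunique R" "R \<subseteq> X \<times> X"
  shows "chart R \<in> sym_inv_monoid X"
  unfolding sym_inv_monoid_def
  using assms chart_eq_Some[OF assms(1)]
  by (auto simp: ran_def inj_on_def dom_def) (metis biunique_left)

lemma biunique_graph:
  assumes "f \<in> sym_inv_monoid X"
  shows "biunique (Map.graph f)"
  using assms by (intro biuniqueI) (auto simp: Map.graph_def sym_inv_monoid_def inj_on_def dom_def)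

lemma graph_subset:
  assumes "f \<in> sym_inv_monoid X"
  shows "Map.graph f \<subseteq> X \<times> X"
  using assms by (auto simp: Map.graph_def sym_inv_monoid_def ran_def)

lemma semigroup_gen_subset:
  assumes "A \<subseteq> semigroup_gen B"
  shows "semigroup_gen A \<subseteq> semigroup_gen B"
proof
  fix f assume "f \<in> semigroup_gen A"
  then show "f \<in> semigroup_gen B"
    by induction (use assms in \<open>auto intro: semigroup_gen.mult\<close>)
qed

lemma semigroup_gen_mono: "A \<subseteq> B \<Longrightarrow> semigroup_gen A \<subseteq> semigroup_gen B"
  by (rule semigroup_gen_subset) (auto intro: semigroup_gen.base)

lemma chart_O_gen:
  assumes "chart R \<in> semigroup_gen A" "chart S \<in> semigroup_gen A" "biunique R" "biunique S"
  shows "chart (R O S) \<in> semigroup_gen A"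
  unfolding chart_O[OF assms(3,4)] by (rule semigroup_gen.mult[OF assms(1,2)])

lemma converse_relpow:
  fixes R :: "('a \<times> 'a) set"
  shows "(R ^^ n)\<inverse> = R\<inverse> ^^ n"
proof (induction n)
  case (Suc n)
  then show ?case by (simp add: converse_relcomp relpow_commute[where R = "R\<inverse>", symmetric])
qed auto

text \<open>A semigroup need not contain an identity, and for \<open>n = 0\<close> the relation
  \<open>B ^^ n\<close> is the identity of the whole type. The factor \<open>R\<close> in front
  keeps the product in the generated semigroup for every \<open>n\<close>.\<close>

lemma chart_funpow_gen:
  assumes "chart R \<in> semigroup_gen A" "chart B \<in> semigroup_gen A" "biunique R" "biunique B"
  shows "chart (R O B ^^ n) \<in> semigroup_gen A \<and> biunique (B ^^ n)"
proof (induction n)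
  case 0
  show ?case using assms by (simp add: biunique_def)
next
  case (Suc n)
  have "R O B ^^ Suc n = (R O B ^^ n) O B" by (simp add: O_assoc)
  moreover have "biunique (R O B ^^ n)"
    using Suc assms by (blast intro: biunique_O)
  ultimately show ?case
    using Suc assms chart_O_gen[of "R O B ^^ n" A B] biunique_O[of "B ^^ n" B] by auto
qed

text \<open>Sierpinski's argument: with disjoint copies \<open>c ` ({n} \<times> X)\<close> of \<open>X\<close> inside \<open>X\<close>, a single
  chart acts as the \<open>n\<close>-th given chart on the \<open>n\<close>-th copy, and two charts reach that copy.\<close>

lemma countable_subset_finitely_generated:
  assumes X: "countable X" "infinite X" and C: "countable C" "C \<subseteq> sym_inv_monoid X"
  obtains U where "finite U" "U \<subseteq> sym_inv_monoid X" "C \<subseteq> semigroup_gen U"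
proof (cases "C = {}")
  case True
  then show ?thesis using that[of "{}"] by auto
next
  case False
  then obtain F :: "nat \<Rightarrow> 'a \<rightharpoonup> 'a" where F: "range F = C"
    using range_from_nat_into[OF False C(1)] by metis
  have FX: "F n \<in> sym_inv_monoid X" for n using F C(2) by auto
  have "countable (UNIV \<times> X :: (nat \<times> 'a) set)" "infinite (UNIV \<times> X :: (nat \<times> 'a) set)"
    using X by (auto simp: finite_cartesian_product_iff)
  then obtain c where c: "bij_betw c (UNIV \<times> X :: (nat \<times> 'a) set) X"
    using bij_betw_trans[OF to_nat_on_infinite bij_betw_from_nat_into[OF X]] by metis
  have cinj: "c (m, x) = c (n, y) \<longleftrightarrow> m = n \<and> x = y" if "x \<in> X" "y \<in> X" for m n x y
    using bij_betw_imp_inj_on[OF c] that by (auto simp: inj_on_def)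
  have cX: "c (m, x) \<in> X" if "x \<in> X" for m x
    using c that by (auto dest: bij_betwE)
  define a where "a = {(x, c (0, x)) | x. x \<in> X}"
  define b where "b = {(c (n, x), c (Suc n, x)) | n x. x \<in> X}"
  define g where "g = {(c (n, x), c (n, y)) | n x y. x \<in> X \<and> y \<in> X \<and> F n x = Some y}"
  have Fd: "x \<in> X" "y \<in> X" if "F n x = Some y" for n x y
    using FX[of n] that by (auto simp: sym_inv_monoid_def ran_def)
  have Finj: "x = x'" if "F n x = Some y" "F n x' = Some y" for n x x' y
    using FX[of n] that by (auto simp: sym_inv_monoid_def inj_on_def dom_def)
  have bi: "biunique a" "biunique b" "biunique g"
    unfolding a_def b_def g_def
    by (rule biuniqueI; auto simp: cinj Fd dest: Fd Finj)+
  have sub: "a \<subseteq> X \<times> X" "b \<subseteq> X \<times> X" "g \<subseteq> X \<times> X"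
    unfolding a_def b_def g_def by (auto simp: cX dest: Fd)
  define U where "U = chart ` {a, b, g, a\<inverse>, b\<inverse>}"
  have "finite U" "U \<subseteq> sym_inv_monoid X"
    unfolding U_def using bi sub
    by (auto intro!: chart_in_sym_inv_monoid biunique_converse)
  moreover have "F n \<in> semigroup_gen U" for n
  proof -
    have gens: "chart a \<in> semigroup_gen U" "chart b \<in> semigroup_gen U" "chart g \<in> semigroup_gen U"
      "chart (a\<inverse>) \<in> semigroup_gen U" "chart (b\<inverse>) \<in> semigroup_gen U"
      by (auto simp: U_def intro: semigroup_gen.base)
    have ab: "a O b ^^ n = {(x, c (n, x)) | x. x \<in> X}" for n
    proof (induction n)
      case 0
      then show ?case by (auto simp: a_def)
    next
      case (Suc n)
      have "a O b ^^ Suc n = (a O b ^^ n) O b" by (simp add: O_assoc)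
      also have "\<dots> = {(x, c (Suc n, x)) | x. x \<in> X}"
        unfolding Suc by (auto simp: b_def cinj relcomp_unfold)
      finally show ?case .
    qed
    have "chart (a O b ^^ n) \<in> semigroup_gen U" "biunique (a O b ^^ n)"
      using chart_funpow_gen[OF gens(1,2) bi(1,2), of n] bi(1) by (auto intro: biunique_O)
    then have 1: "chart ((a O b ^^ n) O g) \<in> semigroup_gen U" "biunique ((a O b ^^ n) O g)"
      using gens bi by (auto intro: chart_O_gen biunique_O)
    have 2: "chart (((a O b ^^ n) O g) O (b\<inverse>) ^^ n) \<in> semigroup_gen U"
       "biunique (((a O b ^^ n) O g) O (b\<inverse>) ^^ n)"
      using chart_funpow_gen[OF 1(1) gens(5) 1(2) biunique_converse[OF bi(2)], of n]
        1 by (auto intro: biunique_O)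
    have 3: "chart ((((a O b ^^ n) O g) O (b\<inverse>) ^^ n) O a\<inverse>) \<in> semigroup_gen U"
      by (rule chart_O_gen) (use 2 gens bi biunique_converse in auto)
    \<comment> \<open>Since \<open>g\<close> maps each copy into itself, conjugating it by the map
      onto copy \<open>n\<close> gives back \<open>F n\<close>.\<close>
    have "(((a O b ^^ n) O g) O (b\<inverse>) ^^ n) O a\<inverse> = (a O b ^^ n) O g O (a O b ^^ n)\<inverse>"
      by (simp add: converse_relcomp converse_relpow O_assoc)
    also have "\<dots> = Map.graph (F n)"
      unfolding ab by (auto simp: relcomp_unfold g_def Map.graph_def cinj dest: Fd)
    finally show ?thesis using 3 by (simp add: chart_graph)
  qed
  ultimately show ?thesis using that[of U] F by auto
qed

lemma preceq_I_via_countable: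
  assumes "countable X" "infinite X" "countable C" "C \<subseteq> sym_inv_monoid X"
    and "S1 \<subseteq> semigroup_gen (S2 \<union> C)"
  shows "preceq_I X S1 S2"
proof -
  obtain U where U: "finite U" "U \<subseteq> sym_inv_monoid X" "C \<subseteq> semigroup_gen U"
    using countable_subset_finitely_generated[OF assms(1-4)] .
  have "S2 \<union> C \<subseteq> semigroup_gen (S2 \<union> U)"
    using U(3) semigroup_gen_mono[of U "S2 \<union> U"] by (auto intro: semigroup_gen.base)
  from order_trans[OF assms(5) semigroup_gen_subset[OF this]] show ?thesis
    using U(1,2) unfolding preceq_I_def by blast
qed

lemma preceq_I_subset: "S1 \<subseteq> S2 \<Longrightarrow> preceq_I X S1 S2"
  unfolding preceq_I_def by (intro exI[of _ "{}"]) (auto intro: semigroup_gen.base)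

lemma preceq_I_trans:
  assumes "preceq_I X S1 S2" "preceq_I X S2 S3"
  shows "preceq_I X S1 S3"
proof -
  obtain U V where U: "finite U" "U \<subseteq> sym_inv_monoid X" "S1 \<subseteq> semigroup_gen (S2 \<union> U)"
    and V: "finite V" "V \<subseteq> sym_inv_monoid X" "S2 \<subseteq> semigroup_gen (S3 \<union> V)"
    using assms unfolding preceq_I_def by blast
  have "S2 \<union> U \<subseteq> semigroup_gen (S3 \<union> (U \<union> V))"
    using V(3) semigroup_gen_mono[of "S3 \<union> V" "S3 \<union> (U \<union> V)"] by (auto intro: semigroup_gen.base)
  from order_trans[OF U(3) semigroup_gen_subset[OF this]] show ?thesis
    unfolding preceq_I_def using U(1,2) V(1,2) by (intro exI[of _ "U \<union> V"]) auto
qed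

section \<open>Extending partial injections in partwise stabilisers\<close>

text \<open>Domain and range are equinumerous, hence so are their complements in the finite set
  \<open>A\<close>; any bijection between the complements completes \<open>R\<close>. For infinite
  \<open>A\<close> this can fail, and here the finiteness of the parts enters.\<close>

lemma extend_injection_finite:
  assumes "finite A" "biunique R" "R \<subseteq> A \<times> A"
  obtains S where "R \<subseteq> S" "S \<subseteq> A \<times> A" "biunique S" "Domain S = A" "Range S = A"
proof -
  have fin: "finite (Domain R)" "finite (Range R)" and sub: "Domain R \<subseteq> A" "Range R \<subseteq> A"
    using assms by (auto intro: finite_subset)
  have "fst ` R = Domain R" "snd ` R = Range R" by (auto simp: Domain_fst Range_snd)
  moreover have "inj_on fst R" "inj_on snd R"
    using assms(2) by (auto simp: inj_on_def dest: biunique_right biunique_left)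
  ultimately have "card (Domain R) = card (Range R)" by (metis card_image)
  then have "card (A - Domain R) = card (A - Range R)"
    using sub fin assms(1) by (simp add: card_Diff_subset)
  then obtain h where h: "bij_betw h (A - Domain R) (A - Range R)"
    using finite_same_card_bij[of "A - Domain R" "A - Range R"] assms(1) by auto
  define S where "S = R \<union> {(x, h x) | x. x \<in> A - Domain R}"
  have hA: "h x \<in> A" "h x \<notin> Range R" if "x \<in> A" "x \<notin> Domain R" for x
    using bij_betwE[OF h] that by auto
  have hinj: "x = y" if "h x = h y" "x \<in> A - Domain R" "y \<in> A - Domain R" for x y
    using bij_betw_imp_inj_on[OF h] that by (auto dest: inj_onD)
  have Siff: "(x, y) \<in> S \<longleftrightarrow> (x, y) \<in> R \<or> x \<in> A \<and> x \<notin> Domain R \<and> y = h x" for x y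
    by (auto simp: S_def)
  show ?thesis
  proof (rule that[of S])
    show "R \<subseteq> S" "S \<subseteq> A \<times> A" using assms hA by (auto simp: S_def)
    show "biunique S"
    proof (rule biuniqueI)
      fix x y z assume "(x, y) \<in> S" "(x, z) \<in> S"
      then show "y = z"
        unfolding Siff using biunique_right[OF assms(2), of x y z] by (elim disjE) auto
    next
      fix x y z assume "(x, z) \<in> S" "(y, z) \<in> S"
      then show "x = y"
        unfolding Siff using biunique_left[OF assms(2), of x z y] hA[of x] hA[of y] hinj[of x y]
        by (elim disjE) auto
    qed
    have SA: "S \<subseteq> A \<times> A" using assms(3) hA(1) by (auto simp: S_def)
    have D: "x \<in> Domain S" if "x \<in> A" for x
    proof (cases "x \<in> Domain R")
      case True
      then obtain y where "(x, y) \<in> R" by (rule DomainE)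
      then have "(x, y) \<in> S" using Siff by simp
      then show ?thesis by (rule DomainI)
    next
      case False
      then have "(x, h x) \<in> S" using Siff that by simp
      then show ?thesis by (rule DomainI)
    qed
    have DR: "Domain S \<subseteq> A" "Range S \<subseteq> A" using SA by auto
    show "Domain S = A" by (rule subset_antisym[OF DR(1) subsetI[OF D]])
    have R: "y \<in> Range S" if "y \<in> A" for y
    proof (cases "y \<in> Range R")
      case True
      then obtain x where "(x, y) \<in> R" by (rule RangeE)
      then have "(x, y) \<in> S" using Siff by simp
      then show ?thesis by (rule RangeI)
    next
      case False
      then have "y \<in> h ` (A - Domain R)" using bij_betw_imp_surj_on[OF h] that by simp
      then obtain x where "x \<in> A - Domain R" "y = h x" by (elim imageE) simp
      then have "(x, y) \<in> S" using Siff by simp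
      then show ?thesis by (rule RangeI)
    qed
    show "Range S = A" by (rule subset_antisym[OF DR(2) subsetI[OF R]])
  qed
qed

text \<open>Elements of the partwise stabiliser are total, whereas later constructions prescribe
  values at some points only. The parts are completed separately, and disjointness of the parts
  makes the union of the completions biunique again.\<close>

lemma PStab_extension:
  assumes P: "partition_on X \<P>" "\<And>A. A \<in> \<P> \<Longrightarrow> finite A"
    and R: "biunique R" "\<And>x y. (x, y) \<in> R \<Longrightarrow> \<exists>A\<in>\<P>. x \<in> A \<and> y \<in> A"
  obtains S where "R \<subseteq> S" "S \<subseteq> X \<times> X" "biunique S" "chart S \<in> PStab X \<P>"
proof -
  have "\<forall>A. A \<in> \<P> \<longrightarrow> (\<exists>S. R \<inter> A \<times> A \<subseteq> S \<and> S \<subseteq> A \<times> A \<and> biunique S \<and> Domain S = A \<and> Range S = A)"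
  proof (intro allI impI)
    fix A assume "A \<in> \<P>"
    then have "finite A" using P by auto
    moreover have "biunique (R \<inter> A \<times> A)"
      using R(1) unfolding biunique_def single_valued_def by blast
    ultimately obtain S where "R \<inter> A \<times> A \<subseteq> S" "S \<subseteq> A \<times> A" "biunique S" "Domain S = A" "Range S = A"
      by (rule extend_injection_finite) simp_all
    then show "\<exists>S. R \<inter> A \<times> A \<subseteq> S \<and> S \<subseteq> A \<times> A \<and> biunique S \<and> Domain S = A \<and> Range S = A"
      by (intro exI conjI)
  qed
  then have "\<forall>A. \<exists>S. A \<in> \<P> \<longrightarrow> R \<inter> A \<times> A \<subseteq> S \<and> S \<subseteq> A \<times> A \<and> biunique S \<and> Domain S = A \<and> Range S = A"
    by simp
  from choice[OF this] obtain s where s': "\<forall>A. A \<in> \<P> \<longrightarrow> R \<inter> A \<times> A \<subseteq> s A \<and> s A \<subseteq> A \<times> A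
      \<and> biunique (s A) \<and> Domain (s A) = A \<and> Range (s A) = A" ..
  note s = s'[rule_format]
  have disj: "A = B" if "A \<in> \<P>" "B \<in> \<P>" "x \<in> A" "x \<in> B" for A B x
    using partition_onD2[OF P(1)] that by (meson disjointD disjoint_iff)
  have cover: "\<exists>A\<in>\<P>. x \<in> A" if "x \<in> X" for x
    using partition_onD1[OF P(1)] that by blast
  have sub: "A \<subseteq> X" if "A \<in> \<P>" for A
    using P(1) that by (auto simp: partition_on_def)
  define S where "S = (\<Union>A\<in>\<P>. s A)"
  have SA: "(x, y) \<in> s A" if "(x, y) \<in> S" "A \<in> \<P>" "x \<in> A \<or> y \<in> A" for x y A
  proof -
    obtain B where "B \<in> \<P>" "(x, y) \<in> s B" using \<open>(x, y) \<in> S\<close> by (auto simp: S_def)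
    moreover then have "x \<in> B" "y \<in> B" using conjunct1[OF conjunct2[OF s[of B]]] by blast+
    ultimately show ?thesis using disj that by blast
  qed
  have dom: "\<exists>y\<in>A. (x, y) \<in> S" and ran: "\<exists>y\<in>A. (y, x) \<in> S" if "A \<in> \<P>" "x \<in> A" for A x
  proof -
    have "x \<in> Domain (s A)" "x \<in> Range (s A)" "s A \<subseteq> A \<times> A" "s A \<subseteq> S"
      using s[OF that(1)] that by (auto simp: S_def)
    then show "\<exists>y\<in>A. (x, y) \<in> S" "\<exists>y\<in>A. (y, x) \<in> S" by blast+
  qed
  have SP: "\<exists>A\<in>\<P>. x \<in> A \<and> y \<in> A \<and> (x, y) \<in> s A" if "(x, y) \<in> S" for x y
  proof -
    obtain A where A: "A \<in> \<P>" "(x, y) \<in> s A" using \<open>(x, y) \<in> S\<close> by (auto simp: S_def)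
    moreover have "s A \<subseteq> A \<times> A" using s[OF A(1)] by simp
    ultimately show ?thesis by blast
  qed
  have bi: "biunique S"
  proof (rule biuniqueI)
    fix x y z assume "(x, y) \<in> S" "(x, z) \<in> S"
    then obtain A where "A \<in> \<P>" "(x, y) \<in> s A" "(x, z) \<in> s A" using SP[of x y] SA[of x z] by blast
    then show "y = z" using s[of A] by (auto intro: biunique_right[of "s A"])
  next
    fix x y z assume "(x, z) \<in> S" "(y, z) \<in> S"
    then obtain A where "A \<in> \<P>" "(x, z) \<in> s A" "(y, z) \<in> s A" using SP[of x z] SA[of y z] by blast
    then show "x = y" using s[of A] by (auto intro: biunique_left[of "s A"])
  qed
  have SX: "S \<subseteq> X \<times> X" using SP sub by auto
  have RS: "R \<subseteq> S"
  proof
    fix p assume p: "p \<in> R"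
    obtain x y where xy: "p = (x, y)" by force
    then obtain A where "A \<in> \<P>" "x \<in> A" "y \<in> A" using R(2) p by blast
    then show "p \<in> S" using s[of A] p xy unfolding S_def by blast
  qed
  have "chart S \<in> sym_inv_monoid X" using chart_in_sym_inv_monoid[OF bi SX] .
  moreover have "dom (chart S) = X" "ran (chart S) = X"
  proof -
    have "\<exists>y. (x, y) \<in> S" "\<exists>y. (y, x) \<in> S" if "x \<in> X" for x
      using cover[OF that] dom ran by blast+
    moreover have "x \<in> dom (chart S) \<longleftrightarrow> (\<exists>y. (x, y) \<in> S)" for x
      by (simp add: chart_def dom_def)
    moreover have "x \<in> ran (chart S) \<longleftrightarrow> (\<exists>y. (y, x) \<in> S)" for x
      by (simp add: ran_def chart_eq_Some[OF bi])
    ultimately show "dom (chart S) = X" "ran (chart S) = X" using SX by (intro set_eqI; blast)+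
  qed
  moreover have "pimage (chart S) A = A" if "A \<in> \<P>" for A
    unfolding pimage_def chart_eq_Some[OF bi]
    using dom[OF that] ran[OF that] SA[OF _ that] conjunct1[OF conjunct2[OF s[OF that]]] by blast
  ultimately have "chart S \<in> PStab X \<P>" by (simp add: PStab_def sym_group_def)
  then show ?thesis using that RS SX bi by blast
qed

text \<open>A part with more than \<open>n + sum card F\<close> elements is at least as large as
  \<open>n\<close> and cannot belong to the finite set \<open>F\<close>. Parts of prescribed minimal
  size can therefore be chosen greedily without repetition.\<close>

lemma distinct_large_parts:
  assumes X: "countable X" "infinite X" and P: "aleph0_unbounded_partition X \<P>"
    and I: "countable I"
  obtains \<Phi> where "inj_on \<Phi> I" "\<And>i. i \<in> I \<Longrightarrow> \<Phi> i \<in> \<P>" "\<And>i. i \<in> I \<Longrightarrow> d i \<le> card (\<Phi> i)"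
proof -
  have large: "\<exists>A\<in>\<P>. n \<le> card A \<and> A \<notin> F" if "finite F" for n F
  proof -
    have "\<exists>A\<in>\<P>. \<not> card A \<le> n + sum card F"
      using P unfolding aleph0_unbounded_partition_def by blast
    then obtain A where A: "A \<in> \<P>" "n + sum card F < card A" by auto
    have "A \<notin> F"
      using member_le_sum[of A F card] that A(2) by auto
    then show ?thesis using A by (intro bexI[of _ A]) auto
  qed
  define P' where "P' n F \<longleftrightarrow> finite F \<and> F \<subseteq> \<P>" for n :: nat and F :: "'a set set"
  define e where "e n = d (from_nat_into I n)" for n
  have "\<exists>F. \<forall>n. P' n (F n) \<and> (\<exists>A\<in>\<P>. e n \<le> card A \<and> A \<notin> F n \<and> F (Suc n) = insert A (F n))"
  proof (rule dependent_nat_choice)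
    show "\<exists>F. P' 0 F" by (auto simp: P'_def)
  next
    fix F n assume "P' n F"
    then show "\<exists>G. P' (Suc n) G \<and> (\<exists>A\<in>\<P>. e n \<le> card A \<and> A \<notin> F \<and> G = insert A F)"
      using large[of F "e n"] unfolding P'_def by auto
  qed
  then obtain F
    where "\<forall>n. P' n (F n) \<and> (\<exists>A\<in>\<P>. e n \<le> card A \<and> A \<notin> F n \<and> F (Suc n) = insert A (F n))" ..
  then have "\<forall>n. \<exists>A. A \<in> \<P> \<and> e n \<le> card A \<and> A \<notin> F n \<and> F (Suc n) = insert A (F n)"
    by (simp add: Bex_def)
  from choice[OF this] obtain A
    where F': "\<forall>n. A n \<in> \<P> \<and> e n \<le> card (A n) \<and> A n \<notin> F n \<and> F (Suc n) = insert (A n) (F n)" ..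
  note F = F'[rule_format]
  have mono: "F m \<subseteq> F n" if "m \<le> n" for m n
    using lift_Suc_mono_le[of F, OF _ that] F by (metis subset_insertI)
  have "A m \<noteq> A n" if "m < n" for m n
    using mono[of "Suc m" n] F[of m] F[of n] that by auto
  then have injA: "inj A" by (metis injI nat_neq_iff)
  show ?thesis
  proof (rule that[of "A \<circ> to_nat_on I"])
    show "inj_on (A \<circ> to_nat_on I) I"
      using injA inj_on_to_nat_on[OF I] by (auto intro: comp_inj_on inj_on_subset)
    show "(A \<circ> to_nat_on I) i \<in> \<P>" if "i \<in> I" for i using F by simp
    show "d i \<le> card ((A \<circ> to_nat_on I) i)" if "i \<in> I" for i
      using F[of "to_nat_on I i"] that I by (simp add: e_def)
  qed
qed

section \<open>Rooted trees as ranked sets of vertices\<close>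

definition simple_path :: "'a rooted_graph \<Rightarrow> (nat \<Rightarrow> 'a) \<Rightarrow> nat \<Rightarrow> bool" where
  "simple_path T f n \<longleftrightarrow> (\<forall>i\<le>n. f i \<in> gverts T) \<and> inj_on f {..n} \<and>
     (\<forall>i<n. {f i, f (Suc i)} \<in> gedges T)"

text \<open>Total functions with unconstrained values beyond \<open>n\<close> can be shifted,
  reversed and spliced without case distinctions on options.\<close>

lemma path_from_to_iff:
  "path_from_to T x p n y \<longleftrightarrow> (\<exists>f. simple_path T f n \<and> f 0 = x \<and> f n = y \<and>
     p = (\<lambda>i. if i \<le> n then Some (f i) else None))" (is "?L \<longleftrightarrow> ?R")
proof
  assume L: ?L
  then have p: "is_path T p" "dom p = {..n}" "p 0 = Some x" "p n = Some y"
    by (auto simp: path_from_to_def)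
  define f where "f i = the (p i)" for i
  have pf: "p i = Some (f i)" if "i \<le> n" for i
    using p(2) that unfolding f_def by (metis atMost_iff domD option.sel)
  have none: "p i = None" if "\<not> i \<le> n" for i
    using p(2) that by auto
  have "inj_on f {..n}"
    using p(1,2) pf unfolding is_path_def inj_on_def by (metis atMost_iff)
  moreover have "\<forall>i\<le>n. f i \<in> gverts T"
    using p(1) pf unfolding is_path_def by (meson ranI subsetD)
  moreover have "\<forall>i<n. {f i, f (Suc i)} \<in> gedges T"
    using p(1) pf unfolding is_path_def by (meson Suc_leI less_imp_le_nat)
  ultimately have "simple_path T f n" by (simp add: simple_path_def)
  moreover have "p = (\<lambda>i. if i \<le> n then Some (f i) else None)"
    using pf none by auto
  ultimately show ?R using pf[of 0] pf[of n] p by auto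
next
  assume ?R
  then obtain f where f: "simple_path T f n" "f 0 = x" "f n = y"
    and p: "p = (\<lambda>i. if i \<le> n then Some (f i) else None)" by blast
  have d: "dom p = {..n}" using p by (auto split: if_splits)
  have "\<exists>k. dom p = {..<k}" using d lessThan_Suc_atMost by metis
  moreover have "ran p \<subseteq> gverts T" using f p by (auto simp: simple_path_def ran_def)
  moreover have "inj_on p (dom p)" using f p d by (auto simp: simple_path_def inj_on_def)
  moreover have "\<forall>i x y. p i = Some x \<longrightarrow> p (Suc i) = Some y \<longrightarrow> {x, y} \<in> gedges T"
    using f p by (auto simp: simple_path_def split: if_splits)
  ultimately show ?L using f p d by (simp add: path_from_to_def is_path_def)
qed

lemma simple_path_prefix: "simple_path T f n \<Longrightarrow> i \<le> n \<Longrightarrow> simple_path T f i"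
  by (auto simp: simple_path_def inj_on_def)

lemma simple_path_suffix:
  assumes "simple_path T f n" "j \<le> n"
  shows "simple_path T (\<lambda>t. f (j + t)) (n - j)"
proof -
  have "inj_on (\<lambda>t. f (j + t)) {..n - j}"
  proof (rule inj_onI)
    fix s t assume "s \<in> {..n - j}" "t \<in> {..n - j}" "f (j + s) = f (j + t)"
    then have "j + s = j + t"
      using assms by (intro inj_onD[of f "{..n}"]) (auto simp: simple_path_def)
    then show "s = t" by simp
  qed
  then show ?thesis using assms by (auto simp: simple_path_def)
qed

lemma simple_path_edge: "simple_path T f n \<Longrightarrow> i < n \<Longrightarrow> {f (Suc i), f i} \<in> gedges T"
  by (simp add: simple_path_def insert_commute)

lemma simple_path_rev:
  assumes "simple_path T f n"
  shows "simple_path T (\<lambda>t. f (n - t)) n"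
proof -
  have "{f (n - t), f (n - Suc t)} \<in> gedges T" if "t < n" for t
  proof -
    have "n - t = Suc (n - Suc t)" "n - Suc t < n" using that by auto
    then show ?thesis using simple_path_edge[OF assms, of "n - Suc t"] by simp
  qed
  moreover have "inj_on (\<lambda>t. f (n - t)) {..n}"
  proof (rule inj_onI)
    fix s t assume st: "s \<in> {..n}" "t \<in> {..n}" "f (n - s) = f (n - t)"
    then have "n - s = n - t"
      using assms by (intro inj_onD[of f "{..n}"]) (auto simp: simple_path_def)
    then show "s = t" using st by auto
  qed
  ultimately show ?thesis using assms by (auto simp: simple_path_def)
qed

lemma simple_path_snoc:
  assumes "simple_path T f n" "y \<in> gverts T" "{f n, y} \<in> gedges T" "y \<notin> f ` {..n}"
  shows "simple_path T (f(Suc n := y)) (Suc n)"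
proof -
  have "inj_on (f(Suc n := y)) {..n}"
    using assms by (auto simp: simple_path_def inj_on_def)
  moreover have "y \<notin> (f(Suc n := y)) ` {..n}"
    using assms(4) by auto
  ultimately have "inj_on (f(Suc n := y)) {..Suc n}"
    by (simp add: atMost_Suc)
  then show ?thesis using assms by (auto simp: simple_path_def less_Suc_eq)
qed

lemma ex_path_iff:
  "(\<exists>p. path_from_to T x p n y) \<longleftrightarrow> (\<exists>f. simple_path T f n \<and> f 0 = x \<and> f n = y)"
  by (simp add: path_from_to_iff)

lemma has_cycle_iff:
  "has_cycle T \<longleftrightarrow> (\<exists>f n. simple_path T f n \<and> 2 \<le> n \<and> {f n, f 0} \<in> gedges T)"
proof -
  have "has_cycle T \<longleftrightarrow> (\<exists>x y n. (\<exists>p. path_from_to T x p n y) \<and> 2 \<le> n \<and> {y, x} \<in> gedges T)"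
    unfolding has_cycle_def by (intro iffI) (elim exE conjE, intro exI conjI, assumption+)+
  also have "\<dots> \<longleftrightarrow> (\<exists>f n. simple_path T f n \<and> 2 \<le> n \<and> {f n, f 0} \<in> gedges T)"
    unfolding ex_path_iff by (metis (no_types))
  finally show ?thesis .
qed

lemma graph_connected_iff:
  "graph_connected T \<longleftrightarrow>
     (\<forall>x\<in>gverts T. \<forall>y\<in>gverts T. \<exists>f n. simple_path T f n \<and> f 0 = x \<and> f n = y)"
proof -
  have "(\<exists>p n. path_from_to T x p n y) \<longleftrightarrow> (\<exists>f n. simple_path T f n \<and> f 0 = x \<and> f n = y)" for x y
    using ex_path_iff[of T x _ y] by (metis (no_types))
  then show ?thesis unfolding graph_connected_def by simp
qed

text \<open>If two paths with common end points part after position \<open>k\<close>, then the first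
  return of \<open>g\<close> to the later portion of \<open>f\<close> closes a cycle.\<close>

lemma simple_paths_agree:
  assumes acyc: "\<not> has_cycle T"
    and f: "simple_path T f i" and g: "simple_path T g j" and "f 0 = g 0" "f i = g j"
    and "m \<le> i" "m \<le> j"
  shows "f m = g m"
proof (rule ccontr)
  assume "f m \<noteq> g m"
  define k' where "k' = (LEAST k. f k \<noteq> g k)"
  have k': "f k' \<noteq> g k'" "k' \<le> m"
    unfolding k'_def using \<open>f m \<noteq> g m\<close> LeastI[of "\<lambda>k. f k \<noteq> g k" m]
      Least_le[of "\<lambda>k. f k \<noteq> g k" m] by auto
  then obtain k where k: "k' = Suc k" using \<open>f 0 = g 0\<close> by (cases k') auto
  have fk: "f k = g k" using not_less_Least[of k "\<lambda>k. f k \<noteq> g k"] k unfolding k'_def by auto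
  have le: "Suc k \<le> i" "Suc k \<le> j" using k k' assms by auto
  \<comment> \<open>\<open>P t\<close> says that \<open>g\<close> is back on the part of
    \<open>f\<close> after \<open>k\<close>. It holds at \<open>j\<close> because the paths end in
    the same vertex; taking the least such \<open>t\<close> keeps the two segments disjoint in
    between.\<close>
  define P where "P t \<longleftrightarrow> k < t \<and> t \<le> j \<and> g t \<in> f ` {k<..i}" for t
  have "P j" using le assms(5) unfolding P_def by (auto simp: image_iff intro!: bexI[of _ i])
  define j' where "j' = (LEAST t. P t)"
  have j': "P j'" unfolding j'_def by (rule LeastI) fact
  have min: "\<not> P t" if "t < j'" for t using that not_less_Least unfolding j'_def by blast
  obtain i' where i': "k < i'" "i' \<le> i" "f i' = g j'" using j' unfolding P_def by auto
  have jj: "k < j'" "j' \<le> j" using j' unfolding P_def by auto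
  have ne: "g t \<noteq> f s" if "k < t" "t < j'" "k \<le> s" "s \<le> i'" for s t
  proof (cases "s = k")
    case True
    then show ?thesis using fk g that jj unfolding simple_path_def inj_on_def
      by (metis atMost_iff le_trans less_imp_le_nat less_irrefl)
  next
    case False
    then show ?thesis using min[OF that(2)] that jj i' unfolding P_def by auto
  qed
  define a where "a = i' - k"
  define n where "n = a + (j' - k - 1)"
  \<comment> \<open>The cycle follows \<open>f\<close> from \<open>k\<close> to \<open>i'\<close>,
    where it meets \<open>g j'\<close>, and then runs backwards along \<open>g\<close> down to
    \<open>Suc k\<close>. The closing edge is the one of \<open>g\<close> between
    \<open>Suc k\<close> and \<open>k\<close>.\<close>
  define h where "h t = (if t \<le> a then f (k + t) else g (j' - (t - a)))" for t
  have f_inj: "f s = f t \<longleftrightarrow> s = t" if "s \<le> i" "t \<le> i" for s t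
    using f that by (auto simp: simple_path_def inj_on_def)
  have g_inj: "g s = g t \<longleftrightarrow> s = t" if "s \<le> j" "t \<le> j" for s t
    using g that by (auto simp: simple_path_def inj_on_def)
  have h0: "h 0 = g k" by (simp add: h_def fk)
  have hn: "h n = g (Suc k)"
    using i' jj by (cases "j' = Suc k") (auto simp: h_def n_def a_def)
  \<comment> \<open>A shorter closed walk would force \<open>i' = j' = Suc k\<close>, so the paths
    would agree at the position of their first disagreement.\<close>
  have "2 \<le> n"
  proof (rule ccontr)
    assume "\<not> 2 \<le> n"
    then have "i' = Suc k \<and> j' = Suc k" using i' jj unfolding n_def a_def by linarith
    then show False using i'(3) k' k by simp
  qed
  moreover have "simple_path T h n"
    unfolding simple_path_def
  proof (intro conjI allI impI)
    fix t assume "t \<le> n"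
    then show "h t \<in> gverts T"
      using f g i' jj by (auto simp: h_def a_def n_def simple_path_def)
  next
    have ne': "f (k + s) \<noteq> g (j' - (t - a))" if "s \<le> a" "a < t" "t \<le> n" for s t
    proof -
      have "0 < t - a" "t - a \<le> j' - k - 1" using that unfolding n_def by auto
      then have "k < j' - (t - a)" "j' - (t - a) < j'" using jj by auto
      moreover have "k + s \<le> i'" using that i' unfolding a_def by auto
      ultimately show ?thesis using ne[of "j' - (t - a)" "k + s"] by (metis le_add1)
    qed
    show "inj_on h {..n}"
    proof (rule inj_onI)
      fix s t assume st: "s \<in> {..n}" "t \<in> {..n}" "h s = h t"
      consider "s \<le> a" "t \<le> a" | "s \<le> a" "a < t" | "a < s" "t \<le> a" | "a < s" "a < t" by linarith
      then show "s = t"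
      proof cases
        case 1 then show ?thesis using st i' by (auto simp: h_def a_def f_inj)
      next
        case 2 then show ?thesis using st ne'[of s t] by (auto simp: h_def)
      next
        case 3 then show ?thesis using st ne'[of t s] by (auto simp: h_def)
      next
        case 4
        then have "g (j' - (s - a)) = g (j' - (t - a))" using st by (simp add: h_def)
        then have "j' - (s - a) = j' - (t - a)" using jj by (subst (asm) g_inj) auto
        then show ?thesis using 4 st jj unfolding n_def by auto
      qed
    qed
  next
    fix t assume t: "t < n"
    consider "t < a" | "t = a" | "a < t" by linarith
    then show "{h t, h (Suc t)} \<in> gedges T"
    proof cases
      case 1 then show ?thesis using f i' by (auto simp: h_def a_def simple_path_def)
    next
      case 2
      then have "h t = g (Suc (j' - 1))" "h (Suc t) = g (j' - 1)" "j' - 1 < j"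
        using i' jj by (auto simp: h_def a_def)
      then show ?thesis using simple_path_edge[OF g] by metis
    next
      case 3
      then have "h t = g (Suc (j' - (Suc t - a)))" "h (Suc t) = g (j' - (Suc t - a))"
        "j' - (Suc t - a) < j"
        using i' jj t by (auto simp: h_def a_def n_def intro!: arg_cong[of _ _ g])
      then show ?thesis using simple_path_edge[OF g] by metis
    qed
  qed
  moreover have "{h n, h 0} \<in> gedges T"
    using simple_path_edge[OF g, of k] le hn h0 by simp
  ultimately show False using acyc has_cycle_iff by blast
qed

lemma simple_paths_unique:
  assumes "\<not> has_cycle T" "simple_path T f i" "simple_path T g j" "f 0 = g 0" "f i = g j"
  shows "i = j"
proof -
  have "f (min i j) = g (min i j)" using simple_paths_agree[OF assms] by simp
  then show ?thesis
    using assms by (auto simp: min_def simple_path_def inj_on_def split: if_splits)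
qed

text \<open>The choices in \<open>level\<close> and \<open>ancestor\<close> are harmless: in a
  rooted tree the length of the path from the root and all vertices on it are determined by its
  end.\<close>

definition level :: "'a rooted_graph \<Rightarrow> 'a \<Rightarrow> nat" where
  "level T x = (SOME n. \<exists>f. simple_path T f n \<and> f 0 = groot T \<and> f n = x)"

definition ancestor :: "'a rooted_graph \<Rightarrow> 'a \<Rightarrow> nat \<Rightarrow> 'a" where
  "ancestor T x = (SOME f. simple_path T f (level T x) \<and> f 0 = groot T \<and> f (level T x) = x)"

lemma
  assumes "rooted_tree T" "simple_path T f n" "f 0 = groot T"
  shows level_path: "level T (f n) = n" and ancestor_path: "i \<le> n \<Longrightarrow> ancestor T (f n) i = f i"
proof -
  have acyc: "\<not> has_cycle T" using assms by (simp add: rooted_tree_def)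
  have "\<exists>g. simple_path T g (level T (f n)) \<and> g 0 = groot T \<and> g (level T (f n)) = f n"
    unfolding level_def by (rule someI[of _ n]) (use assms in blast)
  then show l: "level T (f n) = n"
    using simple_paths_unique[OF acyc assms(2)] assms(3) by metis
  have "simple_path T (ancestor T (f n)) (level T (f n)) \<and> ancestor T (f n) 0 = groot T
      \<and> ancestor T (f n) (level T (f n)) = f n"
    unfolding ancestor_def by (rule someI[of _ f]) (use assms l in auto)
  then show "ancestor T (f n) i = f i" if "i \<le> n"
    using simple_paths_agree[OF acyc _ assms(2), of "ancestor T (f n)" "n" i] assms(3) l that by simp
qed

lemma ancestor_simple_path:
  assumes "rooted_tree T" "x \<in> gverts T"
  shows "simple_path T (ancestor T x) (level T x)" "ancestor T x 0 = groot T"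
    "ancestor T x (level T x) = x"
proof -
  obtain f n where f: "simple_path T f n" "f 0 = groot T" "f n = x"
    using assms unfolding rooted_tree_def graph_connected_iff by blast
  then have l: "level T x = n" using level_path assms by blast
  have "simple_path T (ancestor T x) (level T x) \<and> ancestor T x 0 = groot T
      \<and> ancestor T x (level T x) = x"
    unfolding ancestor_def by (rule someI[of _ f]) (use f l in auto)
  then show "simple_path T (ancestor T x) (level T x)" "ancestor T x 0 = groot T"
    "ancestor T x (level T x) = x" by auto
qed

text \<open>The combinatorial content of a rooted tree: \<open>anc x i\<close> is the vertex at distance \<open>i\<close> from the
  root on the path from the root to \<open>x\<close>; it is junk for \<open>i > lev x\<close>.\<close>

locale ranked_tree =
  fixes V :: "'a set" and lev :: "'a \<Rightarrow> nat" and anc :: "'a \<Rightarrow> nat \<Rightarrow> 'a" and rt :: 'a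
  assumes rt_in: "rt \<in> V"
    and anc_self: "x \<in> V \<Longrightarrow> anc x (lev x) = x"
    and anc_0: "x \<in> V \<Longrightarrow> anc x 0 = rt"
    and anc_in: "x \<in> V \<Longrightarrow> i \<le> lev x \<Longrightarrow> anc x i \<in> V"
    and lev_anc: "x \<in> V \<Longrightarrow> i \<le> lev x \<Longrightarrow> lev (anc x i) = i"
    and anc_anc: "x \<in> V \<Longrightarrow> j \<le> i \<Longrightarrow> i \<le> lev x \<Longrightarrow> anc (anc x i) j = anc x j"
begin

lemma lev_rt: "lev rt = 0"
  using anc_0[OF rt_in] lev_anc[OF rt_in, of 0] by simp

definition kids :: "'a set \<Rightarrow> 'a \<Rightarrow> 'a set" where
  "kids W y = {z \<in> W. lev z = Suc (lev y) \<and> anc z (lev y) = y}"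

definition rays :: "'a set \<Rightarrow> (nat \<Rightarrow> 'a) set" where
  "rays W = {q. \<forall>n. q n \<in> W \<and> lev (q n) = n \<and> anc (q (Suc n)) n = q n}"

text \<open>With the root as a member, such a set is the vertex set of an induced subtree.\<close>

definition prefix_closed :: "'a set \<Rightarrow> bool" where
  "prefix_closed W \<longleftrightarrow> W \<subseteq> V \<and> (\<forall>x\<in>W. \<forall>i\<le>lev x. anc x i \<in> W)"

lemma ray_anc:
  assumes "q \<in> rays W" "W \<subseteq> V" "i \<le> n"
  shows "anc (q n) i = q i"
  using assms(3)
proof (induction n)
  case 0
  then show ?case using assms anc_self[of "q 0"] by (auto simp: rays_def)
next
  case (Suc n)
  have q: "q (Suc n) \<in> V" "lev (q (Suc n)) = Suc n" "anc (q (Suc n)) n = q n"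
    using assms by (auto simp: rays_def)
  show ?case
  proof (cases "i = Suc n")
    case True
    then show ?thesis using anc_self[OF q(1)] q(2) by simp
  next
    case False
    then show ?thesis using anc_anc[OF q(1), of i n] q Suc by auto
  qed
qed

end

lemma ranked_tree_rooted_tree:
  assumes "rooted_tree T"
  shows "ranked_tree (gverts T) (level T) (ancestor T) (groot T)"
proof
  show "groot T \<in> gverts T" using assms by (simp add: rooted_tree_def)
next
  fix x i assume x: "x \<in> gverts T"
  note p = ancestor_simple_path[OF assms x]
  show "ancestor T x (level T x) = x" "ancestor T x 0 = groot T" using p by auto
  assume i: "i \<le> level T x"
  show "ancestor T x i \<in> gverts T" using p i by (simp add: simple_path_def)
  show "level T (ancestor T x i) = i"
    using level_path[OF assms simple_path_prefix[OF p(1) i] p(2)] .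
  fix j assume "j \<le> i"
  then show "ancestor T (ancestor T x i) j = ancestor T x j"
    using ancestor_path[OF assms simple_path_prefix[OF p(1) i] p(2)] by simp
qed

text \<open>If \<open>y\<close> is not on the root path of \<open>x\<close>, the edge extends this
  path to \<open>y\<close>. Otherwise \<open>y\<close> must be the last vertex before
  \<open>x\<close>, since an earlier one would close a cycle.\<close>

lemma edge_cases:
  assumes T: "rooted_tree T" and e: "{x, y} \<in> gedges T"
  shows "level T y = Suc (level T x) \<and> ancestor T y (level T x) = x \<or>
     level T x = Suc (level T y) \<and> ancestor T x (level T y) = y"
proof -
  have E: "{x, y} \<subseteq> gverts T" "card {x, y} = 2" using T e by (auto simp: rooted_tree_def)
  then have "x \<noteq> y" and x: "x \<in> gverts T" and y: "y \<in> gverts T" by auto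
  define n where "n = level T x"
  define f where "f = ancestor T x"
  have p: "simple_path T f n" "f 0 = groot T" "f n = x"
    using ancestor_simple_path[OF T x] by (auto simp: f_def n_def)
  show ?thesis
  proof (cases "\<exists>j\<le>n. f j = y")
    case False
    then have s: "simple_path T (f(Suc n := y)) (Suc n)"
      using simple_path_snoc[OF p(1) y] e p(3) by auto
    then show ?thesis
      using level_path[OF T s] ancestor_path[OF T s, of n] p by (simp add: n_def)
  next
    case True
    then obtain j where j: "j \<le> n" "f j = y" by blast
    have "j \<noteq> n" using j p \<open>x \<noteq> y\<close> by auto
    have "\<not> j + 2 \<le> n"
    proof
      assume "j + 2 \<le> n"
      then have "has_cycle T"
        unfolding has_cycle_iff
        using simple_path_suffix[OF p(1) j(1)] p j e
        by (intro exI[of _ "\<lambda>t. f (j + t)"] exI[of _ "n - j"]) auto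
      then show False using T by (simp add: rooted_tree_def)
    qed
    then have "n = Suc j" using j \<open>j \<noteq> n\<close> by linarith
    moreover have "level T y = j"
      using level_path[OF T simple_path_prefix[OF p(1) j(1)] p(2)] j by simp
    ultimately show ?thesis using j by (simp add: n_def f_def)
  qed
qed

lemma edge_ancestor:
  assumes "rooted_tree T" "x \<in> gverts T" "i < level T x"
  shows "{ancestor T x i, ancestor T x (Suc i)} \<in> gedges T"
  using ancestor_simple_path[OF assms(1,2)] assms(3) by (simp add: simple_path_def)

lemma descendantD:
  assumes T: "rooted_tree T" and d: "descendant T x y"
  shows "x \<in> gverts T" "y \<in> gverts T" "level T x < level T y" "ancestor T y (level T x) = x"
proof -
  obtain p n f i where f: "simple_path T f n" "f 0 = y" "f n = groot T" "x = f i" "i \<le> n" "x \<noteq> y"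
    using d unfolding descendant_def path_from_to_iff by (auto simp: ran_def split: if_splits)
  define g where "g t = f (n - t)" for t
  have g: "simple_path T g n" "g 0 = groot T" "g n = y" "x = g (n - i)"
    using simple_path_rev[OF f(1)] f by (auto simp: g_def[abs_def])
  have l: "level T y = n" "level T x = n - i"
    using level_path[OF T g(1,2)] g(3)
      level_path[OF T simple_path_prefix[OF g(1), of "n - i"] g(2)] g(4) by auto
  show "x \<in> gverts T" "y \<in> gverts T" using f by (auto simp: simple_path_def)
  show "level T x < level T y" using l f by (cases "i = 0") auto
  show "ancestor T y (level T x) = x" using ancestor_path[OF T g(1,2), of "n - i"] g l by simp
qed

section \<open>Degrees, rays and induced subtrees in terms of levels and ancestors\<close>

definition induced :: "'a rooted_graph \<Rightarrow> 'a set \<Rightarrow> 'a rooted_graph" where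
  "induced T W = \<lparr>gverts = W, gedges = {e \<in> gedges T. e \<subseteq> W}, groot = groot T\<rparr>"

context
  fixes T :: "'a rooted_graph"
  assumes T: "rooted_tree T"
begin

interpretation ranked_tree "gverts T" "level T" "ancestor T" "groot T"
  by (rule ranked_tree_rooted_tree[OF T])

text \<open>At most one neighbour, the parent, is not a child. At the root the truncated subtraction
  yields the root itself, which does no harm in an upper bound.\<close>

lemma neighbours_subset:
  "neighbours T y \<subseteq> insert (ancestor T y (level T y - 1)) (kids (gverts T) y)"
proof
  fix x assume "x \<in> neighbours T y"
  then show "x \<in> insert (ancestor T y (level T y - 1)) (kids (gverts T) y)"
    using edge_cases[OF T, of y x] by (auto simp: neighbours_def kids_def)
qed

lemma vdegree_infD: "vdegree T y = \<infinity> \<Longrightarrow> infinite (kids (gverts T) y)"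
  using finite_subset[OF neighbours_subset] by (auto simp: vdegree_def split: if_splits)

text \<open>One neighbour may be the parent, so three is the least degree that forces two children
  at every vertex.\<close>

lemma vdegree_3D:
  assumes "vdegree T y \<ge> 3"
  shows "\<exists>a b. a \<in> kids (gverts T) y \<and> b \<in> kids (gverts T) y \<and> a \<noteq> b"
proof (rule ccontr)
  assume "\<not> ?thesis"
  then obtain c where "kids (gverts T) y \<subseteq> {c}" by blast
  then have s: "neighbours T y \<subseteq> {ancestor T y (level T y - 1), c}"
    using neighbours_subset[of y] by blast
  then have "finite (neighbours T y)" using finite_subset by blast
  moreover have "card (neighbours T y) \<le> 2"
    using card_mono[OF _ s] card_insert_le_m1[of 2 "{c}"] by (simp add: card_insert_if split: if_splits)
  ultimately have "vdegree T y \<le> enat 2" by (simp add: vdegree_def)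
  then have "(3::enat) \<le> enat 2" using assms by (rule order_trans[rotated])
  then show False by (simp add: numeral_eq_enat)
qed

lemma ray_root_path:
  assumes "q \<in> rays (gverts T)"
  shows "(\<lambda>n. Some (q n)) \<in> root_paths T"
proof -
  have q: "q n \<in> gverts T" "level T (q n) = n" "ancestor T (q (Suc n)) n = q n" for n
    using assms by (auto simp: rays_def)
  have "{q n, q (Suc n)} \<in> gedges T" for n
    using edge_ancestor[OF T q(1)[of "Suc n"], of n] q(2)[of "Suc n"] q(3)[of n]
      anc_self[OF q(1)[of "Suc n"]] by simp
  moreover have "inj q" using q(2) by (metis injI)
  moreover have "q 0 = groot T" using anc_0[OF q(1)[of 0]] anc_self[OF q(1)[of 0]] q(2)[of 0] by simp
  ultimately show ?thesis
    using q(1) by (auto simp: root_paths_def is_path_def dom_def ran_def inj_def inj_on_def)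
qed

text \<open>A finite path from the root is determined by its last vertex, so a countable tree has
  only countably many of them.\<close>

lemma root_path_cases:
  assumes "p \<in> root_paths T"
  obtains (fin) x where "x \<in> gverts T"
      "p = (\<lambda>i. if i \<le> level T x then Some (ancestor T x i) else None)"
    | (inf) q where "q \<in> rays (gverts T)" "p = (\<lambda>n. Some (q n))"
proof (cases "dom p = UNIV")
  case False
  then obtain k where k: "dom p = {..<k}" and p: "is_path T p" "p 0 = Some (groot T)"
    using assms by (auto simp: root_paths_def is_path_def)
  then obtain n where n: "k = Suc n" by (cases k) (auto simp: domIff)
  have "p n = Some (the (p n))" using k n by (metis domIff lessI lessThan_iff option.collapse)
  then have "path_from_to T (groot T) p n (the (p n))"
    using p k n by (auto simp: path_from_to_def lessThan_Suc_atMost)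
  then obtain f where f: "simple_path T f n" "f 0 = groot T"
    and pf: "p = (\<lambda>i. if i \<le> n then Some (f i) else None)"
    unfolding path_from_to_iff by blast
  have "f n \<in> gverts T" using f by (simp add: simple_path_def)
  moreover have "p = (\<lambda>i. if i \<le> level T (f n) then Some (ancestor T (f n) i) else None)"
    using level_path[OF T f] ancestor_path[OF T f] pf by auto
  ultimately show ?thesis using fin by blast
next
  case True
  define q where "q n = the (p n)" for n
  have pq: "p n = Some (q n)" for n
    using True by (metis UNIV_I domD option.sel q_def)
  have p: "is_path T p" "p 0 = Some (groot T)" using assms by (auto simp: root_paths_def)
  have "simple_path T q n" for n
    using p pq unfolding simple_path_def is_path_def inj_on_def
    by (metis UNIV_I True ranI subsetD)
  moreover have "q 0 = groot T" using p pq by simp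
  ultimately have "q \<in> rays (gverts T)"
    using level_path[OF T] ancestor_path[OF T, of q "Suc n" n for n]
    by (auto simp: rays_def simple_path_def)
  then show ?thesis using inf pq by blast
qed

context
  fixes W assumes W: "prefix_closed W" "groot T \<in> W"
begin

lemma induced_simps [simp]:
  "gverts (induced T W) = W" "gedges (induced T W) = {e \<in> gedges T. e \<subseteq> W}"
  "groot (induced T W) = groot T"
  by (simp_all add: induced_def)

lemma induced_path:
  assumes "y \<in> W"
  shows "simple_path (induced T W) (ancestor T y) (level T y)"
  using W ancestor_simple_path[OF T, of y] assms
  by (auto simp: simple_path_def prefix_closed_def)

text \<open>Induction on the level of \<open>y\<close>: a path from \<open>x\<close> to the parent
  of \<open>y\<close> either avoids \<open>y\<close> and can be prolonged by one edge, or passes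
  through \<open>y\<close> and can be cut off there.\<close>

lemma induced_connected:
  assumes "x \<in> W" "y \<in> W"
  shows "\<exists>f n. simple_path (induced T W) f n \<and> f 0 = x \<and> f n = y"
  using assms(2)
proof (induction "level T y" arbitrary: y)
  case 0
  have "x \<in> gverts T" "y \<in> gverts T" using assms 0 W by (auto simp: prefix_closed_def)
  moreover have "y = groot T" using 0 anc_0[of y] anc_self[of y] \<open>y \<in> gverts T\<close> by simp
  ultimately show ?case
    using simple_path_rev[OF induced_path[OF assms(1)]] anc_self anc_0
    by (intro exI[of _ "\<lambda>t. ancestor T x (level T x - t)"] exI[of _ "level T x"]) auto
next
  case (Suc m)
  have y: "y \<in> gverts T" using Suc W by (auto simp: prefix_closed_def)
  define z where "z = ancestor T y m"
  have z: "z \<in> W" "level T z = m"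
    using W Suc lev_anc[OF y, of m] by (auto simp: z_def prefix_closed_def)
  then obtain f n where f: "simple_path (induced T W) f n" "f 0 = x" "f n = z"
    using Suc by blast
  have e: "{z, y} \<in> gedges (induced T W)"
    using edge_ancestor[OF T y, of m] Suc anc_self[OF y] z by (simp add: z_def)
  show ?case
  proof (cases "\<exists>i\<le>n. f i = y")
    case True
    then show ?thesis using f simple_path_prefix by blast
  next
    case False
    then have "simple_path (induced T W) (f(Suc n := y)) (Suc n)"
      using simple_path_snoc[OF f(1)] f e Suc by auto
    then show ?thesis using f by (intro exI[of _ "f(Suc n := y)"] exI[of _ "Suc n"]) auto
  qed
qed

lemma induced_subtree: "subtree (induced T W) T"
proof -
  have "simple_path T f n" if "simple_path (induced T W) f n" for f n
    using that W by (auto simp: simple_path_def prefix_closed_def)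
  then have "\<not> has_cycle (induced T W)"
    using T unfolding rooted_tree_def has_cycle_iff by fastforce
  then show ?thesis
    using T W induced_connected
    by (auto simp: subtree_def rooted_tree_def graph_connected_iff prefix_closed_def)
qed

lemma induced_descendant:
  assumes "y \<in> W" "level T x < level T y" "ancestor T y (level T x) = x"
  shows "descendant (induced T W) x y"
proof -
  have y: "y \<in> gverts T" using assms W by (auto simp: prefix_closed_def)
  let ?f = "\<lambda>t. ancestor T y (level T y - t)"
  have "path_from_to (induced T W) y
    (\<lambda>i. if i \<le> level T y then Some (?f i) else None) (level T y) (groot T)"
    unfolding path_from_to_iff
    using simple_path_rev[OF induced_path[OF assms(1)]] anc_0[OF y] anc_self[OF y]
    by (intro exI[of _ ?f]) auto
  moreover have "x \<in> ran (\<lambda>i. if i \<le> level T y then Some (?f i) else None)"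
    using assms by (auto simp: ran_def intro!: exI[of _ "level T y - level T x"])
  ultimately show ?thesis unfolding descendant_def using assms by auto
qed

lemma kids_neighbours: "y \<in> W \<Longrightarrow> kids W y \<subseteq> neighbours (induced T W) y"
proof
  fix z assume y: "y \<in> W" and z: "z \<in> kids W y"
  then have "z \<in> gverts T" using W by (auto simp: prefix_closed_def kids_def)
  then show "z \<in> neighbours (induced T W) y"
    using edge_ancestor[OF T, of z "level T y"] z y anc_self[of z]
    by (auto simp: neighbours_def kids_def)
qed

lemma vdegree_induced_inf:
  "y \<in> W \<Longrightarrow> infinite (kids W y) \<Longrightarrow> vdegree (induced T W) y = \<infinity>"
  using finite_subset[OF kids_neighbours] by (auto simp: vdegree_def)

text \<open>The third neighbour is the parent, which exists because of the positive level; a root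
  with two children may have degree 2 only.\<close>

lemma vdegree_induced_3:
  assumes y: "y \<in> W" "0 < level T y" and ab: "a \<in> kids W y" "b \<in> kids W y" "a \<noteq> b"
  shows "vdegree (induced T W) y \<ge> 3"
proof -
  have yT: "y \<in> gverts T" using W y by (auto simp: prefix_closed_def)
  define z where "z = ancestor T y (level T y - 1)"
  have z: "z \<in> W" "level T z = level T y - 1"
    using W y lev_anc[OF yT, of "level T y - 1"] by (auto simp: z_def prefix_closed_def)
  then have "z \<in> neighbours (induced T W) y"
    using edge_ancestor[OF T yT, of "level T y - 1"] y anc_self[OF yT]
    by (auto simp: neighbours_def z_def insert_commute)
  then have s: "{a, b, z} \<subseteq> neighbours (induced T W) y" using kids_neighbours[OF y(1)] ab by auto
  have "card {a, b, z} = 3" using ab z by (auto simp: kids_def card_insert_if)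
  then have "enat 3 \<le> vdegree (induced T W) y"
    using card_mono[OF _ s] by (auto simp: vdegree_def)
  then show ?thesis by (simp add: numeral_eq_enat)
qed

end

end

section \<open>Perfect kernels\<close>

context ranked_tree
begin

lemma ray_0: "q \<in> rays V \<Longrightarrow> q 0 = rt"
  using anc_0[of "q 0"] anc_self[of "q 0"] by (auto simp: rays_def)

lemma ray_prefix:
  assumes "q \<in> rays V" "q' \<in> rays V" "q n = q' n" "i \<le> n"
  shows "q i = q' i"
  using ray_anc[OF assms(1) order_refl assms(4)] ray_anc[OF assms(2) order_refl assms(4)] assms(3)
  by simp

text \<open>A Cantor--Bendixson argument: keep the vertices that lie on a non-small set of rays.\<close>

lemma perfect_kernel:
  fixes small :: "(nat \<Rightarrow> 'a) set \<Rightarrow> bool" and big :: "'a set \<Rightarrow> bool"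
  assumes V: "countable V"
    and small_subset: "\<And>A B. A \<subseteq> B \<Longrightarrow> small B \<Longrightarrow> small A"
    and small_Un: "\<And>A B. small A \<Longrightarrow> small B \<Longrightarrow> small (A \<union> B)"
    and small_UN: "\<And>F (I :: 'a set). countable I \<Longrightarrow> (\<And>i. i \<in> I \<Longrightarrow> small (F i)) \<Longrightarrow> small (\<Union>i\<in>I. F i)"
    and thin: "\<And>W c. prefix_closed W \<Longrightarrow> c \<in> W \<Longrightarrow>
      (\<And>y. y \<in> W \<Longrightarrow> lev c \<le> lev y \<Longrightarrow> anc y (lev c) = c \<Longrightarrow> \<not> big (kids W y)) \<Longrightarrow>
      small {q \<in> rays W. q (lev c) = c}"
    and not_small: "\<not> small (rays V)"
  obtains W where "prefix_closed W" "rt \<in> W"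
    "\<And>x. x \<in> W \<Longrightarrow> \<exists>y\<in>W. lev x < lev y \<and> anc y (lev x) = x \<and> big (kids W y)"
proof -
  define thr where "thr x = {q \<in> rays V. q (lev x) = x}" for x
  define W where "W = {x \<in> V. \<not> small (thr x)}"
  have WV: "W \<subseteq> V" by (auto simp: W_def)
  have pc: "prefix_closed W"
    unfolding prefix_closed_def
  proof (intro conjI WV ballI allI impI)
    fix x i assume x: "x \<in> W" "i \<le> lev x"
    then have xV: "x \<in> V" using WV by auto
    have "thr x \<subseteq> thr (anc x i)"
    proof
      fix q assume "q \<in> thr x"
      then have q: "q \<in> rays V" "q (lev x) = x" by (auto simp: thr_def)
      have "q i = anc x i" using ray_anc[OF q(1) order_refl x(2)] q(2) by simp
      then show "q \<in> thr (anc x i)" using q(1) lev_anc[OF xV x(2)] by (simp add: thr_def)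
    qed
    then have "\<not> small (thr (anc x i))" using small_subset x(1) unfolding W_def by blast
    then show "anc x i \<in> W" using anc_in[OF xV x(2)] by (simp add: W_def)
  qed
  have "rays V \<subseteq> thr rt" using ray_0 lev_rt by (auto simp: thr_def)
  then have "\<not> small (thr rt)" using small_subset not_small by blast
  then have rt: "rt \<in> W" using rt_in by (simp add: W_def)
  have "\<exists>y\<in>W. lev x < lev y \<and> anc y (lev x) = x \<and> big (kids W y)" if x: "x \<in> W" for x
  proof (rule ccontr)
    \<comment> \<open>The rays through \<open>x\<close> are covered by two small sets, against
      \<open>x \<in> W\<close>: those that leave \<open>W\<close> pass through one of countably many
      rejected vertices, those that stay in \<open>W\<close> are handled by
      \<open>thin\<close>.\<close>
    assume neg: "\<not> ?thesis"
    have out: "small (\<Union>z\<in>V - W. thr z)"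
    proof (rule small_UN)
      show "countable (V - W)" using V by auto
      show "small (thr z)" if "z \<in> V - W" for z using that by (simp add: W_def)
    qed
    \<comment> \<open>The rays are sorted by their vertex \<open>c\<close> just after
      \<open>x\<close>: \<open>thin\<close> inspects all vertices from \<open>c\<close> on,
      including \<open>c\<close>, while \<open>neg\<close> speaks of proper descendants of
      \<open>x\<close> only.\<close>
    have inn: "small (\<Union>c\<in>kids W x. {q \<in> rays W. q (lev c) = c})"
    proof (rule small_UN)
      have "kids W x \<subseteq> V" using WV by (auto simp: kids_def)
      then show "countable (kids W x)" using V countable_subset by blast
      fix c assume "c \<in> kids W x"
      then have c: "c \<in> W" "lev c = Suc (lev x)" "anc c (lev x) = x" by (auto simp: kids_def)
      show "small {q \<in> rays W. q (lev c) = c}"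
      proof (rule thin[OF pc c(1)])
        fix y assume y: "y \<in> W" "lev c \<le> lev y" "anc y (lev c) = c"
        have "anc y (lev x) = x"
          using anc_anc[of y "lev x" "lev c"] y c WV by auto
        then show "\<not> big (kids W y)" using neg y c by auto
      qed
    qed
    have "thr x \<subseteq> (\<Union>z\<in>V - W. thr z) \<union> (\<Union>c\<in>kids W x. {q \<in> rays W. q (lev c) = c})"
    proof
      fix q assume "q \<in> thr x"
      then have q: "q \<in> rays V" "q (lev x) = x" by (auto simp: thr_def)
      have qn: "q n \<in> V" "lev (q n) = n" "anc (q (Suc n)) n = q n" for n
        using q(1) by (auto simp: rays_def)
      show "q \<in> (\<Union>z\<in>V - W. thr z) \<union> (\<Union>c\<in>kids W x. {q \<in> rays W. q (lev c) = c})"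
      proof (cases "\<exists>n. q n \<notin> W")
        case True
        then obtain n where n: "q n \<notin> W" by blast
        have "q \<in> thr (q n)" using q qn by (simp add: thr_def)
        then show ?thesis using n qn(1)[of n] by blast
      next
        case False
        then have r: "q \<in> rays W" using qn by (simp add: rays_def)
        let ?c = "q (Suc (lev x))"
        have "?c \<in> kids W x" using False qn(2)[of "Suc (lev x)"] qn(3)[of "lev x"] q(2)
          by (simp add: kids_def)
        moreover have "q (lev ?c) = ?c" using qn(2)[of "Suc (lev x)"] by simp
        ultimately show ?thesis using r by blast
      qed
    qed
    then have "small (thr x)" using small_subset small_Un[OF out inn] by blast
    then show False using x by (simp add: W_def)
  qed
  then show ?thesis using that pc rt by blast
qed

lemma ray_kids: "q \<in> rays W \<Longrightarrow> q (Suc n) \<in> kids W (q n)"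
  by (auto simp: rays_def kids_def)

text \<open>Small means countable and big means having two elements. If no vertex from
  \<open>c\<close> on branches in \<open>W\<close>, each vertex of a ray through \<open>c\<close>
  determines the next, so there is at most one such ray.\<close>

lemma uncountable_rays_kernel:
  assumes V: "countable V" and unc: "uncountable (rays V)"
  obtains W where "prefix_closed W" "rt \<in> W"
    "\<And>x. x \<in> W \<Longrightarrow> \<exists>y\<in>W. lev x < lev y \<and> anc y (lev x) = x \<and>
      (\<exists>a b. a \<in> kids W y \<and> b \<in> kids W y \<and> a \<noteq> b)"
proof (rule perfect_kernel[OF V, of countable "\<lambda>K. \<exists>a b. a \<in> K \<and> b \<in> K \<and> a \<noteq> b"])
  fix W c assume W: "prefix_closed W" and c: "c \<in> W"
    and nb: "\<And>y. y \<in> W \<Longrightarrow> lev c \<le> lev y \<Longrightarrow> anc y (lev c) = c \<Longrightarrow>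
      \<not> (\<exists>a b. a \<in> kids W y \<and> b \<in> kids W y \<and> a \<noteq> b)"
  have WV: "W \<subseteq> V" using W by (simp add: prefix_closed_def)
  have "q = q'" if q: "q \<in> rays W" "q (lev c) = c" and q': "q' \<in> rays W" "q' (lev c) = c" for q q'
  proof
    fix n
    have up: "q (lev c + k) = q' (lev c + k)" for k
    proof (induction k)
      case (Suc k)
      let ?y = "q (lev c + k)"
      have "anc ?y (lev c) = c" using ray_anc[OF q(1) WV, of "lev c" "lev c + k"] q(2) by simp
      moreover have "?y \<in> W" "lev ?y = lev c + k" using q(1) by (auto simp: rays_def)
      ultimately have "\<not> (\<exists>a b. a \<in> kids W ?y \<and> b \<in> kids W ?y \<and> a \<noteq> b)" using nb[of ?y] by simp
      moreover have "q (Suc (lev c + k)) \<in> kids W ?y" "q' (Suc (lev c + k)) \<in> kids W ?y"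
        using ray_kids[OF q(1), of "lev c + k"] ray_kids[OF q'(1), of "lev c + k"] Suc by simp_all
      ultimately show ?case by auto
    qed (simp add: q q')
    show "q n = q' n"
    proof (cases "n \<le> lev c")
      case True
      then show ?thesis using ray_anc[OF q(1) WV True] ray_anc[OF q'(1) WV True] q(2) q'(2) by simp
    next
      case False
      then show ?thesis using up[of "n - lev c"] by simp
    qed
  qed
  then obtain r where "{q \<in> rays W. q (lev c) = c} \<subseteq> {r}" by blast
  then show "countable {q \<in> rays W. q (lev c) = c}" by (rule countable_subset) simp
next
  show "countable A" if "A \<subseteq> B" "countable B" for A B :: "(nat \<Rightarrow> 'a) set"
    using that by (rule countable_subset)
next
  fix W assume "prefix_closed W" "rt \<in> W"
    "\<And>x. x \<in> W \<Longrightarrow> \<exists>y\<in>W. lev x < lev y \<and> anc y (lev x) = x \<and>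
      (\<exists>a b. a \<in> kids W y \<and> b \<in> kids W y \<and> a \<noteq> b)"
  then show thesis by (rule that)
qed (use unc in auto)

text \<open>In the topology of pointwise convergence over discrete vertices, these are the sets
  covered by countably many compact sets. The kernel obtained below is a superperfect tree, just as
  the uncountable case gives a perfect one.\<close>

definition sigma_bounded :: "(nat \<Rightarrow> 'a) set \<Rightarrow> bool" where
  "sigma_bounded S \<longleftrightarrow> (\<exists>\<B>. countable \<B> \<and> S \<subseteq> \<Union>\<B> \<and> (\<forall>B\<in>\<B>. \<forall>i. finite ((\<lambda>q. q i) ` B)))"

lemma sigma_boundedI:
  "countable \<B> \<Longrightarrow> S \<subseteq> \<Union>\<B> \<Longrightarrow> (\<And>B i. B \<in> \<B> \<Longrightarrow> finite ((\<lambda>q. q i) ` B)) \<Longrightarrow> sigma_bounded S"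
  unfolding sigma_bounded_def by (intro exI[of _ \<B>]) simp

lemma sigma_boundedE:
  assumes "sigma_bounded S"
  obtains \<B> where "countable \<B>" "S \<subseteq> \<Union>\<B>" "\<forall>B\<in>\<B>. \<forall>i. finite ((\<lambda>q. q i) ` B)"
  using assms unfolding sigma_bounded_def by (elim exE conjE)

text \<open>The essential point is \<open>thin\<close>: if all vertices of \<open>W\<close> from
  \<open>c\<close> on have finitely many children, then the rays through \<open>c\<close> use one
  vertex at each level up to that of \<open>c\<close> and, by induction, finitely many at each later
  level. They form a single bounded set.\<close>

lemma not_sigma_bounded_kernel:
  assumes V: "countable V" and unb: "\<not> sigma_bounded (rays V)"
  obtains W where "prefix_closed W" "rt \<in> W"
    "\<And>x. x \<in> W \<Longrightarrow> \<exists>y\<in>W. lev x < lev y \<and> anc y (lev x) = x \<and> infinite (kids W y)"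
proof (rule perfect_kernel[OF V, of sigma_bounded infinite])
  fix A B assume "A \<subseteq> B" "sigma_bounded B"
  from this(2) show "sigma_bounded A"
    by (rule sigma_boundedE) (rule sigma_boundedI, use \<open>A \<subseteq> B\<close> in auto)
next
  fix A B assume A: "sigma_bounded A" and B: "sigma_bounded B"
  obtain \<A> where \<A>: "countable \<A>" "A \<subseteq> \<Union>\<A>" "\<forall>B\<in>\<A>. \<forall>i. finite ((\<lambda>q. q i) ` B)"
    using A by (rule sigma_boundedE)
  obtain \<B> where \<B>: "countable \<B>" "B \<subseteq> \<Union>\<B>" "\<forall>B\<in>\<B>. \<forall>i. finite ((\<lambda>q. q i) ` B)"
    using B by (rule sigma_boundedE)
  show "sigma_bounded (A \<union> B)"
    by (rule sigma_boundedI[of "\<A> \<union> \<B>"]) (use \<A> \<B> in auto)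
next
  fix F and I :: "'a set" assume I: "countable I" "\<And>i. i \<in> I \<Longrightarrow> sigma_bounded (F i)"
  have "\<forall>i. \<exists>\<B>. i \<in> I \<longrightarrow> countable \<B> \<and> F i \<subseteq> \<Union>\<B> \<and> (\<forall>B\<in>\<B>. \<forall>j. finite ((\<lambda>q. q j) ` B))"
    using I(2) unfolding sigma_bounded_def by simp
  from choice[OF this] obtain \<B> where "\<forall>i. i \<in> I \<longrightarrow> countable (\<B> i) \<and> F i \<subseteq> \<Union>(\<B> i) \<and>
    (\<forall>B\<in>\<B> i. \<forall>j. finite ((\<lambda>q. q j) ` B))" ..
  note \<B> = this[rule_format]
  show "sigma_bounded (\<Union>i\<in>I. F i)"
  proof (rule sigma_boundedI[of "\<Union>i\<in>I. \<B> i"])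
    show "countable (\<Union>i\<in>I. \<B> i)" using I(1) \<B> by auto
    show "(\<Union>i\<in>I. F i) \<subseteq> \<Union>(\<Union>i\<in>I. \<B> i)"
    proof (rule UN_least)
      fix i assume i: "i \<in> I"
      have "F i \<subseteq> \<Union>(\<B> i)" using \<B>[OF i] by simp
      also have "\<dots> \<subseteq> \<Union>(\<Union>i\<in>I. \<B> i)" using i by (intro Union_mono UN_upper)
      finally show "F i \<subseteq> \<Union>(\<Union>i\<in>I. \<B> i)" .
    qed
    show "finite ((\<lambda>q. q j) ` B)" if B: "B \<in> (\<Union>i\<in>I. \<B> i)" for B j
      using B \<B> by (elim UN_E) simp
  qed
next
  show "\<not> sigma_bounded (rays V)" by fact
next
  fix W c assume W: "prefix_closed W" and c: "c \<in> W"
    and nb: "\<And>y. y \<in> W \<Longrightarrow> lev c \<le> lev y \<Longrightarrow> anc y (lev c) = c \<Longrightarrow> \<not> infinite (kids W y)"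
  have WV: "W \<subseteq> V" using W by (simp add: prefix_closed_def)
  let ?S = "{q \<in> rays W. q (lev c) = c}"
  have low: "finite ((\<lambda>q. q i) ` ?S)" if "i \<le> lev c" for i
  proof (rule finite_subset)
    show "(\<lambda>q. q i) ` ?S \<subseteq> {anc c i}"
    proof (rule image_subsetI)
      fix q assume "q \<in> ?S"
      then show "q i \<in> {anc c i}" using ray_anc[OF _ WV that, of q] by simp
    qed
  qed simp
  have up: "finite ((\<lambda>q. q (lev c + k)) ` ?S)" for k
  proof (induction k)
    case 0
    show ?case using low[of "lev c"] by simp
  next
    case (Suc k)
    have step: "(\<lambda>q. q (lev c + Suc k)) ` ?S \<subseteq> (\<Union>y\<in>(\<lambda>q. q (lev c + k)) ` ?S. kids W y)"
      using ray_kids by auto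
    have "finite (kids W (q (lev c + k)))" if q: "q \<in> ?S" for q
    proof -
      have "anc (q (lev c + k)) (lev c) = c" using ray_anc[OF _ WV, of q "lev c" "lev c + k"] q by simp
      moreover have "q (lev c + k) \<in> W" "lev (q (lev c + k)) = lev c + k" using q by (auto simp: rays_def)
      ultimately show ?thesis using nb[of "q (lev c + k)"] by simp
    qed
    then have "finite (kids W y)" if "y \<in> (\<lambda>q. q (lev c + k)) ` ?S" for y
      using that by (elim imageE) simp
    then have "finite (\<Union>y\<in>(\<lambda>q. q (lev c + k)) ` ?S. kids W y)"
      by (rule finite_UN_I[OF Suc])
    with step show ?case by (rule finite_subset)
  qed
  have "finite ((\<lambda>q. q i) ` ?S)" for i
  proof (cases "i \<le> lev c")
    case True
    then show ?thesis using low by simp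
  next
    case False
    then show ?thesis using up[of "i - lev c"] by simp
  qed
  then show "sigma_bounded ?S" by (intro sigma_boundedI[of "{?S}"]) simp_all
next
  fix W assume "prefix_closed W" "rt \<in> W"
    "\<And>x. x \<in> W \<Longrightarrow> \<exists>y\<in>W. lev x < lev y \<and> anc y (lev x) = x \<and> infinite (kids W y)"
  then show thesis by (rule that)
qed

end

section \<open>Upper bounds\<close>

lemma path_bijection_chart:
  assumes "f \<in> path_bijections T"
  obtains p q where "p \<in> root_paths T" "q \<in> root_paths T" "dom p = dom q"
    "Map.graph f = {(a, b). \<exists>i. p i = Some a \<and> q i = Some b}"
proof -
  obtain p q where p: "p \<in> root_paths T" "q \<in> root_paths T" "dom f = ran p" "f \<circ>\<^sub>m p = q"
    using assms by (auto simp: path_bijections_def)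
  have q: "q i = (case p i of None \<Rightarrow> None | Some x \<Rightarrow> f x)" for i
    using p(4) by (auto simp: map_comp_def)
  have def: "p i = Some a \<Longrightarrow> \<exists>b. f a = Some b" for i a
    using p(3) by (auto simp: dom_def ran_def set_eq_iff)
  have "Map.graph f = {(a, b). \<exists>i. p i = Some a \<and> q i = Some b}"
  proof (intro set_eqI iffI; clarsimp simp: Map.graph_def)
    fix a b assume ab: "f a = Some b"
    then have "a \<in> ran p" using p(3) by auto
    then obtain i where "p i = Some a" by (auto simp: ran_def)
    then show "\<exists>i. p i = Some a \<and> q i = Some b" using ab q by auto
  qed (use q in auto)
  moreover have "dom p = dom q"
    using q def by (auto simp: dom_def split: option.splits)
  ultimately show ?thesis using that p by blast
qed

lemma infinite_root_path:
  assumes T: "rooted_tree T" and p: "p \<in> root_paths T" "dom p = UNIV"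
  shows "\<exists>q\<in>ranked_tree.rays (level T) (ancestor T) (gverts T). p = (\<lambda>n. Some (q n))"
  using T p(1)
proof (rule root_path_cases)
  fix x assume "p = (\<lambda>i. if i \<le> level T x then Some (ancestor T x i) else None)"
  then have "p (Suc (level T x)) = None" by simp
  then have "Suc (level T x) \<notin> dom p" by (simp add: domIff)
  then show ?thesis using p(2) by simp
qed blast

lemma countable_finite_root_paths:
  assumes "rooted_tree T" "countable (gverts T)"
  shows "countable {p \<in> root_paths T. dom p \<noteq> UNIV}"
proof (rule countable_subset)
  show "{p \<in> root_paths T. dom p \<noteq> UNIV} \<subseteq>
    (\<lambda>x i. if i \<le> level T x then Some (ancestor T x i) else None) ` gverts T"
  proof (rule subsetI)
    fix p assume "p \<in> {p \<in> root_paths T. dom p \<noteq> UNIV}"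
    then have p: "p \<in> root_paths T" "dom p \<noteq> UNIV" by auto
    from assms(1) p(1) show "p \<in> (\<lambda>x i. if i \<le> level T x then Some (ancestor T x i) else None) ` gverts T"
      by (rule root_path_cases) (use p(2) in auto)
  qed
qed (use assms in auto)

lemma countable_path_bijections:
  assumes "countable Q"
  shows "countable {f \<in> path_bijections T. \<exists>p\<in>Q. \<exists>q\<in>Q.
    Map.graph f = {(a, b). \<exists>i. p i = Some a \<and> q i = Some b}}"
proof (rule countable_subset)
  show "{f \<in> path_bijections T. \<exists>p\<in>Q. \<exists>q\<in>Q.
    Map.graph f = {(a, b). \<exists>i. p i = Some a \<and> q i = Some b}} \<subseteq>
    (\<lambda>(p, q). chart {(a, b). \<exists>i. p i = Some a \<and> q i = Some b}) ` (Q \<times> Q)"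
  proof safe
    fix f p q assume "p \<in> Q" "q \<in> Q" "Map.graph f = {(a, b). \<exists>i. p i = Some a \<and> q i = Some b}"
    then show "f \<in> (\<lambda>(p, q). chart {(a, b). \<exists>i. p i = Some a \<and> q i = Some b}) ` (Q \<times> Q)"
      using chart_graph[of f] by (intro image_eqI[of _ _ "(p, q)"]) auto
  qed
qed (use assms in auto)

text \<open>Level \<open>i\<close> gets a part \<open>\<Phi> i\<close> of its own, with a marked
  point \<open>a i\<close> and an injected copy of the finitely many vertices that rays of
  \<open>B\<close> have there. Selecting a ray means moving each \<open>a i\<close> inside its part,
  which an element of the stabiliser can do. The charts \<open>\<alpha>\<close> and
  \<open>\<omega>\<close> depend on \<open>B\<close> but not on the ray, and the sequence
  \<open>l\<close> does not even depend on \<open>B\<close>.\<close>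

lemma (in ranked_tree) bounded_rays_factor:
  fixes l :: "nat \<Rightarrow> 'a"
  assumes X: "countable V" "infinite V" and P: "aleph0_unbounded_partition V \<P>"
    and l: "inj l" "range l \<subseteq> V"
    and B: "\<And>i. finite ((\<lambda>q. q i) ` B)"
  shows "\<exists>\<alpha> \<omega>. biunique \<alpha> \<and> biunique \<omega> \<and> \<alpha> \<subseteq> V \<times> V \<and> \<omega> \<subseteq> V \<times> V \<and>
    (\<forall>q \<in> B \<inter> rays V. \<exists>\<sigma> \<tau>. biunique \<sigma> \<and> biunique \<tau> \<and> chart \<sigma> \<in> PStab V \<P> \<and> chart \<tau> \<in> PStab V \<P> \<and>
      {(l i, q i) | i. True} = \<alpha> O \<sigma> O \<omega>\<inverse> \<and> {(q i, l i) | i. True} = \<omega> O \<tau> O \<alpha>\<inverse>)"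
proof -
  have part: "partition_on V \<P>" and finP: "\<And>A. A \<in> \<P> \<Longrightarrow> finite A"
    using P by (auto simp: aleph0_unbounded_partition_def)
  have disj: "A = A'" if "A \<in> \<P>" "A' \<in> \<P>" "x \<in> A" "x \<in> A'" for A A' x
    using partition_onD2[OF part] that by (meson disjointD disjoint_iff)
  have PV: "x \<in> V" if "A \<in> \<P>" "x \<in> A" for A x
    using partition_onD1[OF part] that by blast
  define L where "L i = (\<lambda>q. q i) ` (B \<inter> rays V)" for i
  have finL: "finite (L i)" for i unfolding L_def by (rule finite_subset[OF _ B[of i]]) blast
  have levL: "lev x = i" "x \<in> V" if "x \<in> L i" for x i using that by (auto simp: L_def rays_def)
  \<comment> \<open>The \<open>Suc\<close> makes the part nonempty even if \<open>L i\<close> is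
    empty, so that a marked point exists.\<close>
  obtain \<Phi> where \<Phi>: "inj_on \<Phi> (UNIV :: nat set)" "\<And>i. \<Phi> i \<in> \<P>" "\<And>i. Suc (card (L i)) \<le> card (\<Phi> i)"
    using distinct_large_parts[OF X P, of "UNIV :: nat set" "\<lambda>i. Suc (card (L i))"] by auto
  have \<Phi>eq: "i = j" if "x \<in> \<Phi> i" "x \<in> \<Phi> j" for i j x
    using disj[OF \<Phi>(2) \<Phi>(2) that] \<Phi>(1) by (rule injD[rotated])
  have "\<Phi> i \<noteq> {}" for i using \<Phi>(3)[of i] by auto
  then have "\<forall>i. \<exists>x. x \<in> \<Phi> i" by blast
  from choice[OF this] obtain a where "\<forall>i. a i \<in> \<Phi> i" ..
  then have a: "a i \<in> \<Phi> i" for i by simp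
  have "\<forall>i. \<exists>w. w ` L i \<subseteq> \<Phi> i \<and> inj_on w (L i)"
    using card_le_inj[OF finL finP[OF \<Phi>(2)]] \<Phi>(3) Suc_leD by blast
  from choice[OF this] obtain w where w': "\<forall>i. w i ` L i \<subseteq> \<Phi> i \<and> inj_on (w i) (L i)" ..
  have w: "w i x \<in> \<Phi> i" if "x \<in> L i" for i x using w' that by blast
  have winj: "x = y" if "x \<in> L i" "y \<in> L i" "w i x = w i y" for i x y
    using w' that by (meson inj_onD)
  define \<alpha> where "\<alpha> = {(l i, a i) | i. True}"
  define \<omega> where "\<omega> = {(x, w i x) | i x. x \<in> L i}"
  have bi: "biunique \<alpha>" "biunique \<omega>"
  proof -
    show "biunique \<alpha>"
    proof (rule biuniqueI)
      fix x y z assume "(x, y) \<in> \<alpha>" "(x, z) \<in> \<alpha>"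
      then obtain i j where "x = l i" "x = l j" "y = a i" "z = a j" unfolding \<alpha>_def by blast
      then show "y = z" using injD[OF l(1), of i j] by simp
    next
      fix x y z assume "(x, z) \<in> \<alpha>" "(y, z) \<in> \<alpha>"
      then obtain i j where ij: "x = l i" "y = l j" "z = a i" "z = a j" unfolding \<alpha>_def by blast
      have "z \<in> \<Phi> i" "z \<in> \<Phi> j" using a[of i] ij(3) a[of j] ij(4) by metis+
      then show "x = y" using \<Phi>eq ij(1,2) by metis
    qed
    show "biunique \<omega>"
    proof (rule biuniqueI)
      fix x y z assume "(x, y) \<in> \<omega>" "(x, z) \<in> \<omega>"
      then obtain i j where ij: "x \<in> L i" "x \<in> L j" "y = w i x" "z = w j x" unfolding \<omega>_def by blast
      then show "y = z" using levL(1)[OF ij(1)] levL(1)[OF ij(2)] by metis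
    next
      fix x y z assume "(x, z) \<in> \<omega>" "(y, z) \<in> \<omega>"
      then obtain i j where ij: "x \<in> L i" "y \<in> L j" "z = w i x" "z = w j y" unfolding \<omega>_def by blast
      have "z \<in> \<Phi> i" "z \<in> \<Phi> j" using w[OF ij(1)] w[OF ij(2)] ij(3,4) by metis+
      then have "i = j" by (rule \<Phi>eq)
      then show "x = y" using ij winj[of x i y] by metis
    qed
  qed
  have sub: "\<alpha> \<subseteq> V \<times> V" "\<omega> \<subseteq> V \<times> V"
    using l(2) PV[OF \<Phi>(2) a] PV[OF \<Phi>(2) w] levL(2) by (auto simp: \<alpha>_def \<omega>_def)
  have "\<exists>\<sigma> \<tau>. biunique \<sigma> \<and> biunique \<tau> \<and> chart \<sigma> \<in> PStab V \<P> \<and> chart \<tau> \<in> PStab V \<P> \<and>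
      {(l i, q i) | i. True} = \<alpha> O \<sigma> O \<omega>\<inverse> \<and> {(q i, l i) | i. True} = \<omega> O \<tau> O \<alpha>\<inverse>"
    if q: "q \<in> B \<inter> rays V" for q
  proof -
    have qL: "q i \<in> L i" for i using q by (auto simp: L_def)
    define R where "R = {(a i, w i (q i)) | i. True}"
    have biR: "biunique R"
    proof (rule biuniqueI)
      fix x y z assume "(x, y) \<in> R" "(x, z) \<in> R"
      then obtain i j where ij: "x = a i" "x = a j" "y = w i (q i)" "z = w j (q j)" unfolding R_def by blast
      have "x \<in> \<Phi> i" "x \<in> \<Phi> j" using a[of i] ij(1) a[of j] ij(2) by metis+
      then show "y = z" using \<Phi>eq ij(3,4) by metis
    next
      fix x y z assume "(x, z) \<in> R" "(y, z) \<in> R"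
      then obtain i j where ij: "x = a i" "y = a j" "z = w i (q i)" "z = w j (q j)" unfolding R_def by blast
      have "z \<in> \<Phi> i" "z \<in> \<Phi> j" using w[OF qL[of i]] ij(3) w[OF qL[of j]] ij(4) by metis+
      then show "x = y" using \<Phi>eq ij(1,2) by metis
    qed
    have partR: "\<exists>A\<in>\<P>. x \<in> A \<and> y \<in> A" if "(x, y) \<in> R \<or> (y, x) \<in> R" for x y
      using that \<Phi>(2) a w[OF qL] by (auto simp: R_def)
    \<comment> \<open>\<open>\<sigma>\<close> and \<open>\<tau>\<close> extend \<open>R\<close> and
      its converse independently; outside the prescribed points they need not be inverse to each
      other.\<close>
    obtain \<sigma> where \<sigma>: "R \<subseteq> \<sigma>" "biunique \<sigma>" "chart \<sigma> \<in> PStab V \<P>"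
      using PStab_extension[OF part finP biR] partR by metis
    obtain \<tau> where \<tau>: "R\<inverse> \<subseteq> \<tau>" "biunique \<tau>" "chart \<tau> \<in> PStab V \<P>"
      using PStab_extension[OF part finP biunique_converse[OF biR]] partR by (metis converse_iff)
    have \<alpha>i: "(l i, a i) \<in> \<alpha>" and \<omega>i: "(q i, w i (q i)) \<in> \<omega>" and Ri: "(a i, w i (q i)) \<in> R" for i
      using qL by (auto simp: \<alpha>_def \<omega>_def R_def)
    have "{(l i, q i) | i. True} = \<alpha> O \<sigma> O \<omega>\<inverse>"
    proof (intro set_eqI iffI)
      fix p assume "p \<in> {(l i, q i) | i. True}"
      then obtain i where "p = (l i, q i)" by auto
      then show "p \<in> \<alpha> O \<sigma> O \<omega>\<inverse>" using \<alpha>i[of i] \<omega>i[of i] Ri[of i] \<sigma>(1) by auto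
    next
      fix p assume "p \<in> \<alpha> O \<sigma> O \<omega>\<inverse>"
      then obtain i y z where p: "p = (l i, z)" "(a i, y) \<in> \<sigma>" "(z, y) \<in> \<omega>" unfolding \<alpha>_def by blast
      have "y = w i (q i)" using biunique_right[OF \<sigma>(2) p(2)] Ri \<sigma>(1) by blast
      then have "z = q i" using biunique_left[OF bi(2) p(3)] \<omega>i by blast
      then show "p \<in> {(l i, q i) | i. True}" using p by blast
    qed
    moreover have "{(q i, l i) | i. True} = \<omega> O \<tau> O \<alpha>\<inverse>"
    proof (intro set_eqI iffI)
      fix p assume "p \<in> {(q i, l i) | i. True}"
      then obtain i where "p = (q i, l i)" by auto
      then show "p \<in> \<omega> O \<tau> O \<alpha>\<inverse>" using \<alpha>i[of i] \<omega>i[of i] Ri[of i] \<tau>(1) by auto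
    next
      fix p assume "p \<in> \<omega> O \<tau> O \<alpha>\<inverse>"
      then obtain i y z where p: "p = (z, l i)" "(y, a i) \<in> \<tau>" "(z, y) \<in> \<omega>" unfolding \<alpha>_def by blast
      have "y = w i (q i)" using biunique_left[OF \<tau>(2) p(2)] Ri \<tau>(1) by blast
      then have "z = q i" using biunique_left[OF bi(2) p(3)] \<omega>i by blast
      then show "p \<in> {(q i, l i) | i. True}" using p by blast
    qed
    ultimately show ?thesis using \<sigma>(2,3) \<tau>(2,3) by blast
  qed
  then show ?thesis using bi sub by blast
qed

lemma path_bijections_preceq_PStab:
  assumes T: "rooted_tree T" and X: "countable (gverts T)" "infinite (gverts T)"
    and P: "aleph0_unbounded_partition (gverts T) \<P>"
    and sb: "ranked_tree.sigma_bounded (ranked_tree.rays (level T) (ancestor T) (gverts T))"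
  shows "preceq_I (gverts T) (path_bijections T) (PStab (gverts T) \<P>)"
proof -
  interpret ranked_tree "gverts T" "level T" "ancestor T" "groot T"
    by (rule ranked_tree_rooted_tree[OF T])
  let ?X = "gverts T"
  obtain \<B> where \<B>: "countable \<B>" "rays ?X \<subseteq> \<Union>\<B>" "\<forall>B\<in>\<B>. \<forall>i. finite ((\<lambda>q. q i) ` B)"
    using sb by (rule sigma_boundedE)
  obtain l :: "nat \<Rightarrow> 'a" where l: "inj l" "range l \<subseteq> ?X"
    using infinite_countable_subset[OF X(2)] by blast
  define good where "good B \<alpha> \<omega> \<longleftrightarrow> biunique \<alpha> \<and> biunique \<omega> \<and> \<alpha> \<subseteq> ?X \<times> ?X \<and> \<omega> \<subseteq> ?X \<times> ?X \<and>
    (\<forall>q \<in> B \<inter> rays ?X. \<exists>\<sigma> \<tau>. biunique \<sigma> \<and> biunique \<tau> \<and> chart \<sigma> \<in> PStab ?X \<P> \<and> chart \<tau> \<in> PStab ?X \<P> \<and>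
      {(l i, q i) | i. True} = \<alpha> O \<sigma> O \<omega>\<inverse> \<and> {(q i, l i) | i. True} = \<omega> O \<tau> O \<alpha>\<inverse>)" for B \<alpha> \<omega>
  have "\<forall>B. \<exists>\<alpha>\<omega>. B \<in> \<B> \<longrightarrow> good B (fst \<alpha>\<omega>) (snd \<alpha>\<omega>)"
    using bounded_rays_factor[OF X P l] \<B>(3) unfolding good_def[symmetric] by auto
  from choice[OF this] obtain g where "\<forall>B. B \<in> \<B> \<longrightarrow> good B (fst (g B)) (snd (g B))" ..
  then have g: "good B (fst (g B)) (snd (g B))" if "B \<in> \<B>" for B using that by blast
  \<comment> \<open>Four charts for each bounded set, hence countably many in total, although a
    bounded set may contain uncountably many rays.\<close>
  define C1 where "C1 = (\<Union>B\<in>\<B>. chart ` {fst (g B), snd (g B), (fst (g B))\<inverse>, (snd (g B))\<inverse>})"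
  define Q where "Q = {p \<in> root_paths T. dom p \<noteq> UNIV}"
  define C2 where "C2 = {f \<in> path_bijections T. \<exists>p\<in>Q. \<exists>q\<in>Q.
    Map.graph f = {(a, b). \<exists>i. p i = Some a \<and> q i = Some b}}"
  have "countable C1" using \<B>(1) by (auto simp: C1_def)
  moreover have "countable C2"
    unfolding C2_def Q_def by (intro countable_path_bijections countable_finite_root_paths T X)
  ultimately have C: "countable (C1 \<union> C2)" by simp
  have "chart ` {\<alpha>, \<omega>, \<alpha>\<inverse>, \<omega>\<inverse>} \<subseteq> sym_inv_monoid ?X" if "good B \<alpha> \<omega>" for B \<alpha> \<omega>
  proof -
    have "biunique \<alpha>" "biunique \<omega>" "\<alpha> \<subseteq> ?X \<times> ?X" "\<omega> \<subseteq> ?X \<times> ?X"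
      using that by (simp_all add: good_def)
    moreover from this have "\<alpha>\<inverse> \<subseteq> ?X \<times> ?X" "\<omega>\<inverse> \<subseteq> ?X \<times> ?X" by auto
    ultimately show ?thesis
      by (simp add: chart_in_sym_inv_monoid biunique_converse)
  qed
  from UN_least[OF this[OF g]] have "C1 \<subseteq> sym_inv_monoid ?X"
    unfolding C1_def .
  moreover have "C2 \<subseteq> sym_inv_monoid ?X" by (auto simp: C2_def path_bijections_def)
  ultimately have CX: "C1 \<union> C2 \<subseteq> sym_inv_monoid ?X" by simp
  let ?G = "semigroup_gen (PStab ?X \<P> \<union> (C1 \<union> C2))"
  have half: "chart {(l i, q i) | i. True} \<in> ?G \<and> biunique {(l i, q i) | i. True} \<and>
     chart {(q i, l i) | i. True} \<in> ?G \<and> biunique {(q i, l i) | i. True}" if q: "q \<in> rays ?X" for q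
  proof -
    obtain B where B: "B \<in> \<B>" "q \<in> B" using q \<B>(2) by blast
    define \<alpha> \<omega> where "\<alpha> = fst (g B)" and "\<omega> = snd (g B)"
    have good: "good B \<alpha> \<omega>" using g[OF B(1)] by (simp add: \<alpha>_def \<omega>_def)
    then obtain \<sigma> \<tau> where st: "biunique \<sigma>" "biunique \<tau>" "chart \<sigma> \<in> PStab ?X \<P>" "chart \<tau> \<in> PStab ?X \<P>"
      and eq: "{(l i, q i) | i. True} = \<alpha> O \<sigma> O \<omega>\<inverse>" "{(q i, l i) | i. True} = \<omega> O \<tau> O \<alpha>\<inverse>"
      using B(2) q unfolding good_def by blast
    have bi: "biunique \<alpha>" "biunique \<omega>" "biunique (\<alpha>\<inverse>)" "biunique (\<omega>\<inverse>)"
      using good by (auto simp: good_def biunique_converse)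
    have "chart ` {\<alpha>, \<omega>, \<alpha>\<inverse>, \<omega>\<inverse>} \<subseteq> C1" using B(1) unfolding C1_def \<alpha>_def \<omega>_def by blast
    then have gens: "chart \<alpha> \<in> ?G" "chart \<omega> \<in> ?G" "chart (\<alpha>\<inverse>) \<in> ?G" "chart (\<omega>\<inverse>) \<in> ?G"
      "chart \<sigma> \<in> ?G" "chart \<tau> \<in> ?G"
      using st by (auto intro: semigroup_gen.base)
    show ?thesis unfolding eq
      using gens bi st by (intro conjI chart_O_gen biunique_O)
  qed
  have "path_bijections T \<subseteq> ?G"
  proof
    fix f assume f: "f \<in> path_bijections T"
    then obtain p q where pq: "p \<in> root_paths T" "q \<in> root_paths T" "dom p = dom q"
      "Map.graph f = {(a, b). \<exists>i. p i = Some a \<and> q i = Some b}"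
      by (rule path_bijection_chart)
    show "f \<in> ?G"
    proof (cases "dom p = UNIV")
      case False
      then have "p \<in> Q" "q \<in> Q" using pq(1-3) by (simp_all add: Q_def)
      then have "f \<in> C2" using f pq(4) unfolding C2_def by (intro CollectI conjI bexI)
      then show ?thesis by (auto intro: semigroup_gen.base)
    next
      case True
      obtain p' where p': "p' \<in> rays ?X" "p = (\<lambda>n. Some (p' n))"
        using infinite_root_path[OF T pq(1) True] by blast
      obtain q' where q': "q' \<in> rays ?X" "q = (\<lambda>n. Some (q' n))"
        using infinite_root_path[OF T pq(2)] True pq(3) by blast
      \<comment> \<open>The two rays may lie in different bounded sets. Both factorisations pass
        through the same sequence \<open>l\<close>, which makes them composable.\<close>
      have "Map.graph f = {(p' i, l i) | i. True} O {(l i, q' i) | i. True}"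
        unfolding pq(4) p'(2) q'(2) using injD[OF l(1)] by blast
      then have "chart (Map.graph f) \<in> ?G" using half[OF p'(1)] half[OF q'(1)] by (simp add: chart_O_gen)
      then show ?thesis by (simp add: chart_graph)
    qed
  qed
  then show ?thesis using preceq_I_via_countable[OF X C CX] by blast
qed

lemma path_bijections_countable_rays:
  assumes T: "rooted_tree T" and X: "countable (gverts T)" "infinite (gverts T)"
    and rays: "countable (ranked_tree.rays (level T) (ancestor T) (gverts T))"
  shows "countable (root_paths T)" "approx_I (gverts T) (path_bijections T) {}"
proof -
  interpret ranked_tree "gverts T" "level T" "ancestor T" "groot T"
    by (rule ranked_tree_rooted_tree[OF T])
  have "root_paths T \<subseteq> {p \<in> root_paths T. dom p \<noteq> UNIV} \<union> (\<lambda>q n. Some (q n)) ` rays (gverts T)"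
    using infinite_root_path[OF T] by blast
  then show c: "countable (root_paths T)"
    by (rule countable_subset)
      (intro countable_Un countable_image rays countable_finite_root_paths[OF T X(1)])
  have "path_bijections T \<subseteq> {f \<in> path_bijections T. \<exists>p\<in>root_paths T. \<exists>q\<in>root_paths T.
    Map.graph f = {(a, b). \<exists>i. p i = Some a \<and> q i = Some b}}"
  proof
    fix f assume f: "f \<in> path_bijections T"
    then obtain p q where "p \<in> root_paths T" "q \<in> root_paths T"
      "Map.graph f = {(a, b). \<exists>i. p i = Some a \<and> q i = Some b}"
      by (rule path_bijection_chart)
    with f show "f \<in> {f \<in> path_bijections T. \<exists>p\<in>root_paths T. \<exists>q\<in>root_paths T.
      Map.graph f = {(a, b). \<exists>i. p i = Some a \<and> q i = Some b}}"
      by (intro CollectI conjI bexI)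
  qed
  then have "countable (path_bijections T)"
    by (rule countable_subset) (rule countable_path_bijections[OF c])
  then have "preceq_I (gverts T) (path_bijections T) {}"
    by (intro preceq_I_via_countable[OF X, of "path_bijections T"])
      (auto simp: path_bijections_def intro: semigroup_gen.base)
  then show "approx_I (gverts T) (path_bijections T) {}"
    by (simp add: approx_I_def preceq_I_subset)
qed

section \<open>Coding permutations of the parts by rays\<close>

lemma subtree_path_bijections:
  assumes "subtree T' T"
  shows "path_bijections T' \<subseteq> path_bijections T"
proof -
  have "root_paths T' \<subseteq> root_paths T"
    using assms by (auto simp: subtree_def root_paths_def is_path_def)
  then show ?thesis
    using assms unfolding path_bijections_def sym_inv_monoid_def subtree_def by blast
qed

lemma ray_chart_path_bijection:
  assumes T: "rooted_tree T"
    and p: "p \<in> ranked_tree.rays (level T) (ancestor T) (gverts T)"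
    and q: "q \<in> ranked_tree.rays (level T) (ancestor T) (gverts T)"
  shows "biunique {(p i, q i) | i. True}" "chart {(p i, q i) | i. True} \<in> path_bijections T"
proof -
  interpret ranked_tree "gverts T" "level T" "ancestor T" "groot T"
    by (rule ranked_tree_rooted_tree[OF T])
  have pi: "i = j" if "p i = p j" for i j using p that unfolding rays_def by (metis (mono_tags, lifting) mem_Collect_eq)
  have qi: "i = j" if "q i = q j" for i j using q that unfolding rays_def by (metis (mono_tags, lifting) mem_Collect_eq)
  let ?R = "{(p i, q i) | i. True}"
  show bi: "biunique ?R"
    by (rule biuniqueI) (use pi qi in blast)+
  have "?R \<subseteq> gverts T \<times> gverts T" using p q by (auto simp: rays_def)
  from chart_in_sym_inv_monoid[OF bi this] have "chart ?R \<in> sym_inv_monoid (gverts T)" .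
  moreover have "chart ?R (p i) = Some (q i)" for i
    unfolding chart_eq_Some[OF bi] by blast
  then have "chart ?R \<circ>\<^sub>m (\<lambda>n. Some (p n)) = (\<lambda>n. Some (q n))" by (simp add: map_comp_def)
  moreover have "dom (chart ?R) = ran (\<lambda>n. Some (p n))"
    unfolding dom_def ran_def using chart_eq_Some[OF bi]
    by (intro set_eqI) (simp, metis (mono_tags, lifting) Pair_inject mem_Collect_eq option.exhaust option.distinct(1))
  ultimately show "chart ?R \<in> path_bijections T"
    using ray_root_path[OF T p] ray_root_path[OF T q] unfolding path_bijections_def by blast
qed

section \<open>Prolonging vertices to rays, and descendants at a given level\<close>

context ranked_tree
begin

lemma ray_through:
  assumes y: "\<And>k. y k \<in> V" "\<And>k. lev (y k) < lev (y (Suc k))" "\<And>k. anc (y (Suc k)) (lev (y k)) = y k"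
  obtains q where "q \<in> rays V" "\<And>k i. i \<le> lev (y k) \<Longrightarrow> q i = anc (y k) i"
proof -
  have up: "lev (y k) \<le> lev (y m) \<and> anc (y m) (lev (y k)) = y k" if "k \<le> m" for k m
    using that
  proof (induction m)
    case 0
    then show ?case using anc_self y by simp
  next
    case (Suc m)
    show ?case
    proof (cases "k = Suc m")
      case True
      then show ?thesis using anc_self y by simp
    next
      case False
      then have "k \<le> m" using Suc by simp
      then have IH: "lev (y k) \<le> lev (y m)" "anc (y m) (lev (y k)) = y k" using Suc by auto
      have "anc (y (Suc m)) (lev (y k)) = anc (anc (y (Suc m)) (lev (y m))) (lev (y k))"
        using anc_anc[OF y(1)[of "Suc m"] IH(1)] y(2)[of m] by simp
      then show ?thesis using IH y(2,3)[of m] by simp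
    qed
  qed
  have same: "anc (y m) i = anc (y k) i" if "k \<le> m" "i \<le> lev (y k)" for k m i
    using anc_anc[OF y(1)[of m], of i "lev (y k)"] up[OF that(1)] that(2) by simp
  have big: "k \<le> lev (y k)" for k
  proof (induction k)
    case (Suc k)
    then show ?case using y(2)[of k] by simp
  qed simp
  \<comment> \<open>Level \<open>n\<close> is read off \<open>y n\<close>, whose level is at least
    \<open>n\<close>; any later vertex of the chain gives the same value.\<close>
  define q where "q n = anc (y n) n" for n
  have q: "q i = anc (y k) i" if "i \<le> lev (y k)" for i k
    using same[of i k i] same[of k i i] big[of i] that unfolding q_def by (cases "i \<le> k") auto
  have "q \<in> rays V"
    unfolding rays_def
  proof (intro CollectI allI conjI)
    fix n
    show "q n \<in> V" "lev (q n) = n" using anc_in lev_anc y(1) big unfolding q_def by auto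
    have "q (Suc n) = anc (y (Suc n)) (Suc n)" by (simp add: q_def)
    moreover have "q n = anc (y (Suc n)) n" using q big[of "Suc n"] by simp
    ultimately show "anc (q (Suc n)) n = q n"
      using anc_anc[OF y(1)[of "Suc n"], of n "Suc n"] big[of "Suc n"] by simp
  qed
  then show ?thesis using that q by blast
qed

text \<open>Used for \<open>lev y \<le> n\<close> only; for smaller \<open>n\<close> the condition
  would involve a junk value of \<open>anc\<close>.\<close>

definition below :: "'a \<Rightarrow> nat \<Rightarrow> 'a set" where
  "below y n = {z \<in> V. lev z = n \<and> anc z (lev y) = y}"

lemma below_trans:
  assumes "z \<in> below x m" "w \<in> below z n" "lev x \<le> m" "m \<le> n"
  shows "w \<in> below x n"
proof -
  have z: "lev z = m" "anc z (lev x) = x" and w: "w \<in> V" "lev w = n" "anc w m = z"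
    using assms by (auto simp: below_def)
  then have "anc w (lev x) = x" using anc_anc[OF w(1), of "lev x" m] assms(3,4) by simp
  then show ?thesis using w by (simp add: below_def)
qed

lemma anc_below: "z \<in> below x n \<Longrightarrow> lev x \<le> i \<Longrightarrow> i \<le> n \<Longrightarrow> anc z i \<in> below x i"
  by (auto simp: below_def anc_in lev_anc anc_anc)

text \<open>\<open>Q\<close> stands for having two children in the binary case and for having
  infinitely many in the wide case.\<close>

lemma below_unbounded:
  assumes br: "\<And>x. x \<in> V \<Longrightarrow> \<exists>y\<in>V. lev x < lev y \<and> anc y (lev x) = x \<and> Q y" and x: "x \<in> V"
  shows "\<exists>n\<ge>N. \<exists>y\<in>below x n. Q y \<and> lev x < n"
proof (induction N)
  case 0
  then show ?case using br[OF x] by (auto simp: below_def)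
next
  case (Suc N)
  then obtain n y where y: "N \<le> n" "y \<in> below x n" "lev x < n" by blast
  then have yV: "y \<in> V" "lev y = n" by (auto simp: below_def)
  obtain z where z: "z \<in> V" "n < lev z" "anc z n = y" "Q z" using br[OF yV(1)] yV(2) by blast
  have "z \<in> below y (lev z)" using z yV by (simp add: below_def)
  then have "z \<in> below x (lev z)" using below_trans[OF y(2)] y(3) z(2) by simp
  then show ?case using z y by (intro exI[of _ "lev z"]) auto
qed

context
  assumes branching: "\<And>x. x \<in> V \<Longrightarrow> \<exists>y\<in>V. lev x < lev y \<and> anc y (lev x) = x \<and>
    (\<exists>a b. a \<in> kids V y \<and> b \<in> kids V y \<and> a \<noteq> b)"
begin

lemma below_nonempty:
  assumes "x \<in> V" "lev x \<le> n"
  shows "\<exists>z. z \<in> below x n"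
proof -
  obtain m y where "n \<le> m" "y \<in> below x m"
    using below_unbounded[OF branching assms(1), of n] by blast
  then show ?thesis using anc_below assms(2) by blast
qed

text \<open>Induction on \<open>m\<close>: one of the vertices already found is replaced by
  prolongations of two children of a branching vertex under it, and the others are prolonged
  arbitrarily. The old vertices stay apart by their ancestors at level \<open>N\<close>, the two new
  ones by those at level \<open>L\<close>. Obtaining this for all large \<open>n\<close> makes a
  common level for several vertices possible.\<close>

lemma below_many:
  assumes x: "x \<in> V"
  shows "\<exists>N\<ge>lev x. \<forall>n\<ge>N. \<exists>S\<subseteq>below x n. finite S \<and> card S = Suc m"
proof (induction m)
  case 0
  have "\<exists>S\<subseteq>below x n. finite S \<and> card S = Suc 0" if "lev x \<le> n" for n
  proof -
    from below_nonempty[OF x that] obtain z where "z \<in> below x n" ..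
    then show ?thesis by (intro exI[of _ "{z}"]) auto
  qed
  then show ?case by blast
next
  case (Suc m)
  then obtain N S where N: "lev x \<le> N" and S: "S \<subseteq> below x N" "finite S" "card S = Suc m" by blast
  then obtain z where z: "z \<in> S" by fastforce
  then have zb: "z \<in> below x N" "z \<in> V" "lev z = N" using S(1) by (auto simp: below_def)
  obtain w a b where w: "w \<in> V" "N < lev w" "anc w N = z"
    and ab: "a \<in> kids V w" "b \<in> kids V w" "a \<noteq> b"
    using branching[OF zb(2)] zb(3) by blast
  define L where "L = Suc (lev w)"
  have kw: "c \<in> V \<and> lev c = L \<and> anc c N = z" if "c \<in> kids V w" for c
  proof -
    have c: "c \<in> V" "lev c = L" "anc c (lev w) = w" using that by (auto simp: kids_def L_def)
    then have "anc c N = z" using anc_anc[OF c(1), of N "lev w"] w by (simp add: L_def)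
    then show ?thesis using c by simp
  qed
  have "\<exists>S\<subseteq>below x n. finite S \<and> card S = Suc (Suc m)" if n: "L \<le> n" for n
  proof -
    have Nn: "N \<le> n" "N \<le> L" using n w by (auto simp: L_def)
    have "\<forall>s. \<exists>t. s \<in> V \<and> lev s \<le> n \<longrightarrow> t \<in> below s n" using below_nonempty by blast
    from choice[OF this] obtain e where "\<forall>s. s \<in> V \<and> lev s \<le> n \<longrightarrow> e s \<in> below s n" ..
    then have e: "e s \<in> V" "lev (e s) = n" "anc (e s) (lev s) = s" if "s \<in> V" "lev s \<le> n" for s
      using that by (auto simp: below_def)
    have SV: "s \<in> V" "lev s = N" "anc s (lev x) = x" if "s \<in> S" for s
      using that S(1) by (auto simp: below_def)
    have eab: "e c \<in> V \<and> lev (e c) = n \<and> anc (e c) L = c \<and> anc (e c) N = z" if "c \<in> kids V w" for c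
    proof -
      have c: "c \<in> V" "lev c = L" "anc c N = z" using kw[OF that] by auto
      have ec: "e c \<in> V" "lev (e c) = n" "anc (e c) L = c" using e[OF c(1)] c(2) n by auto
      then show ?thesis using anc_anc[OF ec(1) Nn(2)] c(3) n by simp
    qed
    have eS: "e s \<in> V \<and> lev (e s) = n \<and> anc (e s) N = s" if "s \<in> S" for s
      using e[OF SV(1)[OF that]] SV(2)[OF that] Nn by simp
    define S' where "S' = e ` (S - {z}) \<union> {e a, e b}"
    have "inj_on e (S - {z})" by (rule inj_onI) (metis DiffD1 eS)
    then have 1: "card (e ` (S - {z})) = m" using S z by (simp add: card_image)
    have 2: "e a \<noteq> e b" using eab[OF ab(1)] eab[OF ab(2)] ab(3) by metis
    have 3: "e a \<notin> e ` (S - {z})" "e b \<notin> e ` (S - {z})"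
      using eab[OF ab(1)] eab[OF ab(2)] eS by (metis DiffE imageE singletonI)+
    have "card S' = Suc (Suc m)" "finite S'"
      using 1 2 3 S(2) by (auto simp: S'_def)
    moreover have "S' \<subseteq> below x n"
    proof
      fix t assume "t \<in> S'"
      then have t: "t \<in> V \<and> lev t = n \<and> anc t N \<in> S"
        using eS eab[OF ab(1)] eab[OF ab(2)] z unfolding S'_def by auto
      then have "anc t (lev x) = x"
        using anc_anc[of t "lev x" N] SV(3)[of "anc t N"] N Nn by simp
      then show "t \<in> below x n" using t by (simp add: below_def)
    qed
    ultimately show ?thesis by blast
  qed
  moreover have "lev x \<le> L" using N w by (simp add: L_def)
  ultimately show ?case by blast
qed

text \<open>At level \<open>u\<close> each \<open>y\<close> in \<open>W\<close> has enough
  descendants to give every letter one of its own. The vertex for a letter is then prolonged by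
  \<open>g\<close> levels, which leaves room for \<open>g\<close> positions at which the letter is
  already known.\<close>

lemma code_step:
  fixes A :: "'b set"
  assumes W: "finite W" "W \<subseteq> V" "\<And>y. y \<in> W \<Longrightarrow> lev y = b" and A: "finite A"
  shows "\<exists>u h. b \<le> u \<and> (\<forall>y\<in>W. \<forall>a\<in>A. h y a \<in> V \<and> lev (h y a) = u + g \<and> anc (h y a) b = y \<and>
    (\<forall>a'\<in>A. anc (h y a) u = anc (h y a') u \<longrightarrow> a = a'))"
proof -
  have "\<forall>y. \<exists>N. y \<in> V \<longrightarrow> lev y \<le> N \<and> (\<forall>n\<ge>N. \<exists>S\<subseteq>below y n. finite S \<and> card S = Suc (card A))"
    using below_many by blast
  from choice[OF this] obtain N where
    "\<forall>y. y \<in> V \<longrightarrow> lev y \<le> N y \<and> (\<forall>n\<ge>N y. \<exists>S\<subseteq>below y n. finite S \<and> card S = Suc (card A))" ..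
  then have N: "\<exists>S\<subseteq>below y n. finite S \<and> card S = Suc (card A)" if "y \<in> W" "N y \<le> n" for y n
    using that W by blast
  define u where "u = b + sum N W"
  have Nu: "N y \<le> u" if "y \<in> W" for y
    using member_le_sum[of y W N] that W by (simp add: u_def)
  have "\<forall>y. \<exists>\<phi>. y \<in> W \<longrightarrow> inj_on \<phi> A \<and> \<phi> ` A \<subseteq> below y u"
  proof
    fix y
    show "\<exists>\<phi>. y \<in> W \<longrightarrow> inj_on \<phi> A \<and> \<phi> ` A \<subseteq> below y u"
    proof (cases "y \<in> W")
      case True
      obtain S where S: "S \<subseteq> below y u" "finite S" "card S = Suc (card A)" using N[OF True Nu[OF True]] by blast
      then obtain \<phi> where "\<phi> ` A \<subseteq> S" "inj_on \<phi> A" using card_le_inj[OF A S(2)] by auto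
      then show ?thesis using S(1) by blast
    qed auto
  qed
  from choice[OF this] obtain \<phi> where \<phi>': "\<forall>y. y \<in> W \<longrightarrow> inj_on (\<phi> y) A \<and> \<phi> y ` A \<subseteq> below y u" ..
  have \<phi>: "\<phi> y a \<in> V" "lev (\<phi> y a) = u" "anc (\<phi> y a) b = y" if "y \<in> W" "a \<in> A" for y a
    using \<phi>' W(3)[of y] that by (auto simp: below_def)
  have \<phi>inj: "a = a'" if "y \<in> W" "a \<in> A" "a' \<in> A" "\<phi> y a = \<phi> y a'" for y a a'
    using \<phi>' that by (meson inj_onD)
  have "\<forall>s. \<exists>t. s \<in> V \<and> lev s = u \<longrightarrow> t \<in> below s (u + g)"
    using below_nonempty by (metis le_add1)
  from choice[OF this] obtain e where "\<forall>s. s \<in> V \<and> lev s = u \<longrightarrow> e s \<in> below s (u + g)" ..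
  then have e: "e s \<in> V" "lev (e s) = u + g" "anc (e s) u = s" if "s \<in> V" "lev s = u" for s
    using that by (auto simp: below_def)
  have bu: "b \<le> u" by (simp add: u_def)
  show ?thesis
  proof (intro exI[of _ u] exI[of _ "\<lambda>y a. e (\<phi> y a)"] conjI bu ballI impI)
    fix y a assume ya: "y \<in> W" "a \<in> A"
    note p = \<phi>[OF ya]
    note q = e[OF p(1,2)]
    show "e (\<phi> y a) \<in> V" "lev (e (\<phi> y a)) = u + g" using q by auto
    show "anc (e (\<phi> y a)) b = y" using anc_anc[OF q(1) bu] q p by simp
    fix a' assume a': "a' \<in> A" "anc (e (\<phi> y a)) u = anc (e (\<phi> y a')) u"
    then have "\<phi> y a = \<phi> y a'" using q(3) e(3)[OF \<phi>(1,2)[OF ya(1) a'(1)]] by simp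
    then show "a = a'" using \<phi>inj ya a' by blast
  qed
qed

text \<open>Rays coding sequences over finite alphabets: the levels \<open>u k\<close> at which the \<open>k\<close>-th letter has
  been decided are the same for all sequences, and no further letter is decided for \<open>g k\<close> levels.\<close>

lemma ray_coding:
  fixes A :: "nat \<Rightarrow> 'b set" and g :: "nat \<Rightarrow> nat"
  assumes A: "\<And>k. finite (A k)" and g: "\<And>k. 0 < g k"
  shows "\<exists>u b Q. (\<forall>k. b k \<le> u k) \<and> (\<forall>k. b (Suc k) = u k + g k) \<and> (\<forall>\<alpha>\<in>Pi UNIV A. Q \<alpha> \<in> rays V) \<and>
    (\<forall>\<alpha>\<in>Pi UNIV A. \<forall>\<beta>\<in>Pi UNIV A. \<forall>k.
      ((\<forall>i\<le>k. \<alpha> i = \<beta> i) \<longrightarrow> (\<forall>n\<le>b (Suc k). Q \<alpha> n = Q \<beta> n)) \<and>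
      (Q \<alpha> (u k) = Q \<beta> (u k) \<longrightarrow> (\<forall>i\<le>k. \<alpha> i = \<beta> i)))"
proof -
  define ok where "ok k b W u h \<longleftrightarrow> b \<le> u \<and> (\<forall>y\<in>W. \<forall>a\<in>A k. h y a \<in> V \<and> lev (h y a) = u + g k \<and>
    anc (h y a) b = y \<and> (\<forall>a'\<in>A k. anc (h y a) u = anc (h y a') u \<longrightarrow> a = a'))"
    for k b W u and h :: "'a \<Rightarrow> 'b \<Rightarrow> 'a"
  \<comment> \<open>A state holds the current level \<open>b\<close>, the set \<open>W\<close> of
    vertices reached by words of length \<open>k\<close>, the level \<open>u\<close> at which the
    next letter will be decided, and the map \<open>h\<close> that executes a letter. Handling all
    words of length \<open>k\<close> at once is what makes \<open>u\<close> common to them; finite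
    alphabets keep \<open>W\<close> finite.\<close>
  define P where "P k = (\<lambda>(b, W, u, h). (k = 0 \<longrightarrow> W = {rt}) \<and> finite W \<and> W \<subseteq> V \<and> (\<forall>y\<in>W. lev y = b) \<and> ok k b W u h)" for k
  define N where "N k = (\<lambda>(b :: nat, W :: 'a set, u, h :: 'a \<Rightarrow> 'b \<Rightarrow> 'a) (b', W' :: 'a set, u' :: nat, h' :: 'a \<Rightarrow> 'b \<Rightarrow> 'a).
    b' = u + g k \<and> W' = (\<lambda>(y, a). h y a) ` (W \<times> A k))"
    for k :: nat
  have ex: "\<exists>u h. ok k b W u h" if "finite W" "W \<subseteq> V" "\<forall>y\<in>W. lev y = b" for k b W
    unfolding ok_def using code_step[OF that(1,2) _ A] that(3) by blast
  have "\<exists>s. \<forall>k. P k (s k) \<and> N k (s k) (s (Suc k))"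
  proof (rule dependent_nat_choice)
    have "finite {rt}" "{rt} \<subseteq> V" "\<forall>y\<in>{rt}. lev y = 0" using rt_in lev_rt by auto
    from this ex[OF this] show "\<exists>x. P 0 x" unfolding P_def by auto
  next
    fix x k assume x: "P k x"
    obtain b W u h where xe: "x = (b, W, u, h)" by (cases x)
    have W: "finite W" "W \<subseteq> V" "ok k b W u h" using x by (auto simp: P_def xe)
    define W' where "W' = (\<lambda>(y, a). h y a) ` (W \<times> A k)"
    have W': "finite W'" "W' \<subseteq> V" "\<forall>y\<in>W'. lev y = u + g k"
      using W A[of k] by (auto simp: W'_def ok_def)
    obtain u' h' where "ok (Suc k) (u + g k) W' u' h'" using ex[OF W'] by blast
    then have "P (Suc k) (u + g k, W', u', h')" "N k x (u + g k, W', u', h')"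
      using W' by (simp_all add: P_def N_def xe W'_def)
    then show "\<exists>y. P (Suc k) y \<and> N k x y" by blast
  qed
  then obtain s where s: "\<forall>k. P k (s k) \<and> N k (s k) (s (Suc k))" ..
  define b W u h where "b k = fst (s k)" and "W k = fst (snd (s k))"
    and "u k = fst (snd (snd (s k)))" and "h k = snd (snd (snd (s k)))" for k
  have sk: "s k = (b k, W k, u k, h k)" for k by (simp add: b_def W_def u_def h_def)
  have PW: "W k \<subseteq> V" "\<And>y. y \<in> W k \<Longrightarrow> lev y = b k" and okk: "ok k (b k) (W k) (u k) (h k)" for k
    using s[rule_format, of k] by (simp_all add: P_def sk)
  have bS: "b (Suc k) = u k + g k" and WS: "W (Suc k) = (\<lambda>(y, a). h k y a) ` (W k \<times> A k)" for k
    using s[rule_format, of k] by (simp_all add: N_def sk)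
  have bu: "b k \<le> u k" for k using okk[of k] by (simp add: ok_def)
  have W0: "W 0 = {rt}" using s[rule_format, of 0] by (simp add: P_def sk)
  define y where "y \<alpha> = rec_nat rt (\<lambda>k v. h k v (\<alpha> k))" for \<alpha>
  have y_0: "y \<alpha> 0 = rt" and y_Suc: "y \<alpha> (Suc k) = h k (y \<alpha> k) (\<alpha> k)" for \<alpha> k
    by (simp_all add: y_def)
  have yW: "y \<alpha> k \<in> W k" if "\<And>k. \<alpha> k \<in> A k" for \<alpha> k
    by (induction k) (use that in \<open>auto simp: y_0 y_Suc W0 WS\<close>)
  have yV: "y \<alpha> k \<in> V" "lev (y \<alpha> k) = b k" if "\<And>k. \<alpha> k \<in> A k" for \<alpha> k
    using PW yW[of \<alpha> k, OF that] by blast+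
  have y_anc: "anc (y \<alpha> (Suc k)) (b k) = y \<alpha> k" if "\<And>k. \<alpha> k \<in> A k" for \<alpha> k
    using okk[of k] yW[of \<alpha> k, OF that] that[of k] unfolding ok_def y_Suc by simp
  have bless: "b k < b (Suc k)" for k using bu[of k] bS[of k] g[of k] by simp
  have "\<exists>q. q \<in> rays V \<and> (\<forall>k i. i \<le> b k \<longrightarrow> q i = anc (y \<alpha> k) i)" if \<alpha>: "\<And>k. \<alpha> k \<in> A k" for \<alpha>
  proof (rule ray_through[of "y \<alpha>"])
    show "y \<alpha> k \<in> V" "lev (y \<alpha> k) < lev (y \<alpha> (Suc k))"
      "anc (y \<alpha> (Suc k)) (lev (y \<alpha> k)) = y \<alpha> k" for k
      using yV[OF \<alpha>] y_anc[OF \<alpha>] bless by auto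
    fix q assume "q \<in> rays V" "\<And>k i. i \<le> lev (y \<alpha> k) \<Longrightarrow> q i = anc (y \<alpha> k) i"
    then show ?thesis using yV(2)[OF \<alpha>] by auto
  qed
  then have "\<forall>\<alpha>. \<exists>q. (\<forall>k. \<alpha> k \<in> A k) \<longrightarrow> q \<in> rays V \<and> (\<forall>k i. i \<le> b k \<longrightarrow> q i = anc (y \<alpha> k) i)"
    by blast
  from choice[OF this] obtain Q where
    Q': "\<forall>\<alpha>. (\<forall>k. \<alpha> k \<in> A k) \<longrightarrow> Q \<alpha> \<in> rays V \<and> (\<forall>k i. i \<le> b k \<longrightarrow> Q \<alpha> i = anc (y \<alpha> k) i)" ..
  have Q: "Q \<alpha> \<in> rays V" "\<And>k i. i \<le> b k \<Longrightarrow> Q \<alpha> i = anc (y \<alpha> k) i" if "\<And>k. \<alpha> k \<in> A k" for \<alpha>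
    using Q' that by blast+
  have y_cong: "y \<alpha> j = y \<beta> j" if "\<And>i. i < j \<Longrightarrow> \<alpha> i = \<beta> i" for \<alpha> \<beta> j
    using that by (induction j) (simp_all add: y_0 y_Suc)
  \<comment> \<open>Agreement at \<open>u k\<close> passes down to all earlier decision levels, so
    the earlier letters agree and both words have led to the same vertex \<open>v\<close>; from
    there, distinct letters are apart at the next decision level.\<close>
  have sep: "\<forall>i\<le>k. \<alpha> i = \<beta> i" if \<alpha>: "\<And>k. \<alpha> k \<in> A k" and \<beta>: "\<And>k. \<beta> k \<in> A k"
    and eq: "Q \<alpha> (u k) = Q \<beta> (u k)" for \<alpha> \<beta> k
    using eq
  proof (induction k)
    case 0
    have "Q \<alpha> (u 0) = anc (h 0 rt (\<alpha> 0)) (u 0)" "Q \<beta> (u 0) = anc (h 0 rt (\<beta> 0)) (u 0)"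
      using Q(2)[OF \<alpha>, of "u 0" "Suc 0"] Q(2)[OF \<beta>, of "u 0" "Suc 0"] bS[of 0] by (simp_all add: y_Suc y_0)
    then have "\<alpha> 0 = \<beta> 0" using okk[of 0] 0 \<alpha>[of 0] \<beta>[of 0] unfolding ok_def by (simp add: W0)
    then show ?case by simp
  next
    case (Suc k)
    have "u k \<le> u (Suc k)" using bu[of "Suc k"] bS[of k] by simp
    then have "Q \<alpha> (u k) = Q \<beta> (u k)" using ray_prefix[OF Q(1)[OF \<alpha>] Q(1)[OF \<beta>] Suc.prems] by simp
    then have IH: "\<forall>i\<le>k. \<alpha> i = \<beta> i" by (rule Suc.IH)
    define v where "v = y \<alpha> (Suc k)"
    have v: "y \<beta> (Suc k) = v" unfolding v_def using y_cong[of "Suc k" \<alpha> \<beta>] IH by simp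
    have "Q \<alpha> (u (Suc k)) = anc (h (Suc k) v (\<alpha> (Suc k))) (u (Suc k))"
      "Q \<beta> (u (Suc k)) = anc (h (Suc k) v (\<beta> (Suc k))) (u (Suc k))"
      using Q(2)[OF \<alpha>, of "u (Suc k)" "Suc (Suc k)"] Q(2)[OF \<beta>, of "u (Suc k)" "Suc (Suc k)"]
        bS[of "Suc k"] v by (simp_all add: y_Suc[of _ "Suc k"] v_def)
    then have "anc (h (Suc k) v (\<alpha> (Suc k))) (u (Suc k)) = anc (h (Suc k) v (\<beta> (Suc k))) (u (Suc k))"
      using Suc.prems by simp
    moreover have "v \<in> W (Suc k)" unfolding v_def by (rule yW[OF \<alpha>])
    ultimately have "\<alpha> (Suc k) = \<beta> (Suc k)"
      using okk[of "Suc k"] \<alpha>[of "Suc k"] \<beta>[of "Suc k"] unfolding ok_def by blast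
    then show ?case using IH by (auto simp: le_Suc_eq)
  qed
  have cong: "Q \<alpha> n = Q \<beta> n" if \<alpha>: "\<And>k. \<alpha> k \<in> A k" and \<beta>: "\<And>k. \<beta> k \<in> A k"
    and eq: "\<forall>i\<le>k. \<alpha> i = \<beta> i" and n: "n \<le> b (Suc k)" for \<alpha> \<beta> k n
  proof -
    have "y \<alpha> (Suc k) = y \<beta> (Suc k)" by (rule y_cong) (use eq in simp)
    then show ?thesis using Q(2)[OF \<alpha> n] Q(2)[OF \<beta> n] by simp
  qed
  show ?thesis
  proof (intro exI conjI)
    show "\<forall>k. b k \<le> u k" "\<forall>k. b (Suc k) = u k + g k" using bu bS by auto
    show "\<forall>\<alpha>\<in>Pi UNIV A. Q \<alpha> \<in> rays V" using Q(1) by (auto simp: Pi_iff)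
    show "\<forall>\<alpha>\<in>Pi UNIV A. \<forall>\<beta>\<in>Pi UNIV A. \<forall>k.
      ((\<forall>i\<le>k. \<alpha> i = \<beta> i) \<longrightarrow> (\<forall>n\<le>b (Suc k). Q \<alpha> n = Q \<beta> n)) \<and>
      (Q \<alpha> (u k) = Q \<beta> (u k) \<longrightarrow> (\<forall>i\<le>k. \<alpha> i = \<beta> i))"
    proof (intro ballI allI)
      fix \<alpha> \<beta> k assume "\<alpha> \<in> Pi UNIV A" "\<beta> \<in> Pi UNIV A"
      then have ab: "\<alpha> k \<in> A k" "\<beta> k \<in> A k" for k by (simp_all add: Pi_iff)
      show "((\<forall>i\<le>k. \<alpha> i = \<beta> i) \<longrightarrow> (\<forall>n\<le>b (Suc k). Q \<alpha> n = Q \<beta> n)) \<and>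
        (Q \<alpha> (u k) = Q \<beta> (u k) \<longrightarrow> (\<forall>i\<le>k. \<alpha> i = \<beta> i))"
      proof (intro conjI impI)
        assume eq: "\<forall>i\<le>k. \<alpha> i = \<beta> i"
        show "\<forall>n\<le>b (Suc k). Q \<alpha> n = Q \<beta> n"
          by (intro allI impI) (rule cong[OF ab eq])
      next
        assume eq: "Q \<alpha> (u k) = Q \<beta> (u k)"
        show "\<forall>i\<le>k. \<alpha> i = \<beta> i" by (rule sep[OF ab eq])
      qed
    qed
  qed
qed

end

end

text \<open>In the factorisation
  \<open>\<epsilon> O ?in O \<mu> O ?out O \<epsilon>\<inverse>\<close> of \<open>\<sigma>\<close>,
  the chart \<open>\<epsilon>\<close> writes \<open>X\<close> along a reference ray
  \<open>r\<close>, two path-bijections lead from \<open>r\<close> to the ray coding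
  \<open>\<sigma>\<close> and back, and the fixed chart \<open>\<mu>\<close> does the permuting.
  Everything hinges on \<open>\<mu>\<close> being biunique although it is a union over all
  \<open>\<sigma>\<close>.\<close>

lemma PStab_preceq_path_bijections:
  assumes T: "rooted_tree T" and sub: "gverts T \<subseteq> X" and X: "countable X" "infinite X"
    and P: "aleph0_unbounded_partition X \<P>"
    and branching: "\<And>x. x \<in> gverts T \<Longrightarrow> \<exists>y\<in>gverts T. level T x < level T y \<and>
      ancestor T y (level T x) = x \<and> (\<exists>a b. a \<in> ranked_tree.kids (level T) (ancestor T) (gverts T) y \<and>
        b \<in> ranked_tree.kids (level T) (ancestor T) (gverts T) y \<and> a \<noteq> b)"
  shows "preceq_I X (PStab X \<P>) (path_bijections T)"
proof -
  interpret ranked_tree "gverts T" "level T" "ancestor T" "groot T"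
    by (rule ranked_tree_rooted_tree[OF T])
  let ?V = "gverts T"
  have part: "partition_on X \<P>" and finP: "\<And>A. A \<in> \<P> \<Longrightarrow> finite A" and unb: "\<not> (\<exists>n. \<forall>A\<in>\<P>. card A \<le> n)"
    using P by (auto simp: aleph0_unbounded_partition_def)
  have "\<P> \<noteq> {}" using unb by auto
  have "infinite \<P>"
  proof
    assume "finite \<P>"
    then have "\<forall>A\<in>\<P>. card A \<le> sum card \<P>" by (simp add: member_le_sum)
    then show False using unb by blast
  qed
  moreover have "countable \<P>"
  proof (rule countable_image_inj_on[where f = "\<lambda>A. SOME x. x \<in> A"])
    have nonempty: "(SOME x. x \<in> A) \<in> A" if "A \<in> \<P>" for A
      using partition_onD3[OF part] that some_in_eq by blast
    show "inj_on (\<lambda>A. SOME x. x \<in> A) \<P>"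
      using nonempty partition_onD2[OF part] by (intro inj_onI) (metis disjointD disjoint_iff)
    show "countable ((\<lambda>A. SOME x. x \<in> A) ` \<P>)"
      by (rule countable_subset[OF _ X(1)]) (use nonempty partition_onD1[OF part] in blast)
  qed
  ultimately have bij: "bij_betw (from_nat_into \<P>) UNIV \<P>" by (intro bij_betw_from_nat_into)
  define S where "S = from_nat_into \<P>"
  have S: "S k \<in> \<P>" for k using bij by (auto simp: S_def dest: bij_betwE)
  have S_finite: "finite (S k)" for k using finP S by blast
  have S_disj: "j = k" if "x \<in> S j" "x \<in> S k" for j k x
  proof -
    have "S j = S k" using partition_onD2[OF part] S that by (meson disjointD disjoint_iff)
    then show ?thesis using bij_betw_imp_inj_on[OF bij] unfolding S_def by (meson UNIV_I inj_onD)
  qed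
  have S_cover: "\<exists>k. x \<in> S k" if "x \<in> X" for x
  proof -
    obtain A where A: "A \<in> \<P>" "x \<in> A" using partition_onD1[OF part] \<open>x \<in> X\<close> by blast
    then obtain k where "A = S k" using bij_betw_imp_surj_on[OF bij] unfolding S_def by blast
    then show ?thesis using A by blast
  qed
  have SX: "x \<in> X" if "x \<in> S k" for x k using partition_onD1[OF part] S that by blast
  \<comment> \<open>The alphabet consists of all self-maps of the part: it is finite and contains
    every restriction of an element of the stabiliser.\<close>
  define A where "A k = {m :: 'a \<rightharpoonup> 'a. dom m = S k \<and> ran m \<subseteq> S k}" for k
  have A: "finite (A k)" for k
    unfolding A_def by (rule finite_set_of_finite_maps) (rule S_finite)+
  have g: "0 < card (S k)" for k
    using S_finite S partition_onD3[OF part] by (metis card_gt_0_iff)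
  have "\<exists>u b Q. (\<forall>k. b k \<le> u k) \<and> (\<forall>k. b (Suc k) = u k + card (S k)) \<and>
    (\<forall>\<alpha>\<in>Pi UNIV A. Q \<alpha> \<in> rays ?V) \<and> (\<forall>\<alpha>\<in>Pi UNIV A. \<forall>\<beta>\<in>Pi UNIV A. \<forall>k.
      ((\<forall>i\<le>k. \<alpha> i = \<beta> i) \<longrightarrow> (\<forall>n\<le>b (Suc k). Q \<alpha> n = Q \<beta> n)) \<and>
      (Q \<alpha> (u k) = Q \<beta> (u k) \<longrightarrow> (\<forall>i\<le>k. \<alpha> i = \<beta> i)))"
    by (rule ray_coding) (rule branching A g, assumption?)+
  then obtain u b Q where code: "\<forall>k. b k \<le> u k" "\<forall>k. b (Suc k) = u k + card (S k)"
    "\<forall>\<alpha>\<in>Pi UNIV A. Q \<alpha> \<in> rays ?V"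
    "\<forall>\<alpha>\<in>Pi UNIV A. \<forall>\<beta>\<in>Pi UNIV A. \<forall>k.
      ((\<forall>i\<le>k. \<alpha> i = \<beta> i) \<longrightarrow> (\<forall>n\<le>b (Suc k). Q \<alpha> n = Q \<beta> n)) \<and>
      (Q \<alpha> (u k) = Q \<beta> (u k) \<longrightarrow> (\<forall>i\<le>k. \<alpha> i = \<beta> i))"
    by (elim exE conjE)
  have bu: "b k \<le> u k" and bS: "b (Suc k) = u k + card (S k)" for k using code(1,2) by auto
  have Qray: "Q \<alpha> \<in> rays ?V" if "\<And>k. \<alpha> k \<in> A k" for \<alpha> using code(3) that by (simp add: Pi_iff)
  have Qcong: "Q \<alpha> n = Q \<beta> n" if "\<And>k. \<alpha> k \<in> A k" "\<And>k. \<beta> k \<in> A k" "\<And>i. i \<le> k \<Longrightarrow> \<alpha> i = \<beta> i"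
    "n \<le> b (Suc k)" for \<alpha> \<beta> k n
    using code(4)[rule_format, of \<alpha> \<beta> k] that by (simp add: Pi_iff)
  have Qsep: "\<alpha> i = \<beta> i" if "\<And>k. \<alpha> k \<in> A k" "\<And>k. \<beta> k \<in> A k" "Q \<alpha> (u k) = Q \<beta> (u k)" "i \<le> k"
    for \<alpha> \<beta> k i
    using code(4)[rule_format, of \<alpha> \<beta> k] that by (simp add: Pi_iff)
  have bmono: "b j \<le> b k" if "j \<le> k" for j k
    using that by (rule lift_Suc_mono_le[of b, rotated]) (use bu bS in \<open>simp add: le_trans trans_le_add1\<close>)
  have "\<forall>k. \<exists>f. bij_betw f (S k) {0..<card (S k)}"
    using ex_bij_betw_finite_nat[OF S_finite] by blast
  from choice[OF this] obtain idx where idx: "\<forall>k. bij_betw (idx k) (S k) {0..<card (S k)}" ..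
  define pt where "pt x = (SOME k. x \<in> S k)" for x
  have pt: "pt x = k" if "x \<in> S k" for x k
    unfolding pt_def by (rule some_equality) (use that S_disj in blast)+
  \<comment> \<open>The points of \<open>S k\<close> are represented by the levels from
    \<open>u k\<close> up to but excluding \<open>b (Suc k)\<close>: the restriction to
    \<open>S k\<close> has been decided there, and the next one not yet begun.\<close>
  define e where "e x = u (pt x) + idx (pt x) x" for x
  have e_range: "u k \<le> e x \<and> e x < b (Suc k)" if "x \<in> S k" for x k
    using idx that pt[OF that] bij_betwE[of "idx k" "S k"] unfolding e_def bS by fastforce
  have e_inj: "x = y" if "x \<in> X" "y \<in> X" "e x = e y" for x y
  proof -
    obtain j k where jk: "x \<in> S j" "y \<in> S k"
      using S_cover[OF \<open>x \<in> X\<close>] S_cover[OF \<open>y \<in> X\<close>] by blast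
    have "j = k"
    proof (rule ccontr)
      assume "j \<noteq> k"
      then consider "Suc j \<le> k" | "Suc k \<le> j" by linarith
      then show False
        using bmono[of "Suc j" k] bmono[of "Suc k" j] e_range[OF jk(1)] e_range[OF jk(2)] bu[of j] bu[of k] that(3)
        by cases linarith+
    qed
    then have "idx k x = idx k y" using that(3) pt[OF jk(1)] pt[OF jk(2)] by (simp add: e_def)
    then show ?thesis
      using idx jk \<open>j = k\<close> by (meson bij_betw_imp_inj_on inj_onD)
  qed
  define \<kappa> where "\<kappa> \<sigma> k = \<sigma> |` S k" for \<sigma> :: "'a \<rightharpoonup> 'a" and k
  define q where "q \<sigma> = Q (\<kappa> \<sigma>)" for \<sigma>
  have PS: "\<sigma> x = Some y \<Longrightarrow> x \<in> S k \<or> y \<in> S k \<Longrightarrow> x \<in> S k \<and> y \<in> S k"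
    "x \<in> S k \<Longrightarrow> \<exists>y. \<sigma> x = Some y" "\<sigma> x = Some y \<Longrightarrow> x \<in> X \<and> y \<in> X"
    "\<sigma> x = Some z \<Longrightarrow> \<sigma> y = Some z \<Longrightarrow> x = y"
    if "\<sigma> \<in> PStab X \<P>" for \<sigma> x y z k
  proof -
    have \<sigma>: "dom \<sigma> = X" "ran \<sigma> = X" "inj_on \<sigma> (dom \<sigma>)" "\<And>k. pimage \<sigma> (S k) = S k"
      using that S by (auto simp: PStab_def sym_group_def sym_inv_monoid_def)
    show inX: "\<sigma> x = Some y \<Longrightarrow> x \<in> X \<and> y \<in> X" for x y using \<sigma>(1,2) by (auto simp: ran_def)
    show "\<sigma> x = Some z \<Longrightarrow> \<sigma> y = Some z \<Longrightarrow> x = y"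
      using \<sigma>(3) by (metis domI inj_onD)
    show "x \<in> S k \<Longrightarrow> \<exists>y. \<sigma> x = Some y" using SX[of x k] \<sigma>(1) by auto
    have fwd: "y \<in> S k" if "\<sigma> x = Some y" "x \<in> S k" for x y k
      using \<sigma>(4)[of k] that unfolding pimage_def by blast
    show "\<sigma> x = Some y \<Longrightarrow> x \<in> S k \<or> y \<in> S k \<Longrightarrow> x \<in> S k \<and> y \<in> S k"
      using fwd S_disj S_cover inX by metis
  qed
  have \<kappa>A: "\<kappa> \<sigma> k \<in> A k" if "\<sigma> \<in> PStab X \<P>" for \<sigma> k
    using PS(1,2)[OF that] unfolding A_def \<kappa>_def
    by (auto simp: ran_def restrict_map_def dom_def split: if_splits)
  have qray: "q \<sigma> \<in> rays ?V" if "\<sigma> \<in> PStab X \<P>" for \<sigma>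
    unfolding q_def by (rule Qray[OF \<kappa>A[OF that]])
  have qlev: "level T (q \<sigma> n) = n" "q \<sigma> n \<in> ?V" if "\<sigma> \<in> PStab X \<P>" for \<sigma> n
    using qray[OF that] by (auto simp: rays_def)
  \<comment> \<open>This makes \<open>\<mu>\<close> biunique: a common vertex of two coding rays at
    a level representing a point of \<open>S k\<close> forces the same action on \<open>S k\<close>
    and the same vertices at all levels representing this part.\<close>
  have agree: "(\<forall>z\<in>S k. \<sigma> z = \<tau> z) \<and> (\<forall>z\<in>S k. q \<sigma> (e z) = q \<tau> (e z))"
    if "\<sigma> \<in> PStab X \<P>" "\<tau> \<in> PStab X \<P>" "x \<in> S k" "q \<sigma> (e x) = q \<tau> (e x)" for \<sigma> \<tau> x k
  proof -
    have "q \<sigma> (u k) = q \<tau> (u k)"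
      using ray_prefix[OF qray qray that(4)] that(1,2) e_range[OF that(3)] by blast
    then have eq: "\<kappa> \<sigma> i = \<kappa> \<tau> i" if "i \<le> k" for i
      using Qsep[OF \<kappa>A[OF \<open>\<sigma> \<in> PStab X \<P>\<close>] \<kappa>A[OF \<open>\<tau> \<in> PStab X \<P>\<close>] _ that] unfolding q_def by blast
    have "\<sigma> z = \<tau> z" if "z \<in> S k" for z
      using fun_cong[OF eq[OF order_refl], of z] that by (simp add: \<kappa>_def)
    moreover have "q \<sigma> (e z) = q \<tau> (e z)" if "z \<in> S k" for z
      using Qcong[OF \<kappa>A \<kappa>A eq, OF \<open>\<sigma> \<in> PStab X \<P>\<close> \<open>\<tau> \<in> PStab X \<P>\<close>] e_range[OF that]
      unfolding q_def by simp
    ultimately show ?thesis by blast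
  qed
  have idA: "(\<lambda>x. Some x) |` S k \<in> A k" for k
    by (auto simp: A_def ran_def restrict_map_def dom_def split: if_splits)
  define r where "r = Q (\<lambda>k. (\<lambda>x. Some x) |` S k)"
  have r: "r \<in> rays ?V" unfolding r_def by (rule Qray[OF idA])
  then have rlev: "level T (r n) = n" "r n \<in> ?V" for n by (auto simp: rays_def)
  define \<epsilon> where "\<epsilon> = {(x, r (e x)) | x. x \<in> X}"
  define \<mu> where "\<mu> = {(q \<sigma> (e x), q \<sigma> (e y)) | \<sigma> x y. \<sigma> \<in> PStab X \<P> \<and> \<sigma> x = Some y}"
  have bi\<epsilon>: "biunique \<epsilon>"
  proof (rule biuniqueI)
    fix x y z assume "(x, y) \<in> \<epsilon>" "(x, z) \<in> \<epsilon>"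
    then show "y = z" unfolding \<epsilon>_def by blast
  next
    fix x y z assume "(x, z) \<in> \<epsilon>" "(y, z) \<in> \<epsilon>"
    then have xy: "x \<in> X" "y \<in> X" "z = r (e x)" "z = r (e y)" unfolding \<epsilon>_def by blast+
    then have "e x = e y" using rlev(1) by metis
    then show "x = y" using e_inj xy by blast
  qed
  have bi\<mu>: "biunique \<mu>"
  proof (rule biuniqueI)
    fix x y z assume "(x, y) \<in> \<mu>" "(x, z) \<in> \<mu>"
    then obtain \<sigma> \<tau> a b c d where st: "\<sigma> \<in> PStab X \<P>" "\<tau> \<in> PStab X \<P>" "\<sigma> a = Some b" "\<tau> c = Some d"
      and eqs: "x = q \<sigma> (e a)" "y = q \<sigma> (e b)" "x = q \<tau> (e c)" "z = q \<tau> (e d)"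
      unfolding \<mu>_def by blast
    have "e a = e c" using eqs(1,3) qlev(1) st(1,2) by metis
    then have ac: "c = a" using e_inj PS(3) st by metis
    obtain k where k: "a \<in> S k" using S_cover PS(3)[OF st(1,3)] by blast
    have ag: "(\<forall>z\<in>S k. \<sigma> z = \<tau> z) \<and> (\<forall>z\<in>S k. q \<sigma> (e z) = q \<tau> (e z))"
      by (rule agree[OF st(1,2) k]) (use eqs ac in metis)
    then have "d = b" using st(3,4) ac k by auto
    moreover have "b \<in> S k" using PS(1)[OF st(1,3)] k by blast
    ultimately show "y = z" using ag eqs(2,4) by metis
  next
    fix x y z assume "(x, z) \<in> \<mu>" "(y, z) \<in> \<mu>"
    then obtain \<sigma> \<tau> a b c d where st: "\<sigma> \<in> PStab X \<P>" "\<tau> \<in> PStab X \<P>" "\<sigma> a = Some b" "\<tau> c = Some d"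
      and eqs: "x = q \<sigma> (e a)" "z = q \<sigma> (e b)" "y = q \<tau> (e c)" "z = q \<tau> (e d)"
      unfolding \<mu>_def by blast
    have "e b = e d" using eqs(2,4) qlev(1) st(1,2) by metis
    then have bd: "d = b" using e_inj PS(3) st by metis
    obtain k where k: "b \<in> S k" using S_cover PS(3)[OF st(1,3)] by blast
    have ag: "(\<forall>z\<in>S k. \<sigma> z = \<tau> z) \<and> (\<forall>z\<in>S k. q \<sigma> (e z) = q \<tau> (e z))"
      by (rule agree[OF st(1,2) k]) (use eqs bd in metis)
    have acS: "a \<in> S k" "c \<in> S k" using PS(1)[OF st(1,3)] PS(1)[OF st(2,4)] k bd by blast+
    then have "\<sigma> c = Some b" using ag st(4) bd by auto
    then have "c = a" using PS(4)[OF st(1)] st(3) by blast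
    then show "x = y" using ag eqs(1,3) acS by metis
  qed
  have sub\<epsilon>\<mu>: "\<epsilon> \<subseteq> X \<times> X" "\<mu> \<subseteq> X \<times> X"
    using sub rlev(2) qlev(2) unfolding \<epsilon>_def \<mu>_def by blast+
  define C where "C = chart ` {\<epsilon>, \<mu>, \<epsilon>\<inverse>}"
  have "\<epsilon>\<inverse> \<subseteq> X \<times> X" using sub\<epsilon>\<mu>(1) by blast
  then have CX: "C \<subseteq> sym_inv_monoid X"
    using bi\<epsilon> bi\<mu> sub\<epsilon>\<mu> by (simp add: C_def chart_in_sym_inv_monoid biunique_converse)
  have Cc: "countable C" by (simp add: C_def)
  let ?G = "semigroup_gen (path_bijections T \<union> C)"
  have gens: "chart \<epsilon> \<in> ?G" "chart \<mu> \<in> ?G" "chart (\<epsilon>\<inverse>) \<in> ?G"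
    by (auto simp: C_def intro: semigroup_gen.base)
  have "PStab X \<P> \<subseteq> ?G"
  proof
    fix \<sigma> assume \<sigma>: "\<sigma> \<in> PStab X \<P>"
    let ?in = "{(r i, q \<sigma> i) | i. True}" and ?out = "{(q \<sigma> i, r i) | i. True}"
    note pin = ray_chart_path_bijection[OF T r qray[OF \<sigma>]]
    note pout = ray_chart_path_bijection[OF T qray[OF \<sigma>] r]
    have io: "chart ?in \<in> ?G" "chart ?out \<in> ?G"
      using pin(2) pout(2) by (auto intro: semigroup_gen.base)
    have eq: "Map.graph \<sigma> = \<epsilon> O ?in O \<mu> O ?out O \<epsilon>\<inverse>"
    proof (intro set_eqI iffI)
      fix p assume "p \<in> Map.graph \<sigma>"
      then obtain x y where xy: "p = (x, y)" "\<sigma> x = Some y" by (auto simp: Map.graph_def)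
      have "(x, r (e x)) \<in> \<epsilon>" "(y, r (e y)) \<in> \<epsilon>" using PS(3)[OF \<sigma> xy(2)] unfolding \<epsilon>_def by blast+
      moreover have "(q \<sigma> (e x), q \<sigma> (e y)) \<in> \<mu>" using xy \<sigma> unfolding \<mu>_def by blast
      moreover have "(r (e x), q \<sigma> (e x)) \<in> ?in" "(q \<sigma> (e y), r (e y)) \<in> ?out" by blast+
      ultimately show "p \<in> \<epsilon> O ?in O \<mu> O ?out O \<epsilon>\<inverse>" unfolding xy(1) by (meson converseI relcompI)
    next
      fix p assume "p \<in> \<epsilon> O ?in O \<mu> O ?out O \<epsilon>\<inverse>"
      then obtain x z i j w where p: "p = (x, z)" "x \<in> X" "r (e x) = r i" "(q \<sigma> i, w) \<in> \<mu>"
        "w = q \<sigma> j" "r j = r (e z)" "z \<in> X"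
        unfolding \<epsilon>_def by blast
      have ij: "i = e x" "j = e z" using p(3,6) rlev(1) by metis+
      obtain k where k: "x \<in> S k" using S_cover p(2) by blast
      obtain y where y: "\<sigma> x = Some y" using PS(2)[OF \<sigma> k] by blast
      have "(q \<sigma> (e x), q \<sigma> (e y)) \<in> \<mu>" using y \<sigma> unfolding \<mu>_def by blast
      then have "w = q \<sigma> (e y)" using biunique_right[OF bi\<mu>] p(4) ij(1) by blast
      then have "e y = e z" using p(5) ij(2) qlev(1)[OF \<sigma>] by metis
      then have "y = z" using e_inj PS(3)[OF \<sigma> y] p(7) by blast
      then show "p \<in> Map.graph \<sigma>" using y p(1) by (simp add: Map.graph_def)
    qed
    have "chart (Map.graph \<sigma>) \<in> ?G"
      unfolding eq using gens io bi\<epsilon> bi\<mu> pin(1) pout(1) biunique_converse[OF bi\<epsilon>]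
      by (intro chart_O_gen biunique_O)
    then show "\<sigma> \<in> ?G" by (simp add: chart_graph)
  qed
  then show ?thesis by (rule preceq_I_via_countable[OF X Cc CX])
qed

section \<open>Trees with vertices of infinite degree\<close>

text \<open>In the application \<open>I\<close> is the set of vertices with infinitely many children and \<open>ch y\<close>
  enumerates children of \<open>y\<close>; the choice of \<open>K\<close> makes the next block of levels as long as desired.\<close>

locale wide_tree = ranked_tree +
  fixes I :: "'a set" and ch nx :: "'a \<Rightarrow> nat \<Rightarrow> 'a" and y0 :: 'a
  assumes y0: "y0 \<in> I" and I_V: "I \<subseteq> V"
    and ch_inj: "y \<in> I \<Longrightarrow> ch y K = ch y K' \<Longrightarrow> K = K'"
    and nx_I: "y \<in> I \<Longrightarrow> nx y K \<in> I"
    and nx_ge: "y \<in> I \<Longrightarrow> K \<le> lev (nx y K)"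
    and nx_lev: "y \<in> I \<Longrightarrow> lev y < lev (nx y K)"
    and nx_anc: "y \<in> I \<Longrightarrow> anc (nx y K) (lev y) = y"
    and nx_ch: "y \<in> I \<Longrightarrow> anc (nx y K) (Suc (lev y)) = ch y K"
begin

definition stage :: "(nat \<Rightarrow> nat) \<Rightarrow> nat \<Rightarrow> 'a" where
  "stage \<kappa> = rec_nat y0 (\<lambda>j y. nx y (\<kappa> j))"

text \<open>The \<open>Suc\<close> places the start of block \<open>j\<close> at the child of
  \<open>stage \<kappa> j\<close> through which the ray announces \<open>\<kappa> j\<close>. Thus
  the end of the block can be read off each of its vertices.\<close>

definition bound :: "(nat \<Rightarrow> nat) \<Rightarrow> nat \<Rightarrow> nat" where
  "bound \<kappa> j = Suc (lev (stage \<kappa> j))"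

definition stage_ray :: "(nat \<Rightarrow> nat) \<Rightarrow> nat \<Rightarrow> 'a" where
  "stage_ray \<kappa> = (SOME q. q \<in> rays V \<and> (\<forall>j i. i \<le> lev (stage \<kappa> j) \<longrightarrow> q i = anc (stage \<kappa> j) i))"

lemma stage_0: "stage \<kappa> 0 = y0" and stage_Suc: "stage \<kappa> (Suc j) = nx (stage \<kappa> j) (\<kappa> j)"
  by (simp_all add: stage_def)

lemma stage_I: "stage \<kappa> j \<in> I"
  by (induction j) (simp_all add: stage_0 stage_Suc y0 nx_I)

lemma stage_V: "stage \<kappa> j \<in> V"
  using stage_I I_V by blast

lemma stage_ray: "stage_ray \<kappa> \<in> rays V"
  and stage_ray_anc: "i \<le> lev (stage \<kappa> j) \<Longrightarrow> stage_ray \<kappa> i = anc (stage \<kappa> j) i"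
proof -
  have "\<exists>q. q \<in> rays V \<and> (\<forall>j i. i \<le> lev (stage \<kappa> j) \<longrightarrow> q i = anc (stage \<kappa> j) i)"
  proof (rule ray_through[of "stage \<kappa>"])
    show "stage \<kappa> j \<in> V" "lev (stage \<kappa> j) < lev (stage \<kappa> (Suc j))"
      "anc (stage \<kappa> (Suc j)) (lev (stage \<kappa> j)) = stage \<kappa> j" for j
      using stage_V stage_I[of \<kappa> j] nx_lev nx_anc by (simp_all add: stage_Suc)
  qed blast
  from someI_ex[OF this] show "stage_ray \<kappa> \<in> rays V"
    "i \<le> lev (stage \<kappa> j) \<Longrightarrow> stage_ray \<kappa> i = anc (stage \<kappa> j) i"
    unfolding stage_ray_def by blast+
qed

lemma stage_ray_lev: "lev (stage_ray \<kappa> n) = n" "stage_ray \<kappa> n \<in> V"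
  using stage_ray by (auto simp: rays_def)

lemma bound_0: "bound \<kappa> 0 = Suc (lev y0)"
  by (simp add: bound_def stage_0)

lemma bound_less: "bound \<kappa> j < bound \<kappa> (Suc j)"
  using nx_lev[OF stage_I] by (simp add: bound_def stage_Suc)

lemma bound_gt: "\<kappa> j < bound \<kappa> (Suc j)"
  using nx_ge[OF stage_I, of "\<kappa> j"] by (simp add: bound_def stage_Suc le_imp_less_Suc)

lemma bound_mono: "j \<le> k \<Longrightarrow> bound \<kappa> j \<le> bound \<kappa> k"
  by (rule lift_Suc_mono_le[of "bound \<kappa>"]) (auto intro: bound_less less_imp_le)

lemma block_exists:
  assumes "Suc (lev y0) \<le> l"
  shows "\<exists>j. bound \<kappa> j \<le> l \<and> l < bound \<kappa> (Suc j)"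
proof -
  have "j \<le> bound \<kappa> j" for j
    by (induction j) (use bound_less in \<open>auto simp: Suc_le_eq intro: le_less_trans\<close>)
  then have ex: "\<exists>j. l < bound \<kappa> j" using less_le_trans[OF lessI] by blast
  define j where "j = (LEAST j. l < bound \<kappa> j)"
  have j: "l < bound \<kappa> j" unfolding j_def by (rule LeastI_ex[OF ex])
  then obtain k where k: "j = Suc k" using assms bound_0 by (cases j) auto
  have "\<not> l < bound \<kappa> k" using not_less_Least[of k "\<lambda>j. l < bound \<kappa> j"] k by (simp add: j_def)
  then show ?thesis using j k by (intro exI[of _ k]) auto
qed

lemma block_unique:
  assumes "bound \<kappa> j \<le> l" "l < bound \<kappa> (Suc j)" "bound \<kappa> k \<le> l" "l < bound \<kappa> (Suc k)"
  shows "j = k"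
proof (rule ccontr)
  assume "j \<noteq> k"
  then consider "Suc j \<le> k" | "Suc k \<le> j" by linarith
  then show False using assms bound_mono[of "Suc j" k \<kappa>] bound_mono[of "Suc k" j \<kappa>] by cases auto
qed

lemma stage_ray_ch: "stage_ray \<kappa> (bound \<kappa> j) = ch (stage \<kappa> j) (\<kappa> j)"
  using stage_ray_anc[of "bound \<kappa> j" \<kappa> "Suc j"] nx_ch[OF stage_I] nx_lev[OF stage_I]
  by (simp add: bound_def stage_Suc Suc_le_eq)

text \<open>The numbers are read off from the root upwards: at level \<open>bound \<kappa> j\<close>
  the ray passes through child number \<open>\<kappa> j\<close> of stage \<open>j\<close>, and
  \<open>ch\<close> is injective in the number.\<close>

lemma stages_agree:
  assumes eq: "stage_ray \<kappa> l = stage_ray \<kappa>' l" and "bound \<kappa> j \<le> l" "bound \<kappa>' j \<le> l"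
  shows "stage \<kappa> j = stage \<kappa>' j \<and> \<kappa> j = \<kappa>' j"
  using assms(2,3)
proof (induction j)
  case 0
  have "stage_ray \<kappa> (bound \<kappa> 0) = stage_ray \<kappa>' (bound \<kappa> 0)"
    using ray_prefix[OF stage_ray stage_ray eq 0(1)] .
  then have "ch y0 (\<kappa> 0) = ch y0 (\<kappa>' 0)"
    using stage_ray_ch[of \<kappa> 0] stage_ray_ch[of \<kappa>' 0] by (simp add: bound_0 stage_0)
  then show ?case using ch_inj[OF y0] by (simp add: stage_0)
next
  case (Suc j)
  then have IH: "stage \<kappa> j = stage \<kappa>' j" "\<kappa> j = \<kappa>' j"
    using bound_less[of \<kappa> j] bound_less[of \<kappa>' j] by auto
  then have st: "stage \<kappa> (Suc j) = stage \<kappa>' (Suc j)" by (simp add: stage_Suc)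
  then have b: "bound \<kappa> (Suc j) = bound \<kappa>' (Suc j)" by (simp add: bound_def)
  have "stage_ray \<kappa> (bound \<kappa> (Suc j)) = stage_ray \<kappa>' (bound \<kappa> (Suc j))"
    using ray_prefix[OF stage_ray stage_ray eq Suc.prems(1)] .
  then have "ch (stage \<kappa> (Suc j)) (\<kappa> (Suc j)) = ch (stage \<kappa> (Suc j)) (\<kappa>' (Suc j))"
    using stage_ray_ch[of \<kappa> "Suc j"] stage_ray_ch[of \<kappa>' "Suc j"] st b by simp
  then show ?case using ch_inj[OF stage_I] st by blast
qed

text \<open>A vertex of a coded ray determines the block it lies in. For \<open>m = min j k\<close>
  both rays have started block \<open>m\<close> and agree on its stage and number, so the block ends
  at the same level for both and contains \<open>l\<close>.\<close>

lemma block_agree: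
  assumes eq: "stage_ray \<kappa> l = stage_ray \<kappa>' l" and l: "bound \<kappa> j \<le> l" "l < bound \<kappa> (Suc j)"
    and l': "bound \<kappa>' k \<le> l" "l < bound \<kappa>' (Suc k)"
  shows "j = k \<and> stage \<kappa> j = stage \<kappa>' k \<and> \<kappa> j = \<kappa>' k"
proof -
  define m where "m = min j k"
  have "bound \<kappa> m \<le> l" "bound \<kappa>' m \<le> l"
    using bound_mono[of m j \<kappa>] bound_mono[of m k \<kappa>'] l l' by (auto simp: m_def)
  then have ag: "stage \<kappa> m = stage \<kappa>' m" "\<kappa> m = \<kappa>' m" using stages_agree[OF eq] by blast+
  then have "bound \<kappa> (Suc m) = bound \<kappa>' (Suc m)" by (simp add: bound_def stage_Suc)
  then have "j = m" "k = m"
    using block_unique[of \<kappa> j l m] block_unique[of \<kappa>' k l m] \<open>bound \<kappa> m \<le> l\<close> \<open>bound \<kappa>' m \<le> l\<close> l l'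
    unfolding m_def by (cases "j \<le> k"; simp add: min_def)+
  then show ?thesis using ag by simp
qed

lemma stage_ray_block:
  assumes "stage \<kappa> j = stage \<kappa>' k" "\<kappa> j = \<kappa>' k" "l < bound \<kappa> (Suc j)"
  shows "stage_ray \<kappa> l = stage_ray \<kappa>' l"
proof -
  have "stage \<kappa> (Suc j) = stage \<kappa>' (Suc k)" using assms(1,2) by (simp add: stage_Suc)
  then show ?thesis
    using stage_ray_anc[of l \<kappa> "Suc j"] stage_ray_anc[of l \<kappa>' "Suc k"] assms(3) by (simp add: bound_def)
qed

text \<open>Both sequences are built in a joint recursion: each new number is \<open>F\<close> of
  the latest bound of the other system, and the next bound exceeds the announced number. The second
  system already uses the new bound of the first.\<close>

lemma interleaved_bounds:
  fixes F :: "nat \<Rightarrow> nat"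
  obtains \<kappa> \<kappa>' where "\<forall>j. F (bound \<kappa>' j) < bound \<kappa> (Suc j)" "\<forall>j. F (bound \<kappa> (Suc j)) < bound \<kappa>' (Suc j)"
proof -
  define n where "n y y' = nx y (F (Suc (lev y')))" for y y'
  define s where "s = rec_nat (y0, y0) (\<lambda>j (y, y'). (n y y', n y' (n y y')))"
  define \<kappa> where "\<kappa> j = F (Suc (lev (snd (s j))))" for j
  define \<kappa>' where "\<kappa>' j = F (Suc (lev (fst (s (Suc j)))))" for j
  have s_Suc: "fst (s (Suc j)) = nx (fst (s j)) (\<kappa> j)" "snd (s (Suc j)) = nx (snd (s j)) (\<kappa>' j)" for j
    by (simp_all add: s_def \<kappa>_def \<kappa>'_def n_def split: prod.split)
  have st: "stage \<kappa> j = fst (s j) \<and> stage \<kappa>' j = snd (s j)" for j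
  proof (induction j)
    case 0
    show ?case by (simp add: stage_0 s_def)
  next
    case (Suc j)
    then show ?case unfolding stage_Suc s_Suc by simp
  qed
  have "F (bound \<kappa>' j) < bound \<kappa> (Suc j)" "F (bound \<kappa> (Suc j)) < bound \<kappa>' (Suc j)" for j
    using bound_gt[of \<kappa> j] bound_gt[of \<kappa>' j] st[of j] st[of "Suc j"]
    by (simp_all add: bound_def \<kappa>_def \<kappa>'_def)
  then show ?thesis using that by blast
qed

text \<open>All entries are thereby forced to be at least \<open>Suc (lev y0)\<close>, where the
  first block starts.\<close>

definition block_preserving :: "(nat \<Rightarrow> nat) \<Rightarrow> (nat \<times> nat) set \<Rightarrow> bool" where
  "block_preserving \<kappa> g \<longleftrightarrow>
    (\<forall>(l, m)\<in>g. \<exists>j. bound \<kappa> j \<le> l \<and> l < bound \<kappa> (Suc j) \<and> bound \<kappa> j \<le> m \<and> m < bound \<kappa> (Suc j))"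

text \<open>One fixed chart \<open>v\<close> moves, for every \<open>\<kappa>\<close>, each block of the ray of \<open>\<kappa>\<close> into a part of the
  partition that is twice as large. The spare half of the part receives the points at which a given
  partial map is undefined.\<close>

lemma block_maps_via_PStab:
  assumes VX: "V \<subseteq> X" and X: "countable X" "infinite X" and P: "aleph0_unbounded_partition X \<P>"
  shows "\<exists>v. biunique v \<and> v \<subseteq> V \<times> X \<and> (\<forall>\<kappa> g. biunique g \<longrightarrow> block_preserving \<kappa> g \<longrightarrow>
    (\<exists>\<sigma>. biunique \<sigma> \<and> chart \<sigma> \<in> PStab X \<P> \<and>
      (\<forall>l m. (\<exists>a b. (stage_ray \<kappa> l, a) \<in> v \<and> (a, b) \<in> \<sigma> \<and> (stage_ray \<kappa> m, b) \<in> v) \<longleftrightarrow> (l, m) \<in> g)))"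
proof -
  have part: "partition_on X \<P>" and finP: "\<And>A. A \<in> \<P> \<Longrightarrow> finite A"
    using P by (auto simp: aleph0_unbounded_partition_def)
  have disj: "A = A'" if "A \<in> \<P>" "A' \<in> \<P>" "x \<in> A" "x \<in> A'" for A A' x
    using partition_onD2[OF part] that by (meson disjointD disjoint_iff)
  have PX: "x \<in> X" if "A \<in> \<P>" "x \<in> A" for A x
    using partition_onD1[OF part] that by blast
  \<comment> \<open>There are uncountably many \<open>\<kappa>\<close> but only countably many pairs
    of a stage and its number, and such a pair identifies the block; hence parts can be assigned to
    blocks for all \<open>\<kappa>\<close> at once.\<close>
  define J where "J = V \<times> (UNIV :: nat set)"
  have J: "countable J" using VX X(1) by (auto simp: J_def intro: countable_subset)
  \<comment> \<open>This is the upper end of the block and not its length, so that levels serve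
    directly as indices into the part. Doubling it leaves the indices from \<open>len\<close> on as
    the spare half.\<close>
  define len where "len yK = Suc (lev (nx (fst yK) (snd yK)))" for yK
  obtain \<Phi> where \<Phi>: "inj_on \<Phi> J" "\<And>i. i \<in> J \<Longrightarrow> \<Phi> i \<in> \<P>" "\<And>i. i \<in> J \<Longrightarrow> 2 * len i \<le> card (\<Phi> i)"
    using distinct_large_parts[OF X P J, of "\<lambda>i. 2 * len i"] by blast
  have "\<forall>i. \<exists>f. i \<in> J \<longrightarrow> f ` {..<2 * len i} \<subseteq> \<Phi> i \<and> inj_on f {..<2 * len i}"
  proof
    fix i
    show "\<exists>f. i \<in> J \<longrightarrow> f ` {..<2 * len i} \<subseteq> \<Phi> i \<and> inj_on f {..<2 * len i}"
    proof (cases "i \<in> J")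
      case True
      then show ?thesis using card_le_inj[of "{..<2 * len i}" "\<Phi> i"] finP \<Phi>(2,3) by auto
    qed simp
  qed
  from choice[OF this] obtain \<iota> where
    \<iota>': "\<forall>i. i \<in> J \<longrightarrow> \<iota> i ` {..<2 * len i} \<subseteq> \<Phi> i \<and> inj_on (\<iota> i) {..<2 * len i}" ..
  have \<iota>: "\<iota> i l \<in> \<Phi> i" if "i \<in> J" "l < 2 * len i" for i l using \<iota>' that by blast
  have \<iota>_inj: "i = i' \<and> l = l'"
    if "i \<in> J" "i' \<in> J" "l < 2 * len i" "l' < 2 * len i'" "\<iota> i l = \<iota> i' l'" for i i' l l'
  proof -
    have "\<Phi> i = \<Phi> i'" using disj[OF \<Phi>(2) \<Phi>(2), OF that(1,2) \<iota>[OF that(1,3)]] \<iota>[OF that(2,4)] that(5) by simp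
    then have i: "i = i'" using \<Phi>(1) that(1,2) by (meson inj_onD)
    moreover have "inj_on (\<iota> i) {..<2 * len i}" using \<iota>' that(1) by blast
    ultimately have "l = l'" using that by (intro inj_onD[of "\<iota> i" "{..<2 * len i}"]) simp_all
    with i show ?thesis by simp
  qed
  define s where "s \<kappa> j = (stage \<kappa> j, \<kappa> j)" for \<kappa> j
  have sJ: "s \<kappa> j \<in> J" for \<kappa> j using stage_V by (simp add: s_def J_def)
  have slen: "len (s \<kappa> j) = bound \<kappa> (Suc j)" for \<kappa> j
    by (simp add: len_def s_def bound_def stage_Suc)
  have s_inj: "j = k" if "s \<kappa> j = s \<kappa> k" for \<kappa> j k
  proof -
    have "bound \<kappa> j = bound \<kappa> k" using that by (simp add: s_def bound_def)
    then show ?thesis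
      using block_unique[of \<kappa> j "bound \<kappa> j" k] bound_less[of \<kappa> j] bound_less[of \<kappa> k] by simp
  qed
  define v where "v = {(stage_ray \<kappa> l, \<iota> (s \<kappa> j) l) | \<kappa> j l. bound \<kappa> j \<le> l \<and> l < bound \<kappa> (Suc j)}"
  have vI: "(stage_ray \<kappa> l, \<iota> (s \<kappa> j) l) \<in> v" if "bound \<kappa> j \<le> l" "l < bound \<kappa> (Suc j)" for \<kappa> j l
    using that unfolding v_def by blast
  have biv: "biunique v"
  proof (rule biuniqueI)
    fix x y z assume "(x, y) \<in> v" "(x, z) \<in> v"
    then obtain \<kappa> \<kappa>' j k l m where x: "x = stage_ray \<kappa> l" "x = stage_ray \<kappa>' m"
      and y: "y = \<iota> (s \<kappa> j) l" "z = \<iota> (s \<kappa>' k) m"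
      and l: "bound \<kappa> j \<le> l" "l < bound \<kappa> (Suc j)" and m: "bound \<kappa>' k \<le> m" "m < bound \<kappa>' (Suc k)"
      unfolding v_def by blast
    have lm: "m = l" using x stage_ray_lev(1) by metis
    have "stage_ray \<kappa> l = stage_ray \<kappa>' l" using x lm by simp
    from block_agree[OF this l m[unfolded lm]] have "s \<kappa> j = s \<kappa>' k" unfolding s_def by metis
    then show "y = z" using y lm by simp
  next
    fix x y z assume "(x, z) \<in> v" "(y, z) \<in> v"
    then obtain \<kappa> \<kappa>' j k l m where x: "x = stage_ray \<kappa> l" "y = stage_ray \<kappa>' m"
      and z: "z = \<iota> (s \<kappa> j) l" "z = \<iota> (s \<kappa>' k) m"
      and l: "bound \<kappa> j \<le> l" "l < bound \<kappa> (Suc j)" and m: "bound \<kappa>' k \<le> m" "m < bound \<kappa>' (Suc k)"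
      unfolding v_def by blast
    have "s \<kappa> j = s \<kappa>' k \<and> l = m"
    proof (rule \<iota>_inj[OF sJ sJ])
      show "l < 2 * len (s \<kappa> j)" "m < 2 * len (s \<kappa>' k)" using l m by (simp_all add: slen)
      show "\<iota> (s \<kappa> j) l = \<iota> (s \<kappa>' k) m" using z(1) z(2) by (rule subst)
    qed
    then show "x = y" using stage_ray_block[OF _ _ l(2), of \<kappa>' k] x by (simp add: s_def)
  qed
  have "\<iota> (s \<kappa> j) l \<in> X" if "l < bound \<kappa> (Suc j)" for \<kappa> j l
    using PX[OF \<Phi>(2)[OF sJ] \<iota>[OF sJ]] that by (simp add: slen)
  then have vX: "v \<subseteq> V \<times> X"
    unfolding v_def using stage_ray_lev(2) by blast
  have main: "\<exists>\<sigma>. biunique \<sigma> \<and> chart \<sigma> \<in> PStab X \<P> \<and>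
      (\<forall>l m. (\<exists>a b. (stage_ray \<kappa> l, a) \<in> v \<and> (a, b) \<in> \<sigma> \<and> (stage_ray \<kappa> m, b) \<in> v) \<longleftrightarrow> (l, m) \<in> g)"
    if g: "biunique g" "block_preserving \<kappa> g" for \<kappa> g
  proof -
    have gblock: "\<exists>j. bound \<kappa> j \<le> l \<and> l < bound \<kappa> (Suc j) \<and> bound \<kappa> j \<le> m \<and> m < bound \<kappa> (Suc j)"
      if "(l, m) \<in> g" for l m
      using g(2) that unfolding block_preserving_def by blast
    have gm: "m < bound \<kappa> (Suc j)" if "(l, m) \<in> g" "bound \<kappa> j \<le> l" "l < bound \<kappa> (Suc j)" for l m j
      using gblock[OF that(1)] block_unique[OF that(2,3)] by blast
    \<comment> \<open>A level without image under \<open>g\<close> is shifted by the upper end of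
      its block, into the spare half. Otherwise the completion to a permutation might map it back
      into the block and create a pair outside \<open>g\<close>.\<close>
    define H where "H j l m \<longleftrightarrow> bound \<kappa> j \<le> l \<and> l < bound \<kappa> (Suc j) \<and>
      ((l, m) \<in> g \<or> l \<notin> Domain g \<and> m = l + bound \<kappa> (Suc j))" for j l m
    have Hlen: "l < 2 * len (s \<kappa> j)" "m < 2 * len (s \<kappa> j)" if "H j l m" for j l m
      using that gm[of l m j] unfolding H_def slen by auto
    have Hr: "m = m'" if "H j l m" "H j l m'" for j l m m'
      using that biunique_right[OF g(1)] unfolding H_def by blast
    have Hl: "l = l'" if "H j l m" "H j l' m" for j l l' m
    proof -
      consider "(l, m) \<in> g" "(l', m) \<in> g" | "(l, m) \<in> g" "m = l' + bound \<kappa> (Suc j)"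
        | "(l', m) \<in> g" "m = l + bound \<kappa> (Suc j)" | "m = l + bound \<kappa> (Suc j)" "m = l' + bound \<kappa> (Suc j)"
        using \<open>H j l m\<close> \<open>H j l' m\<close> unfolding H_def by blast
      then show ?thesis
        using gm[of l m j] gm[of l' m j] that biunique_left[OF g(1)] unfolding H_def by cases auto
    qed
    define R where "R = {(\<iota> (s \<kappa> j) l, \<iota> (s \<kappa> j) m) | j l m. H j l m}"
    have biR: "biunique R"
    proof (rule biuniqueI)
      fix x y z assume "(x, y) \<in> R" "(x, z) \<in> R"
      then obtain j k l l' m m' where h: "H j l m" "H k l' m'"
        and x: "x = \<iota> (s \<kappa> j) l" "x = \<iota> (s \<kappa> k) l'" and y: "y = \<iota> (s \<kappa> j) m" "z = \<iota> (s \<kappa> k) m'"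
        unfolding R_def by blast
      have "s \<kappa> j = s \<kappa> k \<and> l = l'"
        by (rule \<iota>_inj[OF sJ sJ Hlen(1)[OF h(1)] Hlen(1)[OF h(2)] trans[OF x(1)[symmetric] x(2)]])
      then have "j = k" "l = l'" using s_inj by blast+
      then show "y = z" using Hr[of j l m m'] h y by simp
    next
      fix x y z assume "(x, z) \<in> R" "(y, z) \<in> R"
      then obtain j k l l' m m' where h: "H j l m" "H k l' m'"
        and x: "x = \<iota> (s \<kappa> j) l" "y = \<iota> (s \<kappa> k) l'" and y: "z = \<iota> (s \<kappa> j) m" "z = \<iota> (s \<kappa> k) m'"
        unfolding R_def by blast
      have "s \<kappa> j = s \<kappa> k \<and> m = m'"
        by (rule \<iota>_inj[OF sJ sJ Hlen(2)[OF h(1)] Hlen(2)[OF h(2)] trans[OF y(1)[symmetric] y(2)]])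
      then have "j = k" "m = m'" using s_inj by blast+
      then show "x = y" using Hl[of j l m l'] h x by simp
    qed
    have Rpart: "\<exists>A\<in>\<P>. x \<in> A \<and> y \<in> A" if "(x, y) \<in> R" for x y
    proof -
      obtain j l m where h: "H j l m" "x = \<iota> (s \<kappa> j) l" "y = \<iota> (s \<kappa> j) m"
        using \<open>(x, y) \<in> R\<close> unfolding R_def by blast
      then show ?thesis using \<iota>[OF sJ Hlen(1)[OF h(1)]] \<iota>[OF sJ Hlen(2)[OF h(1)]] \<Phi>(2)[OF sJ] by blast
    qed
    obtain \<sigma> where \<sigma>: "R \<subseteq> \<sigma>" "biunique \<sigma>" "chart \<sigma> \<in> PStab X \<P>"
      using PStab_extension[OF part finP biR Rpart] by metis
    have "(\<exists>a b. (stage_ray \<kappa> l, a) \<in> v \<and> (a, b) \<in> \<sigma> \<and> (stage_ray \<kappa> m, b) \<in> v) \<longleftrightarrow> (l, m) \<in> g" for l m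
    proof
      assume "\<exists>a b. (stage_ray \<kappa> l, a) \<in> v \<and> (a, b) \<in> \<sigma> \<and> (stage_ray \<kappa> m, b) \<in> v"
      then obtain a b where ab: "(stage_ray \<kappa> l, a) \<in> v" "(a, b) \<in> \<sigma>" "(stage_ray \<kappa> m, b) \<in> v" by blast
      have lev0: "Suc (lev y0) \<le> n" if "(stage_ray \<kappa> n, c) \<in> v" for n c
      proof -
        obtain \<kappa>' j l where "stage_ray \<kappa> n = stage_ray \<kappa>' l" "bound \<kappa>' j \<le> l"
          using \<open>(stage_ray \<kappa> n, c) \<in> v\<close> unfolding v_def by blast
        then have "l = n" "bound \<kappa>' 0 \<le> l" using stage_ray_lev(1) bound_mono[of 0 j \<kappa>'] by (metis, simp)
        then show ?thesis by (simp add: bound_0)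
      qed
      obtain j where j: "bound \<kappa> j \<le> l" "l < bound \<kappa> (Suc j)" using block_exists[OF lev0[OF ab(1)]] by blast
      obtain k where k: "bound \<kappa> k \<le> m" "m < bound \<kappa> (Suc k)" using block_exists[OF lev0[OF ab(3)]] by blast
      have a: "a = \<iota> (s \<kappa> j) l" using biunique_right[OF biv ab(1) vI[OF j]] .
      have b: "b = \<iota> (s \<kappa> k) m" using biunique_right[OF biv ab(3) vI[OF k]] .
      obtain m' where m': "H j l m'" using j unfolding H_def by blast
      then have "(a, \<iota> (s \<kappa> j) m') \<in> \<sigma>" using \<sigma>(1) a unfolding R_def by blast
      then have b': "b = \<iota> (s \<kappa> j) m'" using biunique_right[OF \<sigma>(2) ab(2)] by blast
      have "s \<kappa> k = s \<kappa> j \<and> m = m'"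
        by (rule \<iota>_inj[OF sJ sJ _ Hlen(2)[OF m'] trans[OF b[symmetric] b']]) (use k in \<open>simp add: slen\<close>)
      then have "m = m'" "k = j" using s_inj by blast+
      then show "(l, m) \<in> g" using m' k unfolding H_def by auto
    next
      assume lm: "(l, m) \<in> g"
      then obtain j where j: "bound \<kappa> j \<le> l" "l < bound \<kappa> (Suc j)" "bound \<kappa> j \<le> m" "m < bound \<kappa> (Suc j)"
        using gblock by blast
      have "(\<iota> (s \<kappa> j) l, \<iota> (s \<kappa> j) m) \<in> \<sigma>" using \<sigma>(1) lm j unfolding R_def H_def by blast
      then show "\<exists>a b. (stage_ray \<kappa> l, a) \<in> v \<and> (a, b) \<in> \<sigma> \<and> (stage_ray \<kappa> m, b) \<in> v"
        using vI[OF j(1,2)] vI[OF j(3,4)] by blast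
    qed
    then show ?thesis using \<sigma>(2,3) by blast
  qed
  show ?thesis using biv vX main by blast
qed

end

section \<open>Arbitrary charts from two block-preserving maps\<close>

lemma finite_biunique_Image:
  assumes "biunique R" "finite A"
  shows "finite (R `` A)"
proof -
  have "finite (R `` {a})" for a
  proof (cases "\<exists>b. (a, b) \<in> R")
    case True
    then obtain b where "(a, b) \<in> R" ..
    then have "R `` {a} \<subseteq> {b}" using biunique_right[OF assms(1)] by blast
    then show ?thesis by (rule finite_subset) simp
  next
    case False
    then have "R `` {a} = {}" by blast
    then show ?thesis by simp
  qed
  then have "finite (\<Union>a\<in>A. R `` {a})" using assms(2) by blast
  moreover have "R `` A = (\<Union>a\<in>A. R `` {a})" by blast
  ultimately show ?thesis by simp
qed

lemma biunique_Un_Id: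
  fixes e :: "('a \<times> 'a) set"
  assumes e: "biunique e" and d: "\<And>x y. (x, y) \<in> d \<Longrightarrow> x = y \<and> x \<notin> Domain e \<and> x \<notin> Range e"
  shows "biunique (e \<union> d)"
proof (rule biuniqueI)
  fix x y z assume "(x, y) \<in> e \<union> d" "(x, z) \<in> e \<union> d"
  then show "y = z" using d[of x y] d[of x z] biunique_right[OF e, of x y z] by (elim UnE) auto
next
  fix x y z assume "(x, z) \<in> e \<union> d" "(y, z) \<in> e \<union> d"
  then show "x = y" using d[of x z] d[of y z] biunique_left[OF e, of x z y] by (elim UnE) auto
qed

lemma biunique_subset: "biunique R \<Longrightarrow> S \<subseteq> R \<Longrightarrow> biunique S"
  unfolding biunique_def by (meson converse_mono single_valued_subset)

text \<open>The bounds of the two block systems interleave and grow so fast that a pair separated by a bound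
  of the first system lies well inside a block of the second.\<close>

lemma (in wide_tree) split_into_blocks:
  assumes f: "biunique f" and low: "\<And>l m. (l, m) \<in> f \<Longrightarrow> Suc (lev y0) \<le> l \<and> Suc (lev y0) \<le> m"
  shows "\<exists>\<kappa> \<kappa>' f1 f2. f = f1 \<union> f2 \<and> f1 \<inter> f2 = {} \<and> block_preserving \<kappa> f1 \<and> block_preserving \<kappa>' f2"
proof -
  \<comment> \<open>Bounding images and preimages alike allows the smaller entry of a pair to be
    taken as \<open>l\<close> below.\<close>
  have "\<forall>n. \<exists>N. \<forall>l m. (l, m) \<in> f \<union> f\<inverse> \<longrightarrow> l < n \<longrightarrow> m < N"
  proof
    fix n :: nat
    have "finite (f `` {..<n} \<union> f\<inverse> `` {..<n})"
      using f finite_biunique_Image[of f "{..<n}"] finite_biunique_Image[of "f\<inverse>" "{..<n}"]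
      by (simp add: biunique_converse)
    then obtain N where N: "\<forall>m\<in>f `` {..<n} \<union> f\<inverse> `` {..<n}. m < N"
      using finite_nat_set_iff_bounded by blast
    then show "\<exists>N. \<forall>l m. (l, m) \<in> f \<union> f\<inverse> \<longrightarrow> l < n \<longrightarrow> m < N" by blast
  qed
  from choice[OF this] obtain F where F: "\<forall>n. \<forall>l m. (l, m) \<in> f \<union> f\<inverse> \<longrightarrow> l < n \<longrightarrow> m < F n" ..
  obtain \<kappa> \<kappa>' where "\<forall>j. F (bound \<kappa>' j) < bound \<kappa> (Suc j)" "\<forall>j. F (bound \<kappa> (Suc j)) < bound \<kappa>' (Suc j)"
    by (rule interleaved_bounds)
  then have \<kappa>: "F (bound \<kappa>' j) < bound \<kappa> (Suc j)" "F (bound \<kappa> (Suc j)) < bound \<kappa>' (Suc j)" for j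
    by simp_all
  define inb where "inb \<kappa> l m \<longleftrightarrow>
    (\<exists>j. bound \<kappa> j \<le> l \<and> l < bound \<kappa> (Suc j) \<and> bound \<kappa> j \<le> m \<and> m < bound \<kappa> (Suc j))" for \<kappa> l m
  have key: "inb \<kappa> l m \<or> inb \<kappa>' l m" if e: "(l, m) \<in> f \<union> f\<inverse>" and "l \<le> m" for l m
  proof -
    have "Suc (lev y0) \<le> l" using e low by blast
    then obtain j where j: "bound \<kappa> j \<le> l" "l < bound \<kappa> (Suc j)" using block_exists by blast
    show ?thesis
    proof (cases "m < bound \<kappa> (Suc j)")
      case True
      then show ?thesis using j \<open>l \<le> m\<close> unfolding inb_def by (meson le_trans)
    next
      \<comment> \<open>The pair crosses \<open>bound \<kappa> (Suc j)\<close>. Its large entry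
        exceeds \<open>F (bound \<kappa>' j)\<close>, so the small one is not below
        \<open>bound \<kappa>' j\<close>; its small entry is below
        \<open>bound \<kappa> (Suc j)\<close>, so the large one stays below
        \<open>bound \<kappa>' (Suc j)\<close>.\<close>
      case False
      have "m < F (bound \<kappa> (Suc j))" using F e j(2) by blast
      then have up: "m < bound \<kappa>' (Suc j)" using \<kappa>(2)[of j] by simp
      have lo: "bound \<kappa>' j \<le> l"
      proof (rule ccontr)
        assume "\<not> ?thesis"
        then have "m < F (bound \<kappa>' j)" using F e by (meson not_le)
        then show False using \<kappa>(1)[of j] False by simp
      qed
      have "inb \<kappa>' l m" unfolding inb_def using up lo \<open>l \<le> m\<close> by (intro exI[of _ j]) simp
      then show ?thesis ..
    qed
  qed
  have sym: "inb \<kappa> l m \<longleftrightarrow> inb \<kappa> m l" for \<kappa> l m unfolding inb_def by blast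
  have all: "inb \<kappa> l m \<or> inb \<kappa>' l m" if "(l, m) \<in> f" for l m
    using key[of l m] key[of m l] that sym by (cases "l \<le> m") auto
  define f1 where "f1 = {(l, m). (l, m) \<in> f \<and> inb \<kappa> l m}"
  define f2 where "f2 = {(l, m). (l, m) \<in> f \<and> \<not> inb \<kappa> l m}"
  have "f = f1 \<union> f2" "f1 \<inter> f2 = {}" by (auto simp: f1_def f2_def)
  moreover have "block_preserving \<kappa> f1" "block_preserving \<kappa>' f2"
    using all unfolding block_preserving_def f1_def f2_def inb_def by blast+
  ultimately show ?thesis by blast
qed

lemma (in wide_tree) block_preserving_Id:
  assumes "\<And>l m. (l, m) \<in> d \<Longrightarrow> l = m \<and> Suc (lev y0) \<le> l" "block_preserving \<kappa> g"
  shows "block_preserving \<kappa> (g \<union> d)"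
  using assms block_exists unfolding block_preserving_def by blast

text \<open>A chart is rewritten as a partial injection \<open>e\<close> from source numbers to
  disjoint target numbers, and the two block-preserving halves of \<open>e\<close> are carried out
  one after the other on the levels of a reference ray.\<close>

lemma sym_inv_monoid_preceq:
  assumes T: "rooted_tree T" and VX: "gverts T \<subseteq> X" and X: "countable X" "infinite X"
    and P: "aleph0_unbounded_partition X \<P>"
    and wide: "\<And>x. x \<in> gverts T \<Longrightarrow> \<exists>y\<in>gverts T. level T x < level T y \<and>
      ancestor T y (level T x) = x \<and> infinite (ranked_tree.kids (level T) (ancestor T) (gverts T) y)"
  shows "preceq_I X (sym_inv_monoid X) (path_bijections T \<union> PStab X \<P>)"
proof -
  interpret ranked_tree "gverts T" "level T" "ancestor T" "groot T"
    by (rule ranked_tree_rooted_tree[OF T])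
  let ?V = "gverts T"
  define I where "I = {y \<in> ?V. infinite (kids ?V y)}"
  have "\<exists>c n. inj c \<and> (\<forall>K. n K \<in> I \<and> K \<le> level T (n K) \<and> level T y < level T (n K) \<and>
      ancestor T (n K) (level T y) = y \<and> ancestor T (n K) (Suc (level T y)) = c K)" if y: "y \<in> I" for y
  proof -
    obtain c :: "nat \<Rightarrow> 'a" where c: "inj c" "range c \<subseteq> kids ?V y"
      using infinite_countable_subset[of "kids ?V y"] y unfolding I_def by blast
    have "\<exists>z. z \<in> I \<and> K \<le> level T z \<and> level T y < level T z \<and>
      ancestor T z (level T y) = y \<and> ancestor T z (Suc (level T y)) = c K" for K
    proof -
      have cK: "c K \<in> ?V" "level T (c K) = Suc (level T y)" "ancestor T (c K) (level T y) = y"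
        using c(2) unfolding kids_def by blast+
      obtain n z where z: "K \<le> n" "z \<in> below (c K) n" "infinite (kids ?V z)" "level T (c K) < n"
        using below_unbounded[of "\<lambda>y. infinite (kids ?V y)" "c K" K, OF wide cK(1)] by blast
      then have zV: "z \<in> ?V" "level T z = n" "ancestor T z (level T (c K)) = c K"
        unfolding below_def by blast+
      have "ancestor T z (level T y) = y"
        using anc_anc[OF zV(1), of "level T y" "level T (c K)"] zV cK z(4) by simp
      then show ?thesis using z zV cK unfolding I_def by (intro exI[of _ z]) simp
    qed
    then have "\<forall>K. \<exists>z. z \<in> I \<and> K \<le> level T z \<and> level T y < level T z \<and>
      ancestor T z (level T y) = y \<and> ancestor T z (Suc (level T y)) = c K" by blast
    from choice[OF this] c(1) show ?thesis by blast
  qed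
  then have "\<forall>y. \<exists>c n. y \<in> I \<longrightarrow> inj c \<and> (\<forall>K. n K \<in> I \<and> K \<le> level T (n K) \<and> level T y < level T (n K) \<and>
      ancestor T (n K) (level T y) = y \<and> ancestor T (n K) (Suc (level T y)) = c K)"
    by blast
  from choice[OF this] obtain ch where
    "\<forall>y. \<exists>n. y \<in> I \<longrightarrow> inj (ch y) \<and> (\<forall>K. n K \<in> I \<and> K \<le> level T (n K) \<and> level T y < level T (n K) \<and>
      ancestor T (n K) (level T y) = y \<and> ancestor T (n K) (Suc (level T y)) = ch y K)" ..
  from choice[OF this] obtain nx where
    cn: "\<forall>y. y \<in> I \<longrightarrow> inj (ch y) \<and> (\<forall>K. nx y K \<in> I \<and> K \<le> level T (nx y K) \<and> level T y < level T (nx y K) \<and>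
      ancestor T (nx y K) (level T y) = y \<and> ancestor T (nx y K) (Suc (level T y)) = ch y K)" ..
  obtain y0 where y0: "y0 \<in> I" using wide[OF rt_in] unfolding I_def by blast
  interpret wide_tree ?V "level T" "ancestor T" "groot T" I ch nx y0
  proof
    show "y0 \<in> I" "I \<subseteq> ?V" using y0 by (auto simp: I_def)
    fix y K K' assume "y \<in> I"
    then show "ch y K = ch y K' \<Longrightarrow> K = K'" "nx y K \<in> I" "K \<le> level T (nx y K)"
      "level T y < level T (nx y K)" "ancestor T (nx y K) (level T y) = y"
      "ancestor T (nx y K) (Suc (level T y)) = ch y K"
      using cn by (auto dest: injD)
  qed
  obtain v where v: "biunique v" "v \<subseteq> ?V \<times> X"
    and vP: "\<forall>\<kappa> g. biunique g \<longrightarrow> block_preserving \<kappa> g \<longrightarrow> (\<exists>\<sigma>. biunique \<sigma> \<and> chart \<sigma> \<in> PStab X \<P> \<and>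
      (\<forall>l m. (\<exists>a b. (stage_ray \<kappa> l, a) \<in> v \<and> (a, b) \<in> \<sigma> \<and> (stage_ray \<kappa> m, b) \<in> v) \<longleftrightarrow> (l, m) \<in> g))"
    using block_maps_via_PStab[OF VX X P] by blast
  define r where "r = stage_ray (\<lambda>_. 0)"
  have r: "r \<in> rays ?V" unfolding r_def by (rule stage_ray)
  have r_lev: "level T (r n) = n" "r n \<in> ?V" for n unfolding r_def by (rule stage_ray_lev)+
  have r_inj: "l = m" if "r l = r m" for l m using r_lev(1) that by metis
  define b where "b = Suc (level T y0)"
  \<comment> \<open>Sources get even and targets odd offsets from \<open>b\<close>, the level where
    the blocks of every \<open>\<kappa>\<close> start.\<close>
  define c where "c x = b + 2 * to_nat_on X x" for x
  define c' where "c' x = Suc (c x)" for x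
  have c_inj: "x = y" if "c x = c y" "x \<in> X" "y \<in> X" for x y
    using inj_on_to_nat_on[OF X(1)] that by (simp add: c_def inj_on_def)
  have c'_inj: "x = y" if "c' x = c' y" "x \<in> X" "y \<in> X" for x y
    using c_inj that by (simp add: c'_def)
  have cc': "c x \<noteq> c' y" for x y unfolding c_def c'_def by presburger
  have cb: "b \<le> c x" "b \<le> c' x" for x by (simp_all add: c_def c'_def)
  define \<epsilon> where "\<epsilon> = {(x, r (c x)) | x. x \<in> X}"
  define \<epsilon>' where "\<epsilon>' = {(x, r (c' x)) | x. x \<in> X}"
  have bi\<epsilon>: "biunique \<epsilon>" "biunique \<epsilon>'"
    unfolding \<epsilon>_def \<epsilon>'_def by (rule biuniqueI; blast dest: r_inj c_inj c'_inj)+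
  have sub\<epsilon>: "\<epsilon> \<subseteq> X \<times> X" "\<epsilon>' \<subseteq> X \<times> X"
    using VX r_lev(2) unfolding \<epsilon>_def \<epsilon>'_def by blast+
  define C where "C = chart ` {v, v\<inverse>, \<epsilon>, \<epsilon>'\<inverse>}"
  have "v \<subseteq> X \<times> X" "v\<inverse> \<subseteq> X \<times> X" "\<epsilon>'\<inverse> \<subseteq> X \<times> X" using v(2) VX sub\<epsilon> by blast+
  then have CX: "C \<subseteq> sym_inv_monoid X"
    using v(1) bi\<epsilon> sub\<epsilon> by (simp add: C_def chart_in_sym_inv_monoid biunique_converse)
  have Cc: "countable C" by (simp add: C_def)
  let ?G = "semigroup_gen (path_bijections T \<union> PStab X \<P> \<union> C)"
  have gens: "chart v \<in> ?G" "chart (v\<inverse>) \<in> ?G" "chart \<epsilon> \<in> ?G" "chart (\<epsilon>'\<inverse>) \<in> ?G"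
    by (auto simp: C_def intro: semigroup_gen.base)
  \<comment> \<open>\<open>lift g\<close> performs \<open>g\<close> on the levels of
    \<open>r\<close>. It is generated by passing to the ray of a \<open>\<kappa>\<close> whose
    blocks \<open>g\<close> preserves, applying \<open>\<sigma>\<close> conjugated by
    \<open>v\<close>, and passing back; \<open>v\<close> is the same for all
    \<open>\<kappa>\<close>.\<close>
  define lift where "lift g = {(r l, r m) | l m. (l, m) \<in> g}" for g
  have lift: "chart (lift g) \<in> ?G \<and> biunique (lift g)" if g: "biunique g" "block_preserving \<kappa> g" for g \<kappa>
  proof -
    obtain \<sigma> where \<sigma>: "biunique \<sigma>" "chart \<sigma> \<in> PStab X \<P>" and
      eq: "\<forall>l m. (\<exists>a b. (stage_ray \<kappa> l, a) \<in> v \<and> (a, b) \<in> \<sigma> \<and> (stage_ray \<kappa> m, b) \<in> v) \<longleftrightarrow> (l, m) \<in> g"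
      using vP g by blast
    let ?q = "stage_ray \<kappa>"
    let ?in = "{(r i, ?q i) | i. True}" and ?out = "{(?q i, r i) | i. True}"
    note pin = ray_chart_path_bijection[OF T r stage_ray[of \<kappa>]]
    note pout = ray_chart_path_bijection[OF T stage_ray[of \<kappa>] r]
    have io: "chart ?in \<in> ?G" "chart ?out \<in> ?G" "chart \<sigma> \<in> ?G"
      using pin(2) pout(2) \<sigma>(2) by (auto intro: semigroup_gen.base)
    have eq: "lift g = ?in O v O \<sigma> O v\<inverse> O ?out"
    proof (intro set_eqI iffI)
      fix p assume "p \<in> lift g"
      then obtain l m where p: "p = (r l, r m)" "(l, m) \<in> g" unfolding lift_def by blast
      then obtain a d where "(?q l, a) \<in> v" "(a, d) \<in> \<sigma>" "(?q m, d) \<in> v" using eq by blast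
      moreover have "(r l, ?q l) \<in> ?in" "(?q m, r m) \<in> ?out" by blast+
      ultimately show "p \<in> ?in O v O \<sigma> O v\<inverse> O ?out" unfolding p(1) by (meson converseI relcompI)
    next
      fix p assume "p \<in> ?in O v O \<sigma> O v\<inverse> O ?out"
      then obtain l m a d where p: "p = (r l, r m)" "(?q l, a) \<in> v" "(a, d) \<in> \<sigma>" "(?q m, d) \<in> v"
        by blast
      then have "(l, m) \<in> g" using eq by blast
      then show "p \<in> lift g" unfolding p(1) lift_def by blast
    qed
    show ?thesis unfolding eq
      using gens io v(1) biunique_converse[OF v(1)] pin(1) pout(1) \<sigma>(1)
      by (intro conjI chart_O_gen biunique_O)
  qed
  have "sym_inv_monoid X \<subseteq> ?G"
  proof
    fix f assume f: "f \<in> sym_inv_monoid X"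
    have fX: "x \<in> X \<and> y \<in> X" if "f x = Some y" for x y
      using graph_subset[OF f] that by (auto simp: Map.graph_def)
    have f_inj: "x = x'" if "f x = Some y" "f x' = Some y" for x x' y
      using biunique_left[OF biunique_graph[OF f], of x y x'] that by (simp add: Map.graph_def)
    define e where "e = {(c x, c' y) | x y. f x = Some y}"
    have eD: "\<exists>x y. l = c x \<and> m = c' y \<and> f x = Some y" if "(l, m) \<in> e" for l m
      using that unfolding e_def by blast
    have bie: "biunique e"
    proof (rule biuniqueI)
      fix x y z assume "(x, y) \<in> e" "(x, z) \<in> e"
      then obtain s t s' t' where st: "x = c s" "y = c' t" "f s = Some t" "x = c s'" "z = c' t'" "f s' = Some t'"
        using eD by metis
      then have "s = s'" using c_inj fX by metis
      then show "y = z" using st by simp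
    next
      fix x y z assume "(x, z) \<in> e" "(y, z) \<in> e"
      then obtain s t s' t' where st: "x = c s" "z = c' t" "f s = Some t" "y = c s'" "z = c' t'" "f s' = Some t'"
        using eD by metis
      then have "t = t'" using c'_inj fX by metis
      then have "s = s'" using f_inj st(3,6) by blast
      then show "x = y" using st by simp
    qed
    have low: "Suc (level T y0) \<le> l \<and> Suc (level T y0) \<le> m" if "(l, m) \<in> e" for l m
      using eD[OF that] cb unfolding b_def by blast
    obtain \<kappa> \<kappa>' e1 e2 where e12: "e = e1 \<union> e2" "e1 \<inter> e2 = {}"
      and bp: "block_preserving \<kappa> e1" "block_preserving \<kappa>' e2"
      using split_into_blocks[OF bie low] by blast
    \<comment> \<open>\<open>d1\<close> lets the sources not moved by \<open>e1\<close> wait for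
      \<open>e2\<close>, and \<open>d2\<close> keeps the targets that \<open>e2\<close> does not
      reach. As sources and targets are disjoint, the enlarged maps stay biunique and their product
      contains no source-target pair outside \<open>e\<close>.\<close>
    define d1 where "d1 = {(c x, c x) | x. x \<in> X \<and> c x \<notin> Domain e1}"
    define d2 where "d2 = {(c' y, c' y) | y. y \<in> X \<and> c' y \<notin> Range e2}"
    have e1: "(l, m) \<in> e1 \<Longrightarrow> \<exists>x y. l = c x \<and> m = c' y \<and> f x = Some y"
      and e2: "(l, m) \<in> e2 \<Longrightarrow> \<exists>x y. l = c x \<and> m = c' y \<and> f x = Some y" for l m
      using eD e12(1) by blast+
    have bi1: "biunique (e1 \<union> d1)"
    proof (rule biunique_Un_Id)
      show "biunique e1" by (rule biunique_subset[OF bie]) (simp add: e12(1))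
      fix x y assume "(x, y) \<in> d1"
      then obtain s where s: "x = c s" "y = c s" "c s \<notin> Domain e1" unfolding d1_def by blast
      have "c s \<notin> Range e1"
      proof
        assume "c s \<in> Range e1"
        then obtain l where "(l, c s) \<in> e1" by (rule RangeE)
        then obtain t where "c s = c' t" using e1 by blast
        then show False using cc' by blast
      qed
      then show "x = y \<and> x \<notin> Domain e1 \<and> x \<notin> Range e1" using s by simp
    qed
    have bi2: "biunique (e2 \<union> d2)"
    proof (rule biunique_Un_Id)
      show "biunique e2" by (rule biunique_subset[OF bie]) (simp add: e12(1))
      fix x y assume "(x, y) \<in> d2"
      then obtain s where s: "x = c' s" "y = c' s" "c' s \<notin> Range e2" unfolding d2_def by blast
      have "c' s \<notin> Domain e2"
      proof
        assume "c' s \<in> Domain e2"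
        then obtain m where "(c' s, m) \<in> e2" by (rule DomainE)
        then obtain t where "c' s = c t" using e2 by blast
        then show False using cc'[of t s] by simp
      qed
      then show "x = y \<and> x \<notin> Domain e2 \<and> x \<notin> Range e2" using s by simp
    qed
    have "block_preserving \<kappa> (e1 \<union> d1)"
      by (rule block_preserving_Id[OF _ bp(1)]) (use cb in \<open>auto simp: d1_def b_def\<close>)
    note l1 = lift[OF bi1 this]
    have "block_preserving \<kappa>' (e2 \<union> d2)"
      by (rule block_preserving_Id[OF _ bp(2)]) (use cb in \<open>auto simp: d2_def b_def\<close>)
    note l2 = lift[OF bi2 this]
    have eq: "Map.graph f = \<epsilon> O lift (e1 \<union> d1) O lift (e2 \<union> d2) O \<epsilon>'\<inverse>"
    proof (intro set_eqI iffI)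
      fix p assume "p \<in> Map.graph f"
      then obtain x y where p: "p = (x, y)" and xy: "f x = Some y" by (auto simp: Map.graph_def)
      have X': "x \<in> X" "y \<in> X" using fX[OF xy] by auto
      have "(c x, c' y) \<in> e" using xy unfolding e_def by blast
      then consider "(c x, c' y) \<in> e1" "(c x, c' y) \<notin> e2" | "(c x, c' y) \<in> e2" "(c x, c' y) \<notin> e1"
        using e12 by blast
      then have "\<exists>m. (c x, m) \<in> e1 \<union> d1 \<and> (m, c' y) \<in> e2 \<union> d2"
      proof cases
        case 1
        have "c' y \<notin> Range e2"
        proof
          assume "c' y \<in> Range e2"
          then obtain l where l: "(l, c' y) \<in> e2" by blast
          then have "l = c x" using biunique_left[OF bie, of l "c' y" "c x"] 1(1) e12(1) by blast
          then show False using l 1(2) by blast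
        qed
        then have "(c' y, c' y) \<in> d2" using X' unfolding d2_def by blast
        then show ?thesis using 1(1) by blast
      next
        case 2
        have "c x \<notin> Domain e1"
        proof
          assume "c x \<in> Domain e1"
          then obtain m where m: "(c x, m) \<in> e1" by blast
          then have "m = c' y" using biunique_right[OF bie, of "c x" m "c' y"] 2(1) e12(1) by blast
          then show False using m 2(2) by blast
        qed
        then have "(c x, c x) \<in> d1" using X' unfolding d1_def by blast
        then show ?thesis using 2(1) by blast
      qed
      then obtain m where "(r (c x), r m) \<in> lift (e1 \<union> d1)" "(r m, r (c' y)) \<in> lift (e2 \<union> d2)"
        unfolding lift_def by blast
      moreover have "(x, r (c x)) \<in> \<epsilon>" "(y, r (c' y)) \<in> \<epsilon>'" using X' unfolding \<epsilon>_def \<epsilon>'_def by blast+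
      ultimately show "p \<in> \<epsilon> O lift (e1 \<union> d1) O lift (e2 \<union> d2) O \<epsilon>'\<inverse>"
        unfolding p by (meson converseI relcompI)
    next
      fix p assume "p \<in> \<epsilon> O lift (e1 \<union> d1) O lift (e2 \<union> d2) O \<epsilon>'\<inverse>"
      then obtain x z w w' where p: "p = (x, z)" "(x, r (c x)) \<in> \<epsilon>" "x \<in> X" "z \<in> X"
        and w: "(r (c x), w) \<in> lift (e1 \<union> d1)" "(w, w') \<in> lift (e2 \<union> d2)" "w' = r (c' z)"
        unfolding \<epsilon>_def \<epsilon>'_def by blast
      obtain l m where lm: "r (c x) = r l" "w = r m" "(l, m) \<in> e1 \<union> d1" using w(1) unfolding lift_def by blast
      obtain m' n where mn: "w = r m'" "w' = r n" "(m', n) \<in> e2 \<union> d2" using w(2) unfolding lift_def by blast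
      have "l = c x" "m' = m" "n = c' z" using r_inj lm(1,2) mn(1,2) w(3) by metis+
      then have 1: "(c x, m) \<in> e1 \<union> d1" and 2: "(m, c' z) \<in> e2 \<union> d2" using lm mn by blast+
      have "(c x, c' z) \<in> e"
      proof (cases "(c x, m) \<in> e1")
        case True
        then obtain y where "m = c' y" using e1 by blast
        then have "(m, c' z) \<notin> e2" using e2[of m "c' z"] cc' by metis
        then have "(m, c' z) \<in> d2" using 2 by blast
        then have "m = c' z" unfolding d2_def by auto
        then show ?thesis using True e12(1) by blast
      next
        case False
        then have "(c x, m) \<in> d1" using 1 by blast
        then have "m = c x" unfolding d1_def by auto
        moreover have "(m, c' z) \<notin> d2" using calculation cc' unfolding d2_def by auto
        ultimately show ?thesis using 2 e12(1) by blast
      qed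
      then obtain s t where st: "c x = c s" "c' z = c' t" "f s = Some t" using eD by metis
      then have "x = s" "z = t" using c_inj c'_inj p(3,4) fX[OF st(3)] by blast+
      then show "p \<in> Map.graph f" using st(3) p(1) by (simp add: Map.graph_def)
    qed
    have "chart (Map.graph f) \<in> ?G"
      unfolding eq using gens l1 l2 bi\<epsilon> biunique_converse[OF bi\<epsilon>(2)]
      by (intro chart_O_gen biunique_O) simp_all
    then show "f \<in> ?G" by (simp add: chart_graph)
  qed
  then show ?thesis by (rule preceq_I_via_countable[OF X Cc CX])
qed

lemma preceq_I_Un:
  assumes "preceq_I X S1 S"
  shows "preceq_I X (S \<union> S1) S"
proof -
  obtain U where U: "finite U" "U \<subseteq> sym_inv_monoid X" "S1 \<subseteq> semigroup_gen (S \<union> U)"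
    using assms unfolding preceq_I_def by blast
  then have "S \<union> S1 \<subseteq> semigroup_gen (S \<union> U)" by (auto intro: semigroup_gen.base)
  then show ?thesis unfolding preceq_I_def using U by blast
qed

theorem theorem5p39:
  fixes X :: "'a set" and T :: "'a rooted_graph" and \<P>\<^sub>\<omega> :: "'a set set"
  assumes "countable X" and "infinite X"
    and "rooted_tree T" and "gverts T = X"
    and "aleph0_unbounded_partition X \<P>\<^sub>\<omega>"
  shows
    "((\<exists>T'. subtree T' T \<and> (\<forall>x\<in>gverts T'. \<exists>y. descendant T' x y \<and> vdegree T' y = \<infinity>)) \<and>
        approx_I X (path_bijections T) (sym_inv_monoid X)) \<or>
     (\<not> (\<exists>T'. subtree T' T \<and> (\<forall>x\<in>gverts T'. \<exists>y. descendant T' x y \<and> vdegree T' y = \<infinity>)) \<and>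
        (\<exists>T'. subtree T' T \<and> (\<forall>x\<in>gverts T'. \<exists>y. descendant T' x y \<and> vdegree T' y \<ge> 3)) \<and>
        approx_I X (path_bijections T) (PStab X \<P>\<^sub>\<omega>)) \<or>
     (countable (root_paths T) \<and> approx_I X (path_bijections T) {})"
    (is "(?wide \<and> _) \<or> (\<not> ?wide \<and> ?branching \<and> _) \<or> _")
proof -
  note X = assms(1,2) and T = assms(3) and V = assms(4) and P = assms(5)
  interpret ranked_tree "gverts T" "level T" "ancestor T" "groot T"
    by (rule ranked_tree_rooted_tree[OF T])
  have PStab: "preceq_I X (PStab X \<P>\<^sub>\<omega>) (path_bijections T)"
    if T': "subtree T' T" and desc: "\<forall>x\<in>gverts T'. \<exists>y. descendant T' x y \<and> vdegree T' y \<ge> 3" for T'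
  proof -
    have rt': "rooted_tree T'" "gverts T' \<subseteq> X" using T' V by (auto simp: subtree_def)
    have "preceq_I X (PStab X \<P>\<^sub>\<omega>) (path_bijections T')"
    proof (rule PStab_preceq_path_bijections[OF rt' X P])
      fix x assume "x \<in> gverts T'"
      then obtain y where y: "descendant T' x y" "vdegree T' y \<ge> 3" using desc by blast
      show "\<exists>y\<in>gverts T'. level T' x < level T' y \<and> ancestor T' y (level T' x) = x \<and>
        (\<exists>a b. a \<in> ranked_tree.kids (level T') (ancestor T') (gverts T') y \<and>
          b \<in> ranked_tree.kids (level T') (ancestor T') (gverts T') y \<and> a \<noteq> b)"
        using descendantD[OF rt'(1) y(1)] vdegree_3D[OF rt'(1) y(2)] by blast
    qed
    then show ?thesis
      using preceq_I_trans preceq_I_subset[OF subtree_path_bijections[OF T']] by blast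
  qed
  have pb: "path_bijections T \<subseteq> sym_inv_monoid X" using V by (auto simp: path_bijections_def)
  show ?thesis
  proof (cases ?wide)
    case True
    then obtain T' where T': "subtree T' T"
      and desc: "\<forall>x\<in>gverts T'. \<exists>y. descendant T' x y \<and> vdegree T' y = \<infinity>" by blast
    have rt': "rooted_tree T'" "gverts T' \<subseteq> X" using T' V by (auto simp: subtree_def)
    have "preceq_I X (sym_inv_monoid X) (path_bijections T' \<union> PStab X \<P>\<^sub>\<omega>)"
    proof (rule sym_inv_monoid_preceq[OF rt' X P])
      fix x assume "x \<in> gverts T'"
      then obtain y where y: "descendant T' x y" "vdegree T' y = \<infinity>" using desc by blast
      show "\<exists>y\<in>gverts T'. level T' x < level T' y \<and> ancestor T' y (level T' x) = x \<and>
        infinite (ranked_tree.kids (level T') (ancestor T') (gverts T') y)"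
        using descendantD[OF rt'(1) y(1)] vdegree_infD[OF rt'(1) y(2)] by blast
    qed
    moreover have "preceq_I X (path_bijections T' \<union> PStab X \<P>\<^sub>\<omega>) (path_bijections T \<union> PStab X \<P>\<^sub>\<omega>)"
      using subtree_path_bijections[OF T'] by (intro preceq_I_subset) blast
    moreover have "\<forall>x\<in>gverts T'. \<exists>y. descendant T' x y \<and> vdegree T' y \<ge> 3"
      using desc by (metis enat_ord_code(3))
    then have "preceq_I X (path_bijections T \<union> PStab X \<P>\<^sub>\<omega>) (path_bijections T)"
      by (intro preceq_I_Un PStab[OF T'])
    ultimately have "preceq_I X (sym_inv_monoid X) (path_bijections T)"
      using preceq_I_trans by blast
    then show ?thesis using True preceq_I_subset[OF pb] by (simp add: approx_I_def)
  next
    case nwide: False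
    have sb: "sigma_bounded (rays (gverts T))"
    proof (rule ccontr)
      assume nsb: "\<not> sigma_bounded (rays (gverts T))"
      obtain W where W: "prefix_closed W" "groot T \<in> W"
        and WI: "\<And>x. x \<in> W \<Longrightarrow> \<exists>y\<in>W. level T x < level T y \<and> ancestor T y (level T x) = x \<and> infinite (kids W y)"
        using not_sigma_bounded_kernel[OF _ nsb] X(1) V by blast
      have "\<forall>x\<in>gverts (induced T W). \<exists>y. descendant (induced T W) x y \<and> vdegree (induced T W) y = \<infinity>"
        using WI induced_descendant[OF T W] vdegree_induced_inf[OF T W]
        by (simp add: induced_simps[OF T W]) blast
      then show False using nwide induced_subtree[OF T W] by blast
    qed
    have up: "preceq_I X (path_bijections T) (PStab X \<P>\<^sub>\<omega>)"
      using path_bijections_preceq_PStab[OF T _ _ _ sb] X P V by simp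
    show ?thesis
    proof (cases ?branching)
      case True
      then have "preceq_I X (PStab X \<P>\<^sub>\<omega>) (path_bijections T)" using PStab by blast
      then show ?thesis using True nwide up by (simp add: approx_I_def)
    next
      case False
      have "countable (rays (gverts T))"
      proof (rule ccontr)
        assume unc: "uncountable (rays (gverts T))"
        obtain W where W: "prefix_closed W" "groot T \<in> W"
          and WI: "\<And>x. x \<in> W \<Longrightarrow> \<exists>y\<in>W. level T x < level T y \<and> ancestor T y (level T x) = x \<and>
            (\<exists>a b. a \<in> kids W y \<and> b \<in> kids W y \<and> a \<noteq> b)"
          using uncountable_rays_kernel[OF _ unc] X(1) V by blast
        have "\<forall>x\<in>gverts (induced T W). \<exists>y. descendant (induced T W) x y \<and> vdegree (induced T W) y \<ge> 3"
        proof
          fix x assume "x \<in> gverts (induced T W)"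
          then have "x \<in> W" by (simp add: induced_def)
          then obtain y a b where "y \<in> W" "level T x < level T y" "ancestor T y (level T x) = x"
            "a \<in> kids W y" "b \<in> kids W y" "a \<noteq> b" using WI by blast
          \<comment> \<open>As a proper descendant, \<open>y\<close> has positive level, so its
            parent supplies the third neighbour.\<close>
          then show "\<exists>y. descendant (induced T W) x y \<and> vdegree (induced T W) y \<ge> 3"
            using induced_descendant[OF T W] vdegree_induced_3[OF T W] by (metis gr_zeroI not_less_zero)
        qed
        then show False using False induced_subtree[OF T W] by blast
      qed
      then show ?thesis using path_bijections_countable_rays[OF T] X V by simp
    qed
  qed
qed

end
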